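(* Let $A=\mathbb{F}_q[T]$, where $q$ is a power of a prime $p$, let $\pi$ be a positive uniformizer of $\mathbb{F}_q((1/T))$, and let $e$ be a nonnegative integer. Let $X_e\subset\mathbb{Z}_p$ be the zero set of the function $\tilde S_e(t)$, $t\in\mathbb{Z}_p$. Then $X_e$ is stable under the action of $S_{(q)}$ on $t$; that is, for all $\rho_\ast\in S_{(q)}$ and $t\in \mathbb{Z}_p$, $t\in X_e$ implies $\rho_\ast(t)\in X_e$.
   Context: A positive uniformizer of $k_\infty=\mathbb{F}_q((1/T))$ is an element $\pi$ of the form $T^{-1}\cdot u$ with $u$ a $1$-unit (an element congruent to $1$ modulo the maximal ideal of $\mathbb{F}_q[[1/T]]$). For monic $f\in A$ of degree $e$ put $\langle f\rangle=\pi^ef$, a $1$-unit; $1$-units may be raised to powers $t\in\mathbb{Z}_p$ via the binomial series. Define $\tilde S_e(t):=\sum_f\langle f\rangle^t$, the sum over all monic $f\in A$ of degree $e$. $S_{(q)}$: for a permutation $\rho$ of $\{0,1,2,\dots\}$ and $x=\sum_{i\ge0}c_iq^i\in\mathbb{Z}_p$ with $0\le c_i<q$, put $\rho_\ast(x)=\sum_{i\ge0}c_iq^{\rho(i)}$; $S_{(q)}$ is the group of all bijections $\rho_\ast$ of $\mathbb{Z}_p$. *)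

theory Defs
  imports "HOL-Computational_Algebra.Computational_Algebra"
    "HOL-Number_Theory.Cong" "HOL-Library.Cardinality"
begin

section \<open>The ring of p-adic integers\<close>

text \<open>
  The ring of p-adic integers is the inverse limit of the rings Z/p^n, where the prime p is the
  characteristic of the index type.  An element is the sequence of its residues modulo p^n,
  each of them represented in {0..<p^n}; the coherence condition below subsumes this range
  condition.
\<close>

typedef (overloaded) 'a :: semiring_prime_char padic_int =
  "{x :: nat \<Rightarrow> int. \<forall>n. x (Suc n) mod int CHAR('a) ^ n = x n}"
  morphisms padic_res Abs_padic_int
  by (rule exI[of _ "\<lambda>_. 0"]) simp

setup_lifting type_definition_padic_int

lemma padic_res_Suc: "padic_res (x :: 'a :: semiring_prime_char padic_int) (Suc n) mod int CHAR('a) ^ n = padic_res x n"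
  by transfer simp

lemma padic_res_mod:
  assumes "m \<le> n"
  shows "padic_res (x :: 'a :: semiring_prime_char padic_int) n mod int CHAR('a) ^ m = padic_res x m"
  using assms
proof (induction n rule: dec_induct)
  case base
  show ?case by (metis padic_res_Suc mod_mod_trivial)
next
  case (step n)
  have "padic_res x (Suc n) mod int CHAR('a) ^ m
          = padic_res x (Suc n) mod int CHAR('a) ^ n mod int CHAR('a) ^ m"
    using step.hyps by (simp add: mod_mod_cancel le_imp_power_dvd)
  also have "\<dots> = padic_res x m"
    by (simp only: padic_res_Suc step.IH)
  finally show ?case .
qed

lemma padic_res_mod_same [simp]:
  "padic_res (x :: 'a :: semiring_prime_char padic_int) n mod int CHAR('a) ^ n = padic_res x n"
  by (rule padic_res_mod) simp

lemma padic_int_eqI: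
  assumes "\<And>n. padic_res x n = padic_res y n"
  shows "x = y"
  using assms by (simp add: padic_res_inject[symmetric] fun_eq_iff)

instantiation padic_int :: (semiring_prime_char) comm_ring_1
begin

lift_definition zero_padic_int :: "'a padic_int" is "\<lambda>n. 0"
  by simp

lift_definition one_padic_int :: "'a padic_int" is "\<lambda>n. 1 mod int CHAR('a) ^ n"
  by (simp add: mod_mod_cancel)

lift_definition plus_padic_int :: "'a padic_int \<Rightarrow> 'a padic_int \<Rightarrow> 'a padic_int"
  is "\<lambda>x y n. (x n + y n) mod int CHAR('a) ^ n"
  by (simp add: mod_mod_cancel) (metis mod_add_eq mod_mod_trivial)

lift_definition uminus_padic_int :: "'a padic_int \<Rightarrow> 'a padic_int"
  is "\<lambda>x n. (- x n) mod int CHAR('a) ^ n"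
  by (simp add: mod_mod_cancel) (metis mod_minus_eq mod_mod_trivial)

lift_definition minus_padic_int :: "'a padic_int \<Rightarrow> 'a padic_int \<Rightarrow> 'a padic_int"
  is "\<lambda>x y n. (x n - y n) mod int CHAR('a) ^ n"
  by (simp add: mod_mod_cancel) (metis mod_diff_eq mod_mod_trivial)

lift_definition times_padic_int :: "'a padic_int \<Rightarrow> 'a padic_int \<Rightarrow> 'a padic_int"
  is "\<lambda>x y n. (x n * y n) mod int CHAR('a) ^ n"
  by (simp add: mod_mod_cancel) (metis mod_mult_eq mod_mod_trivial)

lemma padic_res_ring_ops:
  "padic_res (0 :: 'a padic_int) n = 0"
  "padic_res (1 :: 'a padic_int) n = 1 mod int CHAR('a) ^ n"
  "padic_res (x + y :: 'a padic_int) n = (padic_res x n + padic_res y n) mod int CHAR('a) ^ n"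
  "padic_res (- x :: 'a padic_int) n = (- padic_res x n) mod int CHAR('a) ^ n"
  "padic_res (x - y :: 'a padic_int) n = (padic_res x n - padic_res y n) mod int CHAR('a) ^ n"
  "padic_res (x * y :: 'a padic_int) n = (padic_res x n * padic_res y n) mod int CHAR('a) ^ n"
  by (transfer, simp)+

instance
proof
  fix x y z :: "'a padic_int"
  show "x * y * z = x * (y * z)"
    by (rule padic_int_eqI) (simp add: padic_res_ring_ops mod_simps mult.assoc)
  show "x * y = y * x"
    by (rule padic_int_eqI) (simp add: padic_res_ring_ops mult.commute)
  show "1 * x = x"
    by (rule padic_int_eqI) (simp add: padic_res_ring_ops mod_simps)
  show "x + y + z = x + (y + z)"
    by (rule padic_int_eqI) (simp add: padic_res_ring_ops mod_simps add.assoc)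
  show "x + y = y + x"
    by (rule padic_int_eqI) (simp add: padic_res_ring_ops add.commute)
  show "0 + x = x"
    by (rule padic_int_eqI) (simp add: padic_res_ring_ops)
  show "- x + x = 0"
    by (rule padic_int_eqI) (simp add: padic_res_ring_ops mod_simps)
  show "x - y = x + - y"
    by (rule padic_int_eqI) (simp add: padic_res_ring_ops mod_simps)
  show "(x + y) * z = x * z + y * z"
    by (rule padic_int_eqI) (simp add: padic_res_ring_ops mod_simps distrib_right)
  have "prime CHAR('a)" by simp
  hence "1 < CHAR('a)" by (rule prime_gt_1_nat)
  hence "padic_res (0 :: 'a padic_int) 1 \<noteq> padic_res 1 1"
    by (simp add: padic_res_ring_ops)
  thus "(0 :: 'a padic_int) \<noteq> 1" by metis
qed

end

lemma padic_res_of_nat: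
  "padic_res (of_nat m :: 'a :: semiring_prime_char padic_int) n = int m mod int CHAR('a) ^ n"
  by (induction m) (simp_all add: padic_res_ring_ops mod_simps)

text \<open>The p-adic topology: the residue classes modulo p^n form a neighbourhood basis.\<close>

instantiation padic_int :: (semiring_prime_char) t2_space
begin

definition open_padic_int :: "'a padic_int set \<Rightarrow> bool" where
  "open_padic_int U \<longleftrightarrow> (\<forall>x\<in>U. \<exists>n. \<forall>y. padic_res y n = padic_res x n \<longrightarrow> y \<in> U)"

instance
proof
  show "open (UNIV :: 'a padic_int set)"
    by (simp add: open_padic_int_def)
next
  fix S T :: "'a padic_int set"
  assume S: "open S" and T: "open T"
  show "open (S \<inter> T)"
    unfolding open_padic_int_def
  proof
    fix x assume x: "x \<in> S \<inter> T"
    obtain m where m: "\<And>y. padic_res y m = padic_res x m \<Longrightarrow> y \<in> S"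
      using S x unfolding open_padic_int_def by blast
    obtain n where n: "\<And>y. padic_res y n = padic_res x n \<Longrightarrow> y \<in> T"
      using T x unfolding open_padic_int_def by blast
    have "y \<in> S \<inter> T" if y: "padic_res y (max m n) = padic_res x (max m n)" for y
    proof -
      have "padic_res y k = padic_res x k" if "k \<le> max m n" for k
        using padic_res_mod[OF that, of x] padic_res_mod[OF that, of y] y by simp
      thus ?thesis using m n by simp
    qed
    thus "\<exists>k. \<forall>y. padic_res y k = padic_res x k \<longrightarrow> y \<in> S \<inter> T" by blast
  qed
next
  fix K :: "'a padic_int set set"
  assume "\<forall>S\<in>K. open S"
  thus "open (\<Union>K)"
    unfolding open_padic_int_def by (meson Union_iff)
next
  fix x y :: "'a padic_int"
  assume "x \<noteq> y"
  then obtain n where n: "padic_res x n \<noteq> padic_res y n"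
    using padic_int_eqI by blast
  show "\<exists>U V. open U \<and> open V \<and> x \<in> U \<and> y \<in> V \<and> U \<inter> V = {}"
  proof (intro exI conjI)
    show "open {z. padic_res z n = padic_res x n}" "open {z. padic_res z n = padic_res y n}"
      unfolding open_padic_int_def by (intro ballI exI[of _ n]; simp)+
  qed (use n in auto)
qed

end

lemma tendsto_padic_int_iff:
  fixes f :: "'b \<Rightarrow> 'a :: semiring_prime_char padic_int"
  shows "(f \<longlongrightarrow> l) F \<longleftrightarrow> (\<forall>n. \<forall>\<^sub>F i in F. padic_res (f i) n = padic_res l n)"
proof
  assume f: "(f \<longlongrightarrow> l) F"
  show "\<forall>n. \<forall>\<^sub>F i in F. padic_res (f i) n = padic_res l n"
  proof
    fix n
    have "open {z. padic_res z n = padic_res l n}"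
      unfolding open_padic_int_def by (intro ballI exI[of _ n]; simp)
    from topological_tendstoD[OF f this]
    show "\<forall>\<^sub>F i in F. padic_res (f i) n = padic_res l n" by simp
  qed
next
  assume ev: "\<forall>n. \<forall>\<^sub>F i in F. padic_res (f i) n = padic_res l n"
  show "(f \<longlongrightarrow> l) F"
  proof (rule topological_tendstoI)
    fix S assume "open S" "l \<in> S"
    then obtain n where "\<forall>y. padic_res y n = padic_res l n \<longrightarrow> y \<in> S"
      unfolding open_padic_int_def by blast
    hence n: "\<And>i. padic_res (f i) n = padic_res l n \<Longrightarrow> f i \<in> S" by simp
    show "\<forall>\<^sub>F i in F. f i \<in> S"
      using ev[rule_format, of n] n by (rule eventually_mono)
  qed
qed

text \<open>
  The quotient t (t - 1) ... (t - k + 1) / k!, which is again a p-adic integer; the library's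
  gchoose is not applicable because it is constrained to fields of characteristic 0.
\<close>

definition padic_binomial :: "'a :: semiring_prime_char padic_int \<Rightarrow> nat \<Rightarrow> 'a padic_int" where
  "padic_binomial t k = (THE b. of_nat (fact k) * b = (\<Prod>i<k. t - of_nat i))"

lemma padic_binomial_ex1:
  fixes t :: "'a :: semiring_prime_char padic_int"
  shows "\<exists>!b. of_nat (fact k) * b = (\<Prod>i<k. t - of_nat i)"
proof -
  define p where "p = int CHAR('a)"
  have p: "prime p" by (simp add: p_def)
  have res_prod: "padic_res (\<Prod>i<k. t - of_nat i) n = (\<Prod>i<k. padic_res t n - int i) mod p ^ n" for k n
    by (induction k) (simp_all add: padic_res_ring_ops padic_res_of_nat mod_simps p_def)
  obtain V m where Vm: "fact k = p ^ V * m" "coprime m p"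
  proof -
    have "\<not> is_unit p" using p by auto
    then obtain m where m: "fact k = p ^ multiplicity p (fact k) * m" "\<not> p dvd m"
      by (rule multiplicity_decompose'[OF fact_nonzero])
    show ?thesis
      by (rule that[OF m(1)]) (use prime_imp_coprime[OF p m(2)] in \<open>simp only: coprime_commute\<close>)
  qed
  have cancel: "[a = b] (mod p ^ n)" if "[fact k * a = fact k * b] (mod p ^ (n + V))" for a b n
  proof -
    have "p ^ (n + V) dvd fact k * a - fact k * b"
      using that by (simp only: cong_iff_dvd_diff)
    also have "p ^ (n + V) = p ^ n * p ^ V"
      by (rule power_add)
    also have "fact k * a - fact k * b = (m * (a - b)) * p ^ V"
      unfolding Vm(1) by (simp only: algebra_simps)
    finally have "p ^ n * p ^ V dvd (m * (a - b)) * p ^ V" .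
    moreover have "p \<noteq> 0" using p by auto
    ultimately have "p ^ n dvd m * (a - b)" by simp
    moreover have "coprime (p ^ n) m"
      using Vm(2) by (simp add: coprime_commute)
    ultimately show ?thesis
      by (simp add: cong_iff_dvd_diff coprime_dvd_mult_right_iff)
  qed
  define ch :: "int \<Rightarrow> int" where "ch x = (\<Prod>i<k. x - int i) div fact k" for x
  have choose_fact: "fact k * ch x = (\<Prod>i<k. x - int i)" for x
    using dvdI[OF gbinomial_int_mult_fact[of k x, symmetric]]
    by (simp add: ch_def atLeast0LessThan)
  have choose_cong: "[ch x = ch y] (mod p ^ n)"
    if "[x = y] (mod p ^ (n + V))" for x y n
    by (rule cancel, unfold choose_fact) (intro cong_prod cong_diff that cong_refl)
  define b where "b n = ch (padic_res t (n + V)) mod p ^ n" for n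
  have b: "b (Suc n) mod p ^ n = b n" for n
  proof -
    have "[padic_res t (Suc n + V) = padic_res t (n + V)] (mod p ^ (n + V))"
      using padic_res_mod[of "n + V" "Suc n + V" t] by (simp add: cong_def p_def)
    from choose_cong[OF this] show ?thesis
      by (simp add: b_def cong_def mod_mod_cancel)
  qed
  define B :: "'a padic_int" where "B = Abs_padic_int b"
  have B: "padic_res B n = b n" for n
    unfolding B_def by (subst Abs_padic_int_inverse) (use b in \<open>auto simp: p_def\<close>)
  have "of_nat (fact k) * B = (\<Prod>i<k. t - of_nat i)"
  proof (rule padic_int_eqI)
    fix n
    have "[padic_res t (n + V) = padic_res t n] (mod p ^ n)"
      using padic_res_mod[of n "n + V" t] by (simp add: cong_def p_def)
    hence "[(\<Prod>i<k. padic_res t (n + V) - int i) = (\<Prod>i<k. padic_res t n - int i)] (mod p ^ n)"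
      by (intro cong_prod cong_diff cong_refl)
    thus "padic_res (of_nat (fact k) * B) n = padic_res (\<Prod>i<k. t - of_nat i) n"
      unfolding res_prod
      by (simp add: padic_res_ring_ops padic_res_of_nat B b_def mod_simps choose_fact cong_def flip: p_def)
  qed
  moreover have "x = y" if "of_nat (fact k) * x = of_nat (fact k) * y" for x y :: "'a padic_int"
  proof (rule padic_int_eqI)
    fix n
    have "[fact k * padic_res x (n + V) = fact k * padic_res y (n + V)] (mod p ^ (n + V))"
      using arg_cong[OF that, of "\<lambda>z. padic_res z (n + V)"]
      by (simp add: padic_res_ring_ops padic_res_of_nat mod_simps cong_def p_def)
    from cancel[OF this] show "padic_res x n = padic_res y n"
      using padic_res_mod[of n "n + V" x] padic_res_mod[of n "n + V" y] by (simp add: cong_def p_def)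
  qed
  ultimately show ?thesis by metis
qed

text \<open>Reduction modulo p, followed by the inclusion of the prime field.\<close>

definition padic_to_field :: "'a :: finite_field padic_int \<Rightarrow> 'a" where
  "padic_to_field x = of_int (padic_res x 1)"


section \<open>The group of digit permutations\<close>

definition padic_digits :: "'a :: finite_field padic_int \<Rightarrow> nat \<Rightarrow> nat" where
  "padic_digits x = (THE c. (\<forall>i. c i < CARD('a)) \<and> (\<lambda>i. of_nat (c i) * of_nat CARD('a) ^ i) sums x)"

definition digit_perm :: "(nat \<Rightarrow> nat) \<Rightarrow> 'a :: finite_field padic_int \<Rightarrow> 'a padic_int" where
  "digit_perm \<rho> x = (\<Sum>i. of_nat (padic_digits x i) * of_nat CARD('a) ^ \<rho> i)"

definition digit_perms :: "('a :: finite_field padic_int \<Rightarrow> 'a padic_int) set" where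
  "digit_perms = {digit_perm \<rho> | \<rho>. bij \<rho>}"


section \<open>Power sums of 1-units\<close>

text \<open>
  The field of Laurent series in 1/T is the type of formal Laurent series whose variable
  \<^term>\<open>fls_X\<close> is read as 1/T.  Thus T itself is \<^term>\<open>fls_X_inv\<close>, and the maximal ideal of the
  ring of power series in 1/T is generated by \<^term>\<open>fls_X\<close>.
\<close>

definition poly_to_fls :: "'a :: finite_field poly \<Rightarrow> 'a fls" where
  "poly_to_fls f = poly (map_poly fls_const f) fls_X_inv"

definition one_unit :: "'a :: finite_field fls \<Rightarrow> bool" where
  "one_unit u \<longleftrightarrow> (\<exists>v. u - 1 = fls_X * fps_to_fls v)"

definition positive_uniformizer :: "'a :: finite_field fls \<Rightarrow> bool" where
  "positive_uniformizer \<pi> \<longleftrightarrow> (\<exists>u. one_unit u \<and> \<pi> = inverse fls_X_inv * u)"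

definition one_unit_power :: "'a :: finite_field fls \<Rightarrow> 'a padic_int \<Rightarrow> 'a fls" where
  "one_unit_power u t = (\<Sum>k. fls_const (padic_to_field (padic_binomial t k)) * (u - 1) ^ k)"

definition angle :: "'a :: finite_field fls \<Rightarrow> 'a poly \<Rightarrow> 'a fls" where
  "angle \<pi> f = \<pi> ^ degree f * poly_to_fls f"

definition power_sum :: "'a :: finite_field fls \<Rightarrow> nat \<Rightarrow> 'a padic_int \<Rightarrow> 'a fls" where
  "power_sum \<pi> e t = (\<Sum>f | lead_coeff f = 1 \<and> degree f = e. one_unit_power (angle \<pi> f) t)"

definition zero_set :: "'a :: finite_field fls \<Rightarrow> nat \<Rightarrow> 'a padic_int set" where
  "zero_set \<pi> e = {t. power_sum \<pi> e t = 0}"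

end

theory Submission
  imports Defs
begin

text \<open>
  Put \<open>x = 1/T\<close> and \<open>q = p^r\<close>.  Changing the positive uniformizer multiplies the power sum by a 1-unit, and
  the reversed monic polynomials of degree e are \<open>1 + x (a1 + x (a2 + ...))\<close>.  Expanding the powers by the
  binomial theorem level by level and summing over the coefficients turns the power sum, up to sign, into
  a sum over chains \<open>0 = k0 < k1 < ... < ke\<close> of natural numbers whose differences are divisible by q - 1; such
  a chain contributes a product of binomial coefficients times \<open>x^(k1 + ... + ke)\<close>, and by Lucas the product is
  nonzero iff the base p digits increase along the chain and are bounded by those of t.

  The main point (Carlitz, Sheats) is that no cancellation occurs in lowest degree: among the chains below
  t exactly one minimises \<open>k1 + ... + ke\<close>.  Hence the power sum vanishes at t iff there is no chain below t.  A
  permutation of the base q digits permutes the base p digits and keeps their positions modulo r, so it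
  preserves divisibility by q - 1 and maps chains to chains.

  Uniqueness is discrete convex optimisation.  View a number as a multiset of tokens \<open>p^s\<close>, where s modulo r is
  the class of the token.  The numbers divisible by q - 1 are those whose class counts have the form
  \<open>n l = p c l - c (l - 1)\<close> with an integral charge c, and the cheapest number with given counts takes the smallest
  tokens.  Its value is submodular in c.  In the relaxed problem one only asks the charges to
  increase by at least 1 in every coordinate from one member of the chain to the next; its optimum
  is found greedily from the top, is unique, and turns out to be a chain of numbers.
\<close>

section \<open>Submodular minimisation\<close>

text \<open>Where charges come from: modulo q - 1 multiplication by p rotates the r classes, so if q
  - 1 divides K, it also divides every number obtained by folding the digits of K modulo r and
  rotating them. The charge c l is the quotient for one rotation, and comparing neighbouring
  rotations gives the formula for counts. All rotations grow when digits grow, which yields the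
  increment by 1 in the relaxed problem. Two obstacles shape the argument. First, digitwise
  inclusion of consecutive members does not follow from the relaxed constraints; it has to be
  recovered at the optimum, by \<open>greedy_nested\<close>. Second, a cheap top member leaves less
  space for the members under it, so greed might have to be paid for lower down. It is not: the
  tokens gained below are distinct and all smaller than one token lost at the top, and a power of p
  exceeds any sum of distinct smaller tokens. Chains are strict because the sum of a ^ 0 over the
  field is q = 0. Natural exponents suffice, since a coefficient of given degree depends only on
  finitely many digits of t.\<close>

lemma sum_lessThan_add:
  fixes f :: "nat \<Rightarrow> 'a :: comm_monoid_add"
  shows "(\<Sum>k<m + n. f k) = (\<Sum>k<m. f k) + (\<Sum>i<n. f (m + i))"
  by (induction n) (simp_all add: add.assoc)

text \<open>Partial sums of an increasing sequence are convex in their length, so moving two lengths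
  towards each other with fixed total cannot increase the sum.\<close>

lemma sum_lessThan_exchange:
  fixes f :: "nat \<Rightarrow> nat"
  assumes mono: "\<And>i j. i \<le> j \<Longrightarrow> f i \<le> f j" and "u + v = x + y" "min x y \<le> u" "u \<le> max x y"
  shows "sum f {..<u} + sum f {..<v} \<le> sum f {..<x} + sum f {..<y}"
proof -
  have main: "sum f {..<u} + sum f {..<v} \<le> sum f {..<x} + sum f {..<y}"
    if "u + v = x + y" "x \<le> u" "u \<le> v" for u v x y :: nat
  proof -
    obtain d where d: "u = x + d" using \<open>x \<le> u\<close> le_Suc_ex by blast
    have y: "y = v + d" using that d by simp
    have "(\<Sum>i<d. f (x + i)) \<le> (\<Sum>i<d. f (v + i))"
      using that by (intro sum_mono mono) simp
    thus ?thesis unfolding d y sum_lessThan_add by simp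
  qed
  show ?thesis
    using main[of u v x y] main[of v u x y] main[of u v y x] main[of v u y x] assms(2-4)
    by (simp add: min_def max_def split: if_splits) linarith+
qed

lemma obtain_max:
  fixes f :: "'b \<Rightarrow> nat"
  assumes "A \<noteq> {}" "finite A"
  obtains x where "x \<in> A" "\<And>y. y \<in> A \<Longrightarrow> f y \<le> f x"
proof -
  have "Max (f ` A) \<in> f ` A" using assms by (intro Max_in) auto
  then obtain x where x: "x \<in> A" "f x = Max (f ` A)" by force
  thus thesis using assms by (intro that[of x]) auto
qed

text \<open>
  The classes form a set L, the permutation pr is \<open>l \<mapsto> l - 1\<close>, and \<open>val l k\<close> is the value of the k-th smallest
  token of class l.  The last assumption holds because powers of p with multiplicities below p that are
  smaller than a given power sum up to less than it.
\<close>

locale token_system =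
  fixes p :: int and L :: "'l set" and pr :: "'l \<Rightarrow> 'l" and val :: "'l \<Rightarrow> nat \<Rightarrow> nat"
  assumes p: "2 \<le> p" and fin: "finite L" and pr: "bij_betw pr L L"
    and val_mono: "l \<in> L \<Longrightarrow> j \<le> k \<Longrightarrow> val l j \<le> val l k"
    and val_jump: "l \<in> L \<Longrightarrow> val l k < val l (k + nat (p - 1))"
    and val_disjoint: "l \<in> L \<Longrightarrow> l' \<in> L \<Longrightarrow> val l j = val l' k \<Longrightarrow> l = l'"
    and val_sum: "l \<in> L \<Longrightarrow> finite T \<Longrightarrow> T \<subseteq> L \<times> UNIV \<Longrightarrow>
      (\<And>i j. (i, j) \<in> T \<Longrightarrow> val i j < val l k) \<Longrightarrow> (\<Sum>(i, j)\<in>T. val i j) < val l k"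
begin

section \<open>Charges, counts and the value of the cheapest token set\<close>

definition cnt :: "('l \<Rightarrow> int) \<Rightarrow> 'l \<Rightarrow> int" where
  "cnt c l = p * c l - c (pr l)"

definition feas :: "('l \<Rightarrow> int) \<Rightarrow> bool" where
  "feas c \<longleftrightarrow> (\<forall>l\<in>L. 0 \<le> cnt c l)"

definition tok :: "('l \<Rightarrow> int) \<Rightarrow> ('l \<times> nat) set" where
  "tok c = {(l, k). l \<in> L \<and> int k < cnt c l}"

definition Phi :: "('l \<Rightarrow> int) \<Rightarrow> nat" where
  "Phi c = (\<Sum>(l, k)\<in>tok c. val l k)"

lemma pr_in: "l \<in> L \<Longrightarrow> pr l \<in> L"
  using pr by (auto simp: bij_betw_def)

lemma tok_Sigma: "tok c = Sigma L (\<lambda>l. {..<nat (cnt c l)})"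
  by (auto simp: tok_def)

lemma finite_tok: "finite (tok c)"
  using fin by (simp add: tok_Sigma)

lemma tok_subset: "tok c \<subseteq> L \<times> UNIV"
  by (auto simp: tok_def)

lemma Phi_classes: "Phi c = (\<Sum>l\<in>L. \<Sum>k<nat (cnt c l). val l k)"
  unfolding Phi_def tok_Sigma using fin by (subst sum.Sigma) auto

text \<open>A difference d of charges with equal counts satisfies p |d l| = |d (pr l)|. Summing over
  the permutation \<open>pr\<close> leaves (p - 1) times the sum of all |d l|, which must
  vanish.\<close>

lemma cnt_inj:
  assumes "\<And>l. l \<in> L \<Longrightarrow> cnt a l = cnt b l" "l \<in> L"
  shows "a l = b l"
proof -
  define d where "d l = a l - b l" for l
  have "p * \<bar>d l\<bar> = \<bar>d (pr l)\<bar>" if "l \<in> L" for l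
  proof -
    have "p * d l = d (pr l)" using assms(1)[OF that] by (simp add: cnt_def d_def algebra_simps)
    thus ?thesis using p by (metis abs_mult abs_of_nonneg order_trans zero_le_numeral)
  qed
  hence "p * (\<Sum>l\<in>L. \<bar>d l\<bar>) = (\<Sum>l\<in>L. \<bar>d (pr l)\<bar>)"
    by (simp add: sum_distrib_left)
  also have "\<dots> = (\<Sum>l\<in>L. \<bar>d l\<bar>)"
    by (rule sum.reindex_bij_betw[OF pr])
  finally have "(p - 1) * (\<Sum>l\<in>L. \<bar>d l\<bar>) = 0" by (simp add: algebra_simps)
  hence "(\<Sum>l\<in>L. \<bar>d l\<bar>) = 0" using p by simp
  hence "d l = 0" using fin assms(2) by (simp add: sum_nonneg_eq_0_iff)
  thus ?thesis by (simp add: d_def)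
qed

lemma Phi_cong: "(\<And>l. l \<in> L \<Longrightarrow> a l = b l) \<Longrightarrow> Phi a = Phi b"
  unfolding Phi_classes by (intro sum.cong) (auto simp: cnt_def pr_in)

text \<open>One token outweighs any set of smaller ones by \<open>val_sum\<close>. The largest token
  of b in class l is missing from a and alone beats everything that a has and b lacks.\<close>

lemma Phi_less:
  assumes l: "l \<in> L" "0 \<le> cnt a l" "cnt a l < cnt b l"
    and less: "\<And>i j. (i, j) \<in> tok a - tok b \<Longrightarrow> val i j < val l (nat (cnt b l - 1))"
  shows "Phi a < Phi b"
proof -
  let ?s = "sum (\<lambda>(l, k). val l k)"
  let ?t = "(l, nat (cnt b l - 1))"
  have split: "?s A = ?s (A \<inter> B) + ?s (A - B)" if "finite A" for A B
    using that by (metis sum.Int_Diff)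
  have "?s (tok a - tok b) < val l (nat (cnt b l - 1))"
    by (rule val_sum) (use l less finite_tok tok_subset in \<open>blast+\<close>)
  also have "val l (nat (cnt b l - 1)) = ?s {?t}" by simp
  also have "\<dots> \<le> ?s (tok b - tok a)"
    by (rule sum_mono2) (use l finite_tok in \<open>auto simp: tok_def\<close>)
  finally show ?thesis
    unfolding Phi_def using split[OF finite_tok, of a "tok b"] split[OF finite_tok, of b "tok a"]
    by (simp add: Int_commute)
qed

text \<open>The largest token in which two token sets differ decides the comparison, as a leading
  digit does. Hence minimising \<open>Phi\<close> over feasible charges has at most one solution on
  L.\<close>

lemma Phi_inj:
  assumes "feas a" "feas b" "Phi a = Phi b" "l \<in> L"
  shows "a l = b l"
proof (rule cnt_inj[OF _ \<open>l \<in> L\<close>], rule ccontr)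
  fix l assume l: "l \<in> L" and ne: "cnt a l \<noteq> cnt b l"
  define D where "D = (tok a - tok b) \<union> (tok b - tok a)"
  have "finite D" by (simp add: D_def finite_tok)
  have "D \<noteq> {}"
  proof (cases "cnt a l < cnt b l")
    case True
    hence "(l, nat (cnt a l)) \<in> D" using l assms(1) by (auto simp: D_def tok_def feas_def)
    thus ?thesis by blast
  next
    case False
    hence "(l, nat (cnt b l)) \<in> D" using l assms(2) ne by (auto simp: D_def tok_def feas_def)
    thus ?thesis by blast
  qed
  obtain t where t: "t \<in> D" "\<And>t'. t' \<in> D \<Longrightarrow> (\<lambda>(l, k). val l k) t' \<le> (\<lambda>(l, k). val l k) t"
  proof -
    have "Max ((\<lambda>(l, k). val l k) ` D) \<in> (\<lambda>(l, k). val l k) ` D"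
      using \<open>finite D\<close> \<open>D \<noteq> {}\<close> by (intro Max_in) auto
    then obtain t where "t \<in> D" "Max ((\<lambda>(l, k). val l k) ` D) = (\<lambda>(l, k). val l k) t" by blast
    thus ?thesis using \<open>finite D\<close> by (intro that[of t]) (auto simp flip: \<open>_ = (\<lambda>(l, k). val l k) t\<close>)
  qed
  obtain i k where ik: "t = (i, k)" by force
  \<comment> \<open>The token (i, k) need not be the last token of class i in y, but the last one is
    at least as large, which is all that \<open>Phi_less\<close> needs.\<close>
  have top: "Phi x < Phi y" if xy: "feas x" "feas y" "tok x - tok y \<subseteq> D" "(i, k) \<in> tok y - tok x" for x y
  proof (rule Phi_less[of i])
    show i: "i \<in> L" using that by (simp add: tok_def)
    show "0 \<le> cnt x i" using xy i by (simp add: feas_def)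
    show lt: "cnt x i < cnt y i" using that by (auto simp: tok_def)
    fix i' j assume ij: "(i', j) \<in> tok x - tok y"
    have "i' \<noteq> i" "i' \<in> L" using ij lt by (auto simp: tok_def)
    hence "val i' j \<noteq> val i k" using val_disjoint i by blast
    moreover have "val i' j \<le> val i k" using t(2)[of "(i', j)"] ij xy(3) ik by auto
    moreover have "val i k \<le> val i (nat (cnt y i - 1))"
      using xy(4) i by (intro val_mono) (auto simp: tok_def)
    ultimately show "val i' j < val i (nat (cnt y i - 1))" by simp
  qed
  have "(i, k) \<in> tok a - tok b \<or> (i, k) \<in> tok b - tok a" using t(1) ik by (simp add: D_def)
  thus False using top[of a b] top[of b a] assms by (auto simp: D_def)
qed

lemma Phi_exchange:
  assumes "feas a" "feas b" "feas a'" "feas b'"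
    and "\<And>l. l \<in> L \<Longrightarrow> cnt a' l + cnt b' l = cnt a l + cnt b l"
    and "\<And>l. l \<in> L \<Longrightarrow> min (cnt a l) (cnt b l) \<le> cnt a' l \<and> cnt a' l \<le> max (cnt a l) (cnt b l)"
  shows "Phi a' + Phi b' \<le> Phi a + Phi b"
  unfolding Phi_classes sum.distrib[symmetric]
proof (rule sum_mono)
  fix l assume l: "l \<in> L"
  have "nat (cnt a' l) + nat (cnt b' l) = nat (cnt a l) + nat (cnt b l)"
    using assms(1-4) l assms(5)[OF l] by (simp add: feas_def flip: nat_add_distrib)
  thus "(\<Sum>k<nat (cnt a' l). val l k) + (\<Sum>k<nat (cnt b' l). val l k)
      \<le> (\<Sum>k<nat (cnt a l). val l k) + (\<Sum>k<nat (cnt b l). val l k)"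
    using assms(6)[OF l]
    by (intro sum_lessThan_exchange[OF val_mono[OF l]]) (auto simp: min_def max_def split: if_splits)
qed

section \<open>Lattice of charges and submodularity\<close>

abbreviation meet :: "('l \<Rightarrow> int) \<Rightarrow> ('l \<Rightarrow> int) \<Rightarrow> 'l \<Rightarrow> int" where
  "meet a b \<equiv> \<lambda>l. min (a l) (b l)"

abbreviation join :: "('l \<Rightarrow> int) \<Rightarrow> ('l \<Rightarrow> int) \<Rightarrow> 'l \<Rightarrow> int" where
  "join a b \<equiv> \<lambda>l. max (a l) (b l)"

lemma p_mono: "x \<le> y \<Longrightarrow> p * x \<le> p * y"
  using p by (simp add: mult_left_mono)

text \<open>If the minimum is attained by a at l but by b at \<open>pr l\<close>, the mixed count p
  * a l - b (pr l) is at least the count of a and at most that of b.\<close>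

lemma cnt_meet: "min (cnt a l) (cnt b l) \<le> cnt (meet a b) l \<and> cnt (meet a b) l \<le> max (cnt a l) (cnt b l)"
  using p_mono[of "a l" "b l"] p_mono[of "b l" "a l"] unfolding cnt_def
  by (cases "a l \<le> b l"; cases "a (pr l) \<le> b (pr l)") (simp_all add: min_def max_def)

lemma cnt_join: "min (cnt a l) (cnt b l) \<le> cnt (join a b) l \<and> cnt (join a b) l \<le> max (cnt a l) (cnt b l)"
  using p_mono[of "a l" "b l"] p_mono[of "b l" "a l"] unfolding cnt_def
  by (cases "a l \<le> b l"; cases "a (pr l) \<le> b (pr l)") (simp_all add: min_def max_def)

lemma cnt_meet_join: "cnt (meet a b) l + cnt (join a b) l = cnt a l + cnt b l"
  unfolding cnt_def by (cases "a l \<le> b l"; cases "a (pr l) \<le> b (pr l)") (simp_all add: min_def max_def)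

lemma feas_meet: "feas a \<Longrightarrow> feas b \<Longrightarrow> feas (meet a b)"
  unfolding feas_def using cnt_meet[of a _ b] by (meson min.bounded_iff order_trans)

lemma feas_join: "feas a \<Longrightarrow> feas b \<Longrightarrow> feas (join a b)"
  unfolding feas_def using cnt_join[of a _ b] by (meson min.bounded_iff order_trans)

lemma Phi_submodular:
  assumes "feas a" "feas b"
  shows "Phi (meet a b) + Phi (join a b) \<le> Phi a + Phi b"
  using assms by (intro Phi_exchange feas_meet feas_join cnt_meet_join cnt_meet)

text \<open>With h the counts of a charge, the third conclusion says that subtracting z from that
  charge leaves no count negative. A z with least coordinate sum is taken; where neither the floor f
  nor this condition is attained at \<open>pr l\<close>, z could still be lowered there by
  1.\<close>

lemma least_closure:
  fixes f h x :: "'l \<Rightarrow> int"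
  assumes fx: "\<And>l. l \<in> L \<Longrightarrow> f l \<le> x l" and x: "\<And>l. l \<in> L \<Longrightarrow> p * x l - h l \<le> x (pr l)"
  obtains z where "\<And>l. l \<in> L \<Longrightarrow> f l \<le> z l" "\<And>l. l \<in> L \<Longrightarrow> z l \<le> x l"
    "\<And>l. l \<in> L \<Longrightarrow> p * z l - h l \<le> z (pr l)"
    "\<And>l. l \<in> L \<Longrightarrow> z (pr l) = f (pr l) \<or> z (pr l) = p * z l - h l"
proof -
  define P where "P z \<longleftrightarrow> (\<forall>l\<in>L. f l \<le> z l \<and> z l \<le> x l \<and> p * z l - h l \<le> z (pr l))" for z
  have "P x" using assms by (simp add: P_def)
  then obtain z where z: "P z" and zmin: "\<And>y. P y \<Longrightarrow> nat (\<Sum>l\<in>L. z l - f l) \<le> nat (\<Sum>l\<in>L. y l - f l)"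
    using ex_has_least_nat[of P x "\<lambda>z. nat (\<Sum>l\<in>L. z l - f l)"] by blast
  have "z (pr l) = f (pr l) \<or> z (pr l) = p * z l - h l" if l: "l \<in> L" for l
  proof (rule ccontr)
    assume contra: "\<not> ?thesis"
    define y where "y = z(pr l := z (pr l) - 1)"
    have gt: "f (pr l) < z (pr l)" "p * z l - h l < z (pr l)"
      using contra z l pr_in[OF l] by (auto simp: P_def order.strict_iff_order)
    have "P y" unfolding P_def
    proof (intro ballI conjI)
      fix i assume i: "i \<in> L"
      show "f i \<le> y i" "y i \<le> x i" using gt z i by (auto simp: y_def P_def intro: order_trans[of _ "z (pr l)"])
      have le: "p * y i \<le> p * z i" by (rule p_mono) (simp add: y_def)
      show "p * y i - h i \<le> y (pr i)"
      proof (cases "pr i = pr l")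
        case True
        hence "i = l" using pr i l by (auto simp: bij_betw_def inj_on_def)
        thus ?thesis using gt(2) le by (simp add: y_def)
      next
        case False
        thus ?thesis using le z i by (force simp: y_def P_def)
      qed
    qed
    moreover have "(\<Sum>l\<in>L. y l - f l) < (\<Sum>l\<in>L. z l - f l)"
      using fin pr_in[OF l] by (intro sum_strict_mono_ex1) (auto simp: y_def)
    moreover have "0 \<le> (\<Sum>l\<in>L. y l - f l)"
      using \<open>P y\<close> by (intro sum_nonneg) (auto simp: P_def)
    ultimately show False using zmin[of y] by linarith
  qed
  thus thesis using z by (intro that[of z]) (auto simp: P_def)
qed

section \<open>Relaxed chains and the steepest descent from a top member\<close>

definition chain :: "nat \<Rightarrow> (nat \<Rightarrow> 'l \<Rightarrow> int) \<Rightarrow> bool" where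
  "chain e C \<longleftrightarrow> (\<forall>l\<in>L. C 0 l = 0) \<and> (\<forall>m\<le>e. feas (C m)) \<and> (\<forall>m<e. \<forall>l\<in>L. C m l + 1 \<le> C (Suc m) l)"

definition cost :: "nat \<Rightarrow> (nat \<Rightarrow> 'l \<Rightarrow> int) \<Rightarrow> nat" where
  "cost e C = (\<Sum>m\<le>e. Phi (C m))"

text \<open>The drop d = x - y is the least closure of the constant 1, so y stays as close to x as
  feasibility allows. Where the count of y is positive the closure is not tight; then d (pr l) = 1,
  and as d l is at least 1 the count falls by p - 1 or more.\<close>

lemma descent_step:
  assumes x: "feas x" "\<And>l. l \<in> L \<Longrightarrow> int (Suc m) \<le> x l"
  obtains y where "feas y" "\<And>l. l \<in> L \<Longrightarrow> int m \<le> y l" "\<And>l. l \<in> L \<Longrightarrow> y l + 1 \<le> x l"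
    "\<And>l. l \<in> L \<Longrightarrow> cnt y l = 0 \<or> y (pr l) = x (pr l) - 1 \<and> cnt y l + (p - 1) \<le> cnt x l"
proof -
  \<comment> \<open>The cap x - m is itself closed because p >= 1; it reserves the charge m for the
    steps still to come.\<close>
  have 1: "p * (x l - int m) - cnt x l \<le> x (pr l) - int m" for l
    using p_mono[of 0 "int m"] p mult_right_mono[of 1 p "int m"] by (simp add: cnt_def algebra_simps)
  obtain d where d: "\<And>l. l \<in> L \<Longrightarrow> 1 \<le> d l" "\<And>l. l \<in> L \<Longrightarrow> d l \<le> x l - int m"
    "\<And>l. l \<in> L \<Longrightarrow> p * d l - cnt x l \<le> d (pr l)"
    "\<And>l. l \<in> L \<Longrightarrow> d (pr l) = 1 \<or> d (pr l) = p * d l - cnt x l"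
    by (rule least_closure[of "\<lambda>_. 1" "\<lambda>l. x l - int m" "cnt x"]) (use x(2) 1 in force)+
  define y where "y l = x l - d l" for l
  have cnt_y: "cnt y l = cnt x l - p * d l + d (pr l)" for l
    by (simp add: cnt_def y_def algebra_simps)
  show thesis
  proof (rule that[of y])
    show "feas y" using d(3) by (force simp: feas_def cnt_y)
    show "int m \<le> y l" "y l + 1 \<le> x l" if "l \<in> L" for l using d(1,2)[OF that] by (auto simp: y_def)
    show "cnt y l = 0 \<or> y (pr l) = x (pr l) - 1 \<and> cnt y l + (p - 1) \<le> cnt x l" if "l \<in> L" for l
      using d(4)[OF that] p_mono[OF d(1)[OF that]] unfolding cnt_y by (auto simp: y_def)
  qed
qed

text \<open>The clauses on counts serve the exchange argument: a positive count at m means that the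
  charge at \<open>pr l\<close> fell by exactly 1 per step, and positive counts in one class differ
  between members, so that the tokens they index do not collide.\<close>

definition descends :: "nat \<Rightarrow> ('l \<Rightarrow> int) \<Rightarrow> (nat \<Rightarrow> 'l \<Rightarrow> int) \<Rightarrow> bool" where
  "descends e x g \<longleftrightarrow> g e = x \<and> (\<forall>m\<le>e. feas (g m)) \<and> (\<forall>m\<le>e. \<forall>l\<in>L. int m \<le> g m l) \<and>
    (\<forall>m<e. \<forall>l\<in>L. g m l + 1 \<le> g (Suc m) l) \<and>
    (\<forall>m\<le>e. \<forall>l\<in>L. cnt (g m) l = 0 \<or>
      g m (pr l) = x (pr l) - int (e - m) \<and> cnt (g m) l + (p - 1) * int (e - m) \<le> cnt x l) \<and>
    (\<forall>m\<le>e. \<forall>i<m. \<forall>l\<in>L. cnt (g i) l = 0 \<or> cnt (g i) l < cnt (g m) l)"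

lemma descendsD:
  assumes "descends e x g"
  shows "g e = x" "m \<le> e \<Longrightarrow> feas (g m)" "m \<le> e \<Longrightarrow> l \<in> L \<Longrightarrow> int m \<le> g m l"
    "m < e \<Longrightarrow> l \<in> L \<Longrightarrow> g m l + 1 \<le> g (Suc m) l"
    "m \<le> e \<Longrightarrow> l \<in> L \<Longrightarrow> cnt (g m) l = 0 \<or>
      g m (pr l) = x (pr l) - int (e - m) \<and> cnt (g m) l + (p - 1) * int (e - m) \<le> cnt x l"
    "m \<le> e \<Longrightarrow> i < m \<Longrightarrow> l \<in> L \<Longrightarrow> cnt (g i) l = 0 \<or> cnt (g i) l < cnt (g m) l"
  using assms unfolding descends_def by simp_all

lemma descent:
  assumes "feas x" "\<And>l. l \<in> L \<Longrightarrow> int e \<le> x l"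
  shows "\<exists>g. descends e x g"
  using assms
proof (induction e arbitrary: x)
  case 0
  thus ?case by (intro exI[of _ "\<lambda>_. x"]) (simp add: descends_def)
next
  case (Suc e)
  obtain y where y: "feas y" "\<And>l. l \<in> L \<Longrightarrow> int e \<le> y l" "\<And>l. l \<in> L \<Longrightarrow> y l + 1 \<le> x l"
    "\<And>l. l \<in> L \<Longrightarrow> cnt y l = 0 \<or> y (pr l) = x (pr l) - 1 \<and> cnt y l + (p - 1) \<le> cnt x l"
    using descent_step[of x e] Suc.prems by metis
  have "\<exists>g. descends e y g" using y(1,2) by (rule Suc.IH)
  then obtain g where "descends e y g" ..
  note g = descendsD[OF this]
  define h where "h = g(Suc e := x)"
  have h_le: "h m = g m" if "m \<le> e" for m using that by (simp add: h_def)
  have h_top: "h (Suc e) = x" by (simp add: h_def)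
  have below: "cnt (h m) l = 0 \<or> h m (pr l) = x (pr l) - int (Suc e - m) \<and>
      cnt (h m) l + (p - 1) * int (Suc e - m) \<le> cnt x l" if "m \<le> e" "l \<in> L" for m l
  proof (cases "cnt (g m) l = 0")
    case False
    hence 1: "g m (pr l) = y (pr l) - int (e - m)"
      "cnt (g m) l + (p - 1) * int (e - m) \<le> cnt y l" using g(5)[OF that] by simp_all
    have "0 < cnt (g m) l" using False g(2)[OF that(1)] that(2) by (force simp: feas_def)
    moreover have "0 \<le> (p - 1) * int (e - m)" using p by simp
    \<comment> \<open>A count that is 0 at y stays 0 below y, so a positive count at m excludes the
      first alternative for the step from x to y.\<close>
    ultimately have "cnt y l \<noteq> 0" using 1(2) by linarith
    with y(4)[OF that(2)] have "y (pr l) = x (pr l) - 1" "cnt y l + (p - 1) \<le> cnt x l" by blast+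
    moreover have "int (Suc e - m) = int (e - m) + 1" using that by simp
    ultimately show ?thesis using 1 that(1) by (simp add: h_le algebra_simps)
  qed (use that in \<open>simp add: h_le\<close>)
  have "cnt (h i) l = 0 \<or> cnt (h i) l < cnt (h m) l" if "m \<le> Suc e" "i < m" "l \<in> L" for m i l
  proof (cases "m = Suc e")
    case True
    moreover have "0 < (p - 1) * int (Suc e - i)" using p that by simp
    ultimately show ?thesis using below[of i l] that by (auto simp: h_top)
  next
    case False
    thus ?thesis using g(6)[of m i l] that by (simp add: h_le)
  qed
  moreover have "\<forall>m<Suc e. \<forall>l\<in>L. h m l + 1 \<le> h (Suc m) l"
    using g(1,4) y(3) by (auto simp: h_def less_Suc_eq)
  moreover have "\<forall>m\<le>Suc e. feas (h m)" using g(2) Suc.prems by (auto simp: h_def le_Suc_eq)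
  moreover have "\<forall>m\<le>Suc e. \<forall>l\<in>L. int m \<le> h m l" using g(3) Suc.prems by (auto simp: h_def le_Suc_eq)
  moreover have "cnt (h m) l = 0 \<or> h m (pr l) = x (pr l) - int (Suc e - m) \<and>
      cnt (h m) l + (p - 1) * int (Suc e - m) \<le> cnt x l" if "m \<le> Suc e" "l \<in> L" for m l
    using below[of m l] that by (cases "m = Suc e") (auto simp: h_top)
  ultimately have "descends (Suc e) x h" unfolding descends_def using h_top by blast
  thus ?case by blast
qed

lemma chain_le:
  assumes "chain e C" "m \<le> e" "l \<in> L"
  shows "C m l \<le> C e l - int (e - m)"
  using assms(2)
proof (induction rule: inc_induct)
  case (step m)
  have "C m l + 1 \<le> C (Suc m) l" using assms step.hyps by (auto simp: chain_def)
  thus ?case using step by (simp add: of_nat_diff)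
qed simp

text \<open>
  The idea: lower the charge of the top member a on the set where it exceeds b, and further only as far as the
  counts would become negative; this gives x, and then each lower member C m is replaced by its meet with the m-th
  member of a steepest descent from x.  Every member gains at most one token per class, and all
  gained tokens are distinct members of the token system, smaller than the largest token P which the
  top member loses.  So their sum is less than P.
\<close>

lemma chain_improve_above:
  assumes C: "chain e C" and b: "feas b" "\<And>l. l \<in> L \<Longrightarrow> int e \<le> b l" "\<And>l. l \<in> L \<Longrightarrow> b l \<le> C e l"
    and less: "Phi b < Phi (C e)"
  shows "\<exists>C'. chain e C' \<and> (\<forall>l\<in>L. C' e l \<le> C e l) \<and> cost e C' < cost e C"
proof -
  define a where "a = C e"
  have a: "feas a" "\<And>l. l \<in> L \<Longrightarrow> b l \<le> a l" using C b by (auto simp: chain_def a_def)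
  define S where "S = {l \<in> L. b l < a l}"
  define f :: "'l \<Rightarrow> int" where "f l = (if l \<in> S then 1 else 0)" for l
  have f01: "0 \<le> f l" "f l \<le> 1" for l by (auto simp: f_def)
  have 1: "f l \<le> a l - int e" if "l \<in> L" for l
    using a(2)[OF that] b(2)[OF that] by (auto simp: f_def S_def)
  have 2: "p * (a l - int e) - cnt a l \<le> a (pr l) - int e" for l
    using p mult_right_mono[of 1 p "int e"] by (simp add: cnt_def algebra_simps)
  obtain z where z: "\<And>l. l \<in> L \<Longrightarrow> f l \<le> z l" "\<And>l. l \<in> L \<Longrightarrow> z l \<le> a l - int e"
    "\<And>l. l \<in> L \<Longrightarrow> p * z l - cnt a l \<le> z (pr l)"
    "\<And>l. l \<in> L \<Longrightarrow> z (pr l) = f (pr l) \<or> z (pr l) = p * z l - cnt a l"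
    using least_closure[of f "\<lambda>l. a l - int e" "cnt a"] 1 2 by metis
  have z0: "0 \<le> z l" if "l \<in> L" for l using z(1)[OF that] f01(1)[of l] by linarith
  define x where "x l = a l - z l" for l
  have cnt_x: "cnt x l = cnt a l - p * z l + z (pr l)" for l
    by (simp add: cnt_def x_def algebra_simps)
  have x: "feas x" "\<And>l. l \<in> L \<Longrightarrow> int e \<le> x l"
    using z(2,3) by (force simp: feas_def cnt_x, force simp: x_def)
  have tight: "z (pr l) = f (pr l)" if "l \<in> L" "cnt x l \<noteq> 0" for l
    using z(4)[OF that(1)] that(2) by (auto simp: cnt_x)
  obtain g where "descends e x g" using descent[OF x] by blast
  note g = descendsD[OF this]
  \<comment> \<open>Taking the meet with g m, instead of g m itself, keeps the bottom at 0 and never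
    raises a member.\<close>
  define C' where "C' m = meet (C m) (g m)" for m
  have C'_feas: "feas (C' m)" if "m \<le> e" for m
    using that C g(2) unfolding C'_def by (intro feas_meet) (auto simp: chain_def)
  have C'_top: "C' e l = x l" if "l \<in> L" for l
    using z0[OF that] by (simp add: C'_def g(1) x_def flip: a_def)
  have chain': "chain e C'"
    unfolding chain_def
  proof (intro conjI allI impI ballI)
    show "C' 0 l = 0" if "l \<in> L" for l using C g(3)[of 0 l] that by (force simp: C'_def chain_def)
    show "feas (C' m)" if "m \<le> e" for m using that by (rule C'_feas)
    show "C' m l + 1 \<le> C' (Suc m) l" if "m < e" "l \<in> L" for m l
    proof -
      have "C m l + 1 \<le> C (Suc m) l" "g m l + 1 \<le> g (Suc m) l" using C g(4)[OF that] that by (auto simp: chain_def)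
      thus ?thesis by (auto simp: C'_def min_def)
    qed
  qed
  define Q where "Q m = {l \<in> L. cnt (C m) l < cnt (C' m) l}" for m
  \<comment> \<open>A gain needs a positive count of g m, and there the descent has lowered the
    charge at \<open>pr l\<close> exactly to x (pr l) - (e - m). Since C m (pr l) is at most a (pr
    l) - (e - m), the meet takes away at most z (pr l) = f (pr l), hence at most 1.\<close>
  have gain: "0 < cnt (g m) l" "cnt (C' m) l \<le> cnt (g m) l" "cnt (g m) l + (p - 1) * int (e - m) \<le> cnt x l"
    "cnt (C' m) l = cnt (C m) l + 1" "pr l \<in> S" "z (pr l) = 1"
    if m: "m \<le> e" and l: "l \<in> Q m" for m l
  proof -
    have lL: "l \<in> L" and lt: "cnt (C m) l < cnt (C' m) l" using l by (auto simp: Q_def)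
    show le: "cnt (C' m) l \<le> cnt (g m) l"
      using cnt_meet[of "C m" l "g m"] lt by (simp add: C'_def max_def split: if_splits)
    have "0 \<le> cnt (C m) l" using C lL m by (auto simp: chain_def feas_def)
    thus pos: "0 < cnt (g m) l" using le lt by linarith
    hence 3: "g m (pr l) = x (pr l) - int (e - m)"
      and 4: "cnt (g m) l + (p - 1) * int (e - m) \<le> cnt x l" using g(5)[OF m lL] by auto
    show "cnt (g m) l + (p - 1) * int (e - m) \<le> cnt x l" by fact
    have "0 \<le> (p - 1) * int (e - m)" using p by simp
    hence zf: "z (pr l) = f (pr l)" using pos 4 by (intro tight lL) linarith
    have "C m (pr l) \<le> a (pr l) - int (e - m)"
      unfolding a_def by (rule chain_le[OF C m pr_in[OF lL]])
    hence "C m (pr l) - C' m (pr l) \<le> f (pr l)"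
      using 3 zf f01(1)[of "pr l"] by (simp add: C'_def x_def min_def)
    moreover have "p * C' m l \<le> p * C m l" by (rule p_mono) (simp add: C'_def)
    ultimately have up: "cnt (C' m) l \<le> cnt (C m) l + f (pr l)" by (simp add: cnt_def)
    show "pr l \<in> S" using up lt by (auto simp: f_def split: if_splits)
    thus "cnt (C' m) l = cnt (C m) l + 1" "z (pr l) = 1" using up lt zf by (simp_all add: f_def)
  qed
  define Lost where "Lost = {l \<in> L. cnt x l < cnt a l}"
  \<comment> \<open>Lowering the charge of class l costs at least p tokens and at most one comes
    back through \<open>pr l\<close>, unless the count becomes 0 anyway.\<close>
  have drop: "cnt x l < cnt a l" if "l \<in> L" "1 \<le> z l" "0 < cnt a l" for l
  proof (cases "cnt x l = 0")
    case False
    have "p \<le> p * z l" using p_mono[OF that(2)] by simp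
    thus ?thesis using tight[OF that(1) False] f01(2)[of "pr l"] p unfolding cnt_x by linarith
  qed (use that in simp)
  \<comment> \<open>If no count dropped, then p * z l is at most z (pr l) throughout; summing over
    the permutation forces z = 0, so S is empty and a = b on L.\<close>
  have "Lost \<noteq> {}"
  proof
    assume "Lost = {}"
    hence le: "cnt a l \<le> cnt x l" if "l \<in> L" for l using that by (force simp: Lost_def)
    have "(\<Sum>l\<in>L. p * z l) \<le> (\<Sum>l\<in>L. z (pr l))"
      using le by (intro sum_mono) (simp add: cnt_x)
    also have "\<dots> = (\<Sum>l\<in>L. z l)" by (rule sum.reindex_bij_betw[OF pr])
    finally have "(p - 1) * (\<Sum>l\<in>L. z l) \<le> 0" by (simp add: left_diff_distrib flip: sum_distrib_left)
    hence "(\<Sum>l\<in>L. z l) \<le> 0" using p by (simp add: mult_le_0_iff)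
    moreover have "0 \<le> (\<Sum>l\<in>L. z l)" using z0 by (rule sum_nonneg)
    ultimately have "(\<Sum>l\<in>L. z l) = 0" by linarith
    hence "z l = 0" if "l \<in> L" for l
      using that z0 fin by (simp add: sum_nonneg_eq_0_iff)
    hence "l \<notin> S" if "l \<in> L" for l using z(1)[OF that] that by (auto simp: f_def)
    hence "b l = a l" if "l \<in> L" for l using that a(2)[OF that] by (force simp: S_def)
    hence "Phi b = Phi a" by (rule Phi_cong)
    thus False using less by (simp add: a_def)
  qed
  moreover have "finite Lost" using fin by (simp add: Lost_def)
  ultimately obtain i0 where i0: "i0 \<in> Lost"
    and i0_max: "\<And>i. i \<in> Lost \<Longrightarrow> val i (nat (cnt a i - 1)) \<le> val i0 (nat (cnt a i0 - 1))"
    using obtain_max[of Lost "\<lambda>i. val i (nat (cnt a i - 1))"] by blast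
  define P where "P = val i0 (nat (cnt a i0 - 1))"
  \<comment> \<open>An upper bound for the token gained by member m in class l. Its index comes from
    g m and not from C' m, because the positive counts of g differ between members and so give
    distinct tokens.\<close>
  define bad where "bad m l = val l (nat (cnt (g m) l - 1))" for m l
  have bad_less: "bad m l < P" if m: "m \<le> e" and l: "l \<in> Q m" for m l
  proof (cases "1 \<le> z l")
    case True
    have lL: "l \<in> L" using l by (simp add: Q_def)
    have "0 \<le> (p - 1) * int (e - m)" using p by simp
    hence "cnt (g m) l \<le> cnt x l" using gain(3)[OF m l] by linarith
    moreover have "p \<le> p * z l" using p_mono[OF True] by simp
    ultimately have le: "cnt (g m) l + (p - 1) \<le> cnt a l" using gain(6)[OF m l] unfolding cnt_x by linarith
    have "bad m l < val l (nat (cnt (g m) l - 1) + nat (p - 1))"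
      unfolding bad_def by (rule val_jump[OF lL])
    also have "\<dots> \<le> val l (nat (cnt a l - 1))"
      using le gain(1)[OF m l] p by (intro val_mono lL) simp
    also have "\<dots> \<le> P"
      unfolding P_def using le gain(1)[OF m l] p by (intro i0_max) (use drop lL True in \<open>auto simp: Lost_def\<close>)
    finally show ?thesis .
  next
    \<comment> \<open>Class l keeps its charge but gains through \<open>pr l\<close>, so b has more
      tokens of class l than a. As a is not cheaper than b, \<open>Phi_less\<close> provides a token
      of a that b lacks and that is at least as large; its class lies in S and loses tokens.\<close>
    case False
    have lL: "l \<in> L" using l by (simp add: Q_def)
    have zl: "z l = 0" using False z0[OF lL] by simp
    hence "l \<notin> S" using z(1)[OF lL] by (auto simp: f_def)
    hence ab: "a l = b l" using a(2)[OF lL] lL by (force simp: S_def)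
    hence gt: "cnt a l < cnt b l" using gain(5)[OF m l] by (simp add: cnt_def S_def)
    have "0 \<le> cnt a l" using a lL by (auto simp: feas_def)
    moreover have "\<not> Phi a < Phi b" using less by (simp add: a_def)
    ultimately obtain i k where ik: "(i, k) \<in> tok a - tok b" "val l (nat (cnt b l - 1)) \<le> val i k"
      using Phi_less[OF lL _ gt] by (meson not_le)
    have i: "i \<in> L" "cnt b i < cnt a i" using ik by (auto simp: tok_def)
    have "0 \<le> cnt b i" using b(1) i by (simp add: feas_def)
    have "p * b i - b (pr i) < p * a i - a (pr i)" using i(2) by (simp add: cnt_def)
    hence "p * b i < p * a i" using a(2)[OF pr_in[OF i(1)]] by linarith
    hence "i \<in> S" using p i by (simp add: S_def)
    hence "1 \<le> z i" using z(1)[OF i(1)] by (simp add: f_def)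
    hence "i \<in> Lost" using drop[OF i(1)] i \<open>0 \<le> cnt b i\<close> by (simp add: Lost_def)
    have "0 \<le> (p - 1) * int (e - m)" using p by simp
    hence "cnt (g m) l \<le> cnt x l" using gain(3)[OF m l] by linarith
    hence "cnt (g m) l \<le> cnt b l" using gt zl gain(6)[OF m l] by (simp add: cnt_x)
    hence "bad m l \<le> val l (nat (cnt b l - 1))"
      unfolding bad_def by (intro val_mono lL) simp
    also note ik(2)
    also have "val i k \<le> val i (nat (cnt a i - 1))"
      using ik(1) by (intro val_mono i) (auto simp: tok_def)
    finally have "bad m l \<le> val i (nat (cnt a i - 1))" .
    moreover have "i \<noteq> l" using i gt by auto
    hence "bad m l \<noteq> val i (nat (cnt a i - 1))"
      unfolding bad_def using val_disjoint[OF lL i(1)] by blast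
    ultimately show ?thesis using i0_max[OF \<open>i \<in> Lost\<close>] by (simp add: P_def)
  qed
  have Phi_step: "Phi (C' m) + (if m = e then P else 0) \<le> Phi (C m) + (\<Sum>l\<in>Q m. bad m l)" if m: "m \<le> e" for m
  proof -
    have per_class: "(\<Sum>k<nat (cnt (C' m) l). val l k) + (if l = i0 then if m = e then P else 0 else 0)
        \<le> (\<Sum>k<nat (cnt (C m) l). val l k) + (if l \<in> Q m then bad m l else 0)" if l: "l \<in> L" for l
    proof -
      have C'e: "cnt (C' e) l = cnt x l" using C'_top l pr_in[OF l] by (simp add: cnt_def)
      have nn: "0 \<le> cnt (C m) l" "0 \<le> cnt (C' m) l" using C C'_feas[OF m] m l by (auto simp: chain_def feas_def)
      consider "l \<in> Q m" | "m = e" "l = i0" | "l \<notin> Q m" "\<not> (m = e \<and> l = i0)" by blast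
      thus ?thesis
      proof cases
        case 1
        have "nat (cnt (C' m) l) = Suc (nat (cnt (C m) l))" using gain(4)[OF m 1] nn by simp
        hence "(\<Sum>k<nat (cnt (C' m) l). val l k) = (\<Sum>k<nat (cnt (C m) l). val l k) + val l (nat (cnt (C m) l))"
          by simp
        moreover have "val l (nat (cnt (C m) l)) \<le> bad m l"
          unfolding bad_def using gain(2,4)[OF m 1] by (intro val_mono l) simp
        moreover have "\<not> (m = e \<and> l = i0)" using i0 1 C'e by (auto simp: Q_def Lost_def a_def)
        ultimately show ?thesis using 1 by auto
      next
        case 2
        hence lt: "cnt x l < cnt (C m) l" using i0 by (simp add: Lost_def a_def)
        hence "(\<Sum>k<nat (cnt x l). val l k) + P \<le> (\<Sum>k<Suc (nat (cnt (C m) l - 1)). val l k)"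
          using 2 by (auto simp: P_def a_def intro!: sum_mono2)
        also have "Suc (nat (cnt (C m) l - 1)) = nat (cnt (C m) l)" using lt nn 2 C'e by simp
        finally show ?thesis using 2 C'e by simp
      next
        case 3
        have "cnt (C' m) l \<le> cnt (C m) l" using 3(1) l by (simp add: Q_def)
        hence "(\<Sum>k<nat (cnt (C' m) l). val l k) \<le> (\<Sum>k<nat (cnt (C m) l). val l k)"
          by (intro sum_mono2) auto
        thus ?thesis using 3 by auto
      qed
    qed
    have "Phi (C' m) + (if m = e then P else 0)
        = (\<Sum>l\<in>L. (\<Sum>k<nat (cnt (C' m) l). val l k) + (if l = i0 then if m = e then P else 0 else 0))"
      using i0 fin by (simp add: Phi_classes sum.distrib Lost_def)
    also have "\<dots> \<le> (\<Sum>l\<in>L. (\<Sum>k<nat (cnt (C m) l). val l k) + (if l \<in> Q m then bad m l else 0))"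
      by (rule sum_mono) (rule per_class)
    also have "\<dots> = Phi (C m) + (\<Sum>l\<in>L. if l \<in> Q m then bad m l else 0)"
      by (simp add: Phi_classes sum.distrib)
    also have "(\<Sum>l\<in>L. if l \<in> Q m then bad m l else 0) = (\<Sum>l\<in>L \<inter> Q m. bad m l)"
      using fin by (simp add: sum.inter_restrict)
    also have "L \<inter> Q m = Q m" by (auto simp: Q_def)
    finally show ?thesis .
  qed
  have finQ: "finite (Q m)" for m using fin by (simp add: Q_def)
  define t where "t = (\<lambda>(m, l). (l, nat (cnt (g m) l - 1)))"
  have inj: "inj_on t (Sigma {..e} Q)"
  proof (rule inj_onI)
    fix u v assume uv: "u \<in> Sigma {..e} Q" "v \<in> Sigma {..e} Q" "t u = t v"
    obtain m l m' l' where u: "u = (m, l)" and v: "v = (m', l')" by (cases u, cases v)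
    have *: "m \<in> {..e}" "l \<in> Q m" "m' \<in> {..e}" "l' \<in> Q m'" "t (m, l) = t (m', l')"
      using uv unfolding u v by auto
    have l: "l' = l" "cnt (g m) l = cnt (g m') l" using * gain(1)[of m l] gain(1)[of m' l'] by (auto simp: t_def)
    have "\<not> m < m'" "\<not> m' < m" using g(6)[of m' m l] g(6)[of m m' l] * l gain(1)[of m l] by (auto simp: Q_def)
    thus "u = v" using l u v by simp
  qed
  have "(\<Sum>m\<le>e. \<Sum>l\<in>Q m. bad m l) = (\<Sum>(m, l)\<in>Sigma {..e} Q. bad m l)"
    by (rule sum.Sigma) (use finQ in auto)
  also have "\<dots> = (\<Sum>(l, k)\<in>t ` Sigma {..e} Q. val l k)"
    by (subst sum.reindex[OF inj]) (auto simp: t_def bad_def intro!: sum.cong)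
  also have "\<dots> < P"
    unfolding P_def
  proof (rule val_sum, unfold P_def[symmetric])
    show "i0 \<in> L" using i0 by (simp add: Lost_def)
    show "finite (t ` Sigma {..e} Q)" using finQ by (intro finite_imageI finite_SigmaI) auto
    show "t ` Sigma {..e} Q \<subseteq> L \<times> UNIV" by (auto simp: t_def Q_def)
    fix i j assume "(i, j) \<in> t ` Sigma {..e} Q"
    then obtain m where "m \<le> e" "i \<in> Q m" "j = nat (cnt (g m) i - 1)" by (auto simp: t_def)
    thus "val i j < P" using bad_less[of m i] by (simp add: bad_def P_def)
  qed
  finally have bad_sum: "(\<Sum>m\<le>e. \<Sum>l\<in>Q m. bad m l) < P" .
  have "cost e C' + P = (\<Sum>m\<le>e. Phi (C' m) + (if m = e then P else 0))"
    by (simp add: cost_def sum.distrib sum.delta)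
  also have "\<dots> \<le> (\<Sum>m\<le>e. Phi (C m) + (\<Sum>l\<in>Q m. bad m l))"
    by (rule sum_mono) (simp add: Phi_step)
  also have "\<dots> = cost e C + (\<Sum>m\<le>e. \<Sum>l\<in>Q m. bad m l)" by (simp add: sum.distrib cost_def)
  finally have "cost e C' < cost e C" using bad_sum by linarith
  moreover have "\<forall>l\<in>L. C' e l \<le> C e l" by (simp add: C'_def)
  ultimately show ?thesis using chain' by blast
qed

text \<open>The elements of A are upper bounds; with \<open>A = {}\<close> there is none.\<close>

definition room :: "nat \<Rightarrow> ('l \<Rightarrow> int) set \<Rightarrow> ('l \<Rightarrow> int) set" where
  "room e A = {c. feas c \<and> (\<forall>l\<in>L. int e \<le> c l) \<and> (\<forall>u\<in>A. \<forall>l\<in>L. c l \<le> u l)}"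

section \<open>Optimality and uniqueness of the greedy chain\<close>

lemma chain_ge:
  assumes "chain e C" "m \<le> e" "l \<in> L"
  shows "int m \<le> C m l"
  using assms(2)
proof (induction m)
  case 0
  thus ?case using assms by (simp add: chain_def)
next
  case (Suc m)
  have "C m l + 1 \<le> C (Suc m) l" using assms Suc.prems by (simp add: chain_def)
  thus ?case using Suc by simp
qed

text \<open>This pins the top of a cheapest chain to b. If the top lies above b, the exchange above
  applies. Otherwise the join with b is still a valid top, and it is cheaper by submodularity
  because the meet costs more than b.\<close>

lemma chain_improve:
  assumes C: "chain (Suc e) C" "C (Suc e) \<in> room (Suc e) A"
    and b: "b \<in> room (Suc e) A" "\<And>x. x \<in> room (Suc e) A \<Longrightarrow> Phi b \<le> Phi x"
    and ne: "l0 \<in> L" "C (Suc e) l0 \<noteq> b l0"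
  shows "\<exists>C'. chain (Suc e) C' \<and> C' (Suc e) \<in> room (Suc e) A \<and> cost (Suc e) C' < cost (Suc e) C"
proof -
  let ?a = "C (Suc e)"
  have feas: "feas ?a" "feas b" using C(2) b(1) by (simp_all add: room_def)
  have Phi_eq: "x l0 = b l0" if "x \<in> room (Suc e) A" "Phi x \<le> Phi b" for x
    using b(2)[OF that(1)] that feas(2) ne(1) by (intro Phi_inj) (auto simp: room_def)
  show ?thesis
  proof (cases "\<forall>l\<in>L. b l \<le> ?a l")
    case True
    have "Phi b < Phi ?a" using Phi_eq[OF C(2)] ne(2) by force
    then obtain C' where C': "chain (Suc e) C'" "\<forall>l\<in>L. C' (Suc e) l \<le> ?a l" "cost (Suc e) C' < cost (Suc e) C"
      using chain_improve_above[OF C(1), of b] b(1) True by (auto simp: room_def)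
    have "C' (Suc e) \<in> room (Suc e) A"
      using C' chain_ge[OF C'(1)] C(2) unfolding room_def by (force simp: chain_def)
    thus ?thesis using C' by blast
  next
    case False
    define C' where "C' = C(Suc e := join ?a b)"
    have meet: "meet ?a b \<in> room (Suc e) A"
      using C(2) b(1) feas_meet[OF feas] by (force simp: room_def)
    have join: "join ?a b \<in> room (Suc e) A"
      using C(2) b(1) feas_join[OF feas] by (force simp: room_def)
    obtain l1 where l1: "l1 \<in> L" "?a l1 < b l1" using False by force
    have "Phi b < Phi (meet ?a b)"
    proof (rule ccontr)
      assume "\<not> ?thesis"
      hence "Phi (meet ?a b) = Phi b" using b(2)[OF meet] by simp
      hence "meet ?a b l1 = b l1" using meet feas l1 by (intro Phi_inj) (auto simp: room_def)
      thus False using l1 by simp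
    qed
    hence "Phi (join ?a b) < Phi ?a" using Phi_submodular[OF feas] by simp
    moreover have "cost (Suc e) C' = (\<Sum>m\<le>e. Phi (C m)) + Phi (join ?a b)"
      by (simp add: cost_def C'_def)
    ultimately have "cost (Suc e) C' < cost (Suc e) C" by (simp add: cost_def)
    moreover have "chain (Suc e) C'"
      unfolding chain_def
    proof (intro conjI allI impI ballI)
      show "C' 0 l = 0" if "l \<in> L" for l using C(1) that by (simp add: chain_def C'_def)
      show "feas (C' m)" if "m \<le> Suc e" for m using C(1) that join by (auto simp: chain_def C'_def room_def)
      show "C' m l + 1 \<le> C' (Suc m) l" if "m < Suc e" "l \<in> L" for m l
        using C(1) that by (force simp: chain_def C'_def less_Suc_eq)
    qed
    ultimately show ?thesis using join by (intro exI[of _ C']) (simp add: C'_def)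
  qed
qed

text \<open>
  Otherwise a small charge s could be moved from b to c such that all counts of the two approach each
  other.  By convexity this does not increase the total value, contradicting the choice of b or of c.
\<close>

lemma greedy_nested:
  assumes b: "b \<in> room (Suc e) A" "\<And>x. x \<in> room (Suc e) A \<Longrightarrow> Phi b \<le> Phi x"
    and c: "c \<in> room e {\<lambda>l. b l - 1}" "\<And>x. x \<in> room e {\<lambda>l. b l - 1} \<Longrightarrow> Phi c \<le> Phi x"
    and l0: "l0 \<in> L"
  shows "cnt c l0 \<le> cnt b l0"
proof (rule ccontr)
  assume contra: "\<not> ?thesis"
  define w where "w l = b l - c l" for l
  have cnt_w: "cnt w l = cnt b l - cnt c l" for l by (simp add: cnt_def w_def algebra_simps)
  have w1: "1 \<le> w l" if "l \<in> L" for l using c(1) that by (force simp: room_def w_def)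
  define f :: "'l \<Rightarrow> int" where "f l = (if l = pr l0 then 1 else 0)" for l
  define h where "h l = max 0 (cnt w l)" for l
  \<comment> \<open>The negative count makes w (pr l0) at least 2, so a unit of charge at
    \<open>pr l0\<close> can be moved while b - c keeps a margin of 1.\<close>
  have "cnt w l0 < 0" using contra by (simp add: cnt_w)
  hence "p * w l0 < w (pr l0)" by (simp add: cnt_def)
  moreover have "p \<le> p * w l0" using p_mono[OF w1[OF l0]] by simp
  ultimately have "2 \<le> w (pr l0)" using p by linarith
  hence 1: "f l \<le> w l - 1" if "l \<in> L" for l using w1[OF that] by (auto simp: f_def)
  have 2: "p * (w l - 1) - h l \<le> w (pr l) - 1" for l
    using p by (simp add: h_def cnt_def algebra_simps)
  obtain s where s: "\<And>l. l \<in> L \<Longrightarrow> f l \<le> s l" "\<And>l. l \<in> L \<Longrightarrow> s l \<le> w l - 1"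
    "\<And>l. l \<in> L \<Longrightarrow> p * s l - h l \<le> s (pr l)"
    "\<And>l. l \<in> L \<Longrightarrow> s (pr l) = f (pr l) \<or> s (pr l) = p * s l - h l"
    using least_closure[of f "\<lambda>l. w l - 1" h] 1 2 by metis
  have s0: "0 \<le> s l" if "l \<in> L" for l using s(1)[OF that] by (auto simp: f_def split: if_splits)
  \<comment> \<open>The bound h caps the counts of s by the positive part of those of w. From below,
    a tight class has count h >= 0, and a class that is not tight can be negative only at l0, with
    count p * s l0 - 1 >= -1, which the negative integer \<open>cnt w l0\<close> permits.\<close>
  have conformal: "min 0 (cnt w l) \<le> cnt s l \<and> cnt s l \<le> max 0 (cnt w l)" if l: "l \<in> L" for l
  proof
    show "cnt s l \<le> max 0 (cnt w l)" using s(3)[OF l] by (simp add: cnt_def h_def)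
    have ps: "0 \<le> p * s l" using p_mono[OF s0[OF l]] by simp
    show "min 0 (cnt w l) \<le> cnt s l"
    proof (cases "s (pr l) = p * s l - h l")
      case False
      hence eq: "s (pr l) = f (pr l)" using s(4)[OF l] by blast
      show ?thesis
      proof (cases "l = l0")
        case True
        hence "cnt s l = p * s l - 1" using eq by (simp add: cnt_def f_def)
        thus ?thesis using \<open>cnt w l0 < 0\<close> ps True by simp
      next
        case False
        hence "pr l \<noteq> pr l0" using pr l l0 by (auto simp: bij_betw_def inj_on_def)
        thus ?thesis using ps by (simp add: cnt_def[of s] eq f_def)
      qed
    qed (simp add: cnt_def[of s] h_def)
  qed
  define b' where "b' l = b l - s l" for l
  define c' where "c' l = c l + s l" for l
  have cnt': "cnt b' l = cnt b l - cnt s l" "cnt c' l = cnt c l + cnt s l" for l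
    by (simp_all add: cnt_def b'_def c'_def algebra_simps)
  have feas: "feas b" "feas c" using b(1) c(1) by (simp_all add: room_def)
  have bounds: "min (cnt b l) (cnt c l) \<le> cnt b' l \<and> cnt b' l \<le> max (cnt b l) (cnt c l)"
    "min (cnt b l) (cnt c l) \<le> cnt c' l" if "l \<in> L" for l
    using conformal[OF that] unfolding cnt' cnt_w by linarith+
  have feas': "feas b'" "feas c'"
    using feas bounds unfolding feas_def by (meson min.bounded_iff order_trans)+
  have "b' \<in> room (Suc e) A"
    using feas' b(1) c(1) s(2) s0 unfolding room_def w_def b'_def
    by (force intro: order_trans[of _ "b _"])
  moreover have "c' \<in> room e {\<lambda>l. b l - 1}"
    using feas' c(1) s(2) s0 unfolding room_def w_def c'_def by force
  moreover have "Phi b' + Phi c' \<le> Phi b + Phi c"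
    by (rule Phi_exchange[OF feas feas']) (use bounds in \<open>auto simp: cnt'\<close>)
  ultimately have "Phi b' = Phi b" using b(2)[of b'] c(2)[of c'] by linarith
  hence "b' (pr l0) = b (pr l0)" using feas feas' pr_in[OF l0] by (intro Phi_inj) auto
  thus False using s(1)[OF pr_in[OF l0]] by (simp add: b'_def f_def)
qed

text \<open>Induction on e with A arbitrary: once the top b is fixed, the rest is the same problem
  with the single upper bound b - 1. Any chain is compared with a cheapest one, whose top is b by
  \<open>chain_improve\<close>. Minimality of \<open>Phi (G e)\<close> is carried along because
  \<open>greedy_nested\<close> asks for it.\<close>

theorem unique_optimal_chain:
  assumes "room e A \<noteq> {}"
  shows "\<exists>G. chain e G \<and> G e \<in> room e A \<and> (\<forall>x\<in>room e A. Phi (G e) \<le> Phi x) \<and>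
    (\<forall>m<e. \<forall>l\<in>L. cnt (G m) l \<le> cnt (G (Suc m)) l) \<and>
    (\<forall>C. chain e C \<longrightarrow> C e \<in> room e A \<longrightarrow> cost e G \<le> cost e C \<and>
      (cost e C = cost e G \<longrightarrow> (\<forall>m\<le>e. \<forall>l\<in>L. C m l = G m l)))"
  using assms
proof (induction e arbitrary: A)
  case 0
  then obtain x where "x \<in> room 0 A" by blast
  hence "(\<lambda>_. 0) \<in> room 0 A" by (force simp: room_def feas_def cnt_def intro: order_trans[of 0 "x _"])
  moreover have "Phi (\<lambda>_. 0) = 0" by (simp add: Phi_classes cnt_def)
  ultimately show ?case
    by (intro exI[of _ "\<lambda>_ _. 0"]) (auto simp: chain_def cost_def room_def)
next
  case (Suc e)
  then obtain b where b: "b \<in> room (Suc e) A" "\<And>x. x \<in> room (Suc e) A \<Longrightarrow> Phi b \<le> Phi x"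
    using ex_has_least_nat[of "\<lambda>x. x \<in> room (Suc e) A" _ Phi] by blast
  let ?A = "{\<lambda>l. b l - 1}"
  have "room e ?A \<noteq> {}"
  proof -
    obtain y where "feas y" "\<And>l. l \<in> L \<Longrightarrow> int e \<le> y l" "\<And>l. l \<in> L \<Longrightarrow> y l + 1 \<le> b l"
      using b(1) by (auto simp: room_def intro: descent_step[of b e])
    hence "y \<in> room e ?A" by (force simp: room_def)
    thus ?thesis by blast
  qed
  then obtain H where H: "chain e H" "H e \<in> room e ?A" "\<forall>x\<in>room e ?A. Phi (H e) \<le> Phi x"
    "\<forall>m<e. \<forall>l\<in>L. cnt (H m) l \<le> cnt (H (Suc m)) l"
    "\<And>C. chain e C \<Longrightarrow> C e \<in> room e ?A \<Longrightarrow> cost e H \<le> cost e C \<and>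
      (cost e C = cost e H \<longrightarrow> (\<forall>m\<le>e. \<forall>l\<in>L. C m l = H m l))"
    using Suc.IH[of ?A] by blast
  define G where "G = H(Suc e := b)"
  have cost_G: "cost (Suc e) G = cost e H + Phi b" by (simp add: cost_def G_def)
  have top_G: "G (Suc e) = b" by (simp add: G_def)
  have chain_G: "chain (Suc e) G"
    using H(1,2) b(1) by (force simp: chain_def G_def room_def less_Suc_eq le_Suc_eq)
  have nested_G: "\<forall>m<Suc e. \<forall>l\<in>L. cnt (G m) l \<le> cnt (G (Suc m)) l"
    using H(4) greedy_nested[OF b H(2)] H(3) by (auto simp: G_def less_Suc_eq)
  have best_G: "cost (Suc e) G \<le> cost (Suc e) C \<and>
      (cost (Suc e) C = cost (Suc e) G \<longrightarrow> (\<forall>m\<le>Suc e. \<forall>l\<in>L. C m l = G m l))"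
    if C: "chain (Suc e) C" "C (Suc e) \<in> room (Suc e) A" for C
  proof -
    have optimal: "cost (Suc e) G \<le> cost (Suc e) D \<and>
        (cost (Suc e) D = cost (Suc e) G \<longrightarrow> (\<forall>m\<le>Suc e. \<forall>l\<in>L. D m l = G m l))"
      if D: "chain (Suc e) D" "D (Suc e) \<in> room (Suc e) A"
        and le: "\<And>D'. chain (Suc e) D' \<Longrightarrow> D' (Suc e) \<in> room (Suc e) A \<Longrightarrow> cost (Suc e) D \<le> cost (Suc e) D'" for D
    proof -
      have top: "D (Suc e) l = b l" if "l \<in> L" for l
        using chain_improve[OF D b that] le by (meson not_le)
      have chain: "chain e D" using D(1) by (simp add: chain_def)
      have "D e l \<le> b l - 1" if "l \<in> L" for l
        using D(1) top[OF that] that by (force simp: chain_def)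
      hence "D e \<in> room e ?A" using chain chain_ge[OF chain] by (auto simp: room_def chain_def)
      note * = H(5)[OF chain this]
      have cost_D: "cost (Suc e) D = cost e D + Phi b" using Phi_cong[OF top] by (simp add: cost_def)
      show ?thesis unfolding cost_G cost_D using * top by (auto simp: G_def le_Suc_eq)
    qed
    obtain D where D: "chain (Suc e) D" "D (Suc e) \<in> room (Suc e) A"
      and D_le: "\<And>D'. chain (Suc e) D' \<Longrightarrow> D' (Suc e) \<in> room (Suc e) A \<Longrightarrow> cost (Suc e) D \<le> cost (Suc e) D'"
      using ex_has_least_nat[of "\<lambda>D. chain (Suc e) D \<and> D (Suc e) \<in> room (Suc e) A" C "cost (Suc e)"] C by blast
    have GD: "cost (Suc e) G \<le> cost (Suc e) D" using optimal[OF D D_le] by blast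
    have "cost (Suc e) G \<le> cost (Suc e) C" using GD D_le[OF C] by simp
    moreover have "\<forall>m\<le>Suc e. \<forall>l\<in>L. C m l = G m l" if eq: "cost (Suc e) C = cost (Suc e) G"
    proof -
      have "cost (Suc e) C \<le> cost (Suc e) D'" if "chain (Suc e) D'" "D' (Suc e) \<in> room (Suc e) A" for D'
        using GD D_le[OF that] eq by simp
      thus ?thesis using optimal[OF C] eq by blast
    qed
    ultimately show ?thesis by blast
  qed
  show ?case
    by (intro exI[of _ G] conjI ballI allI impI, unfold top_G)
      (use chain_G b nested_G best_G in blast)+
qed

end

section \<open>Digits and chains of natural numbers\<close>

definition digit :: "nat \<Rightarrow> nat \<Rightarrow> nat \<Rightarrow> nat" where
  "digit p K s = K div p ^ s mod p"

text \<open>The cut-off K loses no digits, since K < p ^ K for p >= 2.\<close>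

definition digit_sum :: "nat \<Rightarrow> (nat \<Rightarrow> nat) \<Rightarrow> nat \<Rightarrow> nat" where
  "digit_sum p h K = (\<Sum>s<K. digit p K s * h s)"

lemma digit_less: "2 \<le> p \<Longrightarrow> digit p K s < p"
  by (simp add: digit_def)

lemma digit_0 [simp]: "digit p 0 s = 0"
  by (simp add: digit_def)

lemma digit_eq_0: "K < p ^ N \<Longrightarrow> N \<le> s \<Longrightarrow> 1 \<le> p \<Longrightarrow> digit p K s = 0"
  using power_increasing[of N s p] by (simp add: digit_def div_less)

lemma sum_digits_mod: "(\<Sum>s<N. digit p K s * p ^ s) = K mod p ^ N"
proof (induction N)
  case (Suc N)
  have "K mod p ^ Suc N = p ^ N * (K div p ^ N mod p) + K mod p ^ N"
    using mod_mult2_eq[of K "p ^ N" p] by (simp add: mult.commute)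
  thus ?case using Suc by (simp add: digit_def mult.commute)
qed simp

lemma less_power_self: "2 \<le> p \<Longrightarrow> (K::nat) < p ^ K"
  by (rule order.strict_trans2[OF less_exp power_mono]) simp_all

lemma digit_sum_eq:
  assumes "2 \<le> p" "K < p ^ N"
  shows "digit_sum p h K = (\<Sum>s<N. digit p K s * h s)"
proof -
  have ext: "(\<Sum>s<M. digit p K s * h s) = (\<Sum>s<M + M'. digit p K s * h s)" if "K < p ^ M" for M M'
    by (rule sum.mono_neutral_left) (use digit_eq_0[OF that] assms in auto)
  show ?thesis
    unfolding digit_sum_def
    using ext[OF less_power_self[OF assms(1)], of N] ext[OF assms(2), of K] by (simp add: add.commute)
qed

lemma digit_sum_powers: "2 \<le> p \<Longrightarrow> digit_sum p (\<lambda>s. p ^ s) K = K"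
  unfolding digit_sum_def sum_digits_mod by (simp add: less_power_self)

lemma digits_inject:
  assumes "2 \<le> p" "\<And>s. digit p K s = digit p K' s"
  shows "K = K'"
proof -
  have lt: "K < p ^ (K + K')" "K' < p ^ (K + K')"
    using less_power_self[OF assms(1), of "K + K'"] by simp_all
  have "K mod p ^ (K + K') = K' mod p ^ (K + K')"
    unfolding sum_digits_mod[symmetric] assms(2) ..
  thus ?thesis unfolding mod_less[OF lt(1)] mod_less[OF lt(2)] .
qed

lemma digits_sum_less:
  fixes d :: "nat \<Rightarrow> nat"
  assumes "\<And>s. d s < p"
  shows "(\<Sum>s<N. d s * p ^ s) < p ^ N"
proof (induction N)
  case (Suc N)
  have "(\<Sum>s<Suc N. d s * p ^ s) < (1 + d N) * p ^ N" using Suc by simp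
  also have "\<dots> \<le> p * p ^ N" using assms[of N] by (intro mult_right_mono) simp_all
  finally show ?case by simp
qed simp

lemma digit_of_sum:
  fixes d :: "nat \<Rightarrow> nat"
  assumes "\<And>s. d s < p" "\<And>s. N \<le> s \<Longrightarrow> d s = 0"
  shows "digit p (\<Sum>s<N. d s * p ^ s) s = d s"
proof -
  have p: "0 < p" using assms(1)[of 0] by simp
  have K: "(\<Sum>s<N. d s * p ^ s) = (\<Sum>s<N + M. d s * p ^ s)" for M
    by (rule sum.mono_neutral_left) (use assms(2) in auto)
  have "(\<Sum>i<Suc s + M. d i * p ^ i) = (\<Sum>i<Suc s. d i * p ^ i) + p ^ Suc s * (\<Sum>i<M. d (Suc s + i) * p ^ i)" for M
    by (induction M) (simp_all add: algebra_simps power_add)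
  from this[of N] have "(\<Sum>i<N. d i * p ^ i)
      = (\<Sum>i<s. d i * p ^ i) + p ^ s * (d s + p * (\<Sum>i<N. d (Suc s + i) * p ^ i))"
    using K[of "Suc s"] by (simp add: algebra_simps add.commute)
  moreover have "(\<Sum>i<s. d i * p ^ i) < p ^ s" by (rule digits_sum_less) (rule assms(1))
  ultimately show ?thesis using p assms(1)[of s] by (simp add: digit_def)
qed

lemma digit_sum_strict_mono:
  assumes p: "2 \<le> p" and le: "\<And>s. digit p K s \<le> digit p K' s" and "K < K'" and h: "\<And>s. 0 < h s"
  shows "digit_sum p h K < digit_sum p h K'"
proof -
  have lt: "K' < p ^ K'" "K < p ^ K'" using less_power_self[OF p, of K'] \<open>K < K'\<close> by simp_all
  have "\<exists>s. digit p K s \<noteq> digit p K' s" using digits_inject[OF p, of K K'] \<open>K < K'\<close> by auto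
  then obtain s where s: "digit p K s < digit p K' s" using le by (metis le_neq_implies_less)
  have "s < K'" using s digit_eq_0[OF lt(1), of s] p by (cases "s < K'") auto
  have "(\<Sum>s<K'. digit p K s * h s) < (\<Sum>s<K'. digit p K' s * h s)"
    by (rule sum_strict_mono_ex1) (use le s h \<open>s < K'\<close> in auto)
  thus ?thesis using digit_sum_eq[OF p lt(1)] digit_sum_eq[OF p lt(2)] by simp
qed

lemma le_if_digits_le:
  assumes "2 \<le> p" "\<And>s. digit p K s \<le> digit p K' s"
  shows "K \<le> K'"
proof -
  have lt: "K < p ^ (K + K')" "K' < p ^ (K + K')" using less_power_self[OF assms(1), of "K + K'"] by simp_all
  have "(\<Sum>s<K + K'. digit p K s * p ^ s) \<le> (\<Sum>s<K + K'. digit p K' s * p ^ s)"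
    using assms(2) by (intro sum_mono mult_right_mono) auto
  thus ?thesis using lt by (simp add: sum_digits_mod)
qed

text \<open>
  The digits are eventually maximal so that every residue class modulo r contains infinitely many tokens; this
  saves upper bounds on the class counts.
\<close>

locale digit_universe =
  fixes p r :: nat and \<tau> :: "nat \<Rightarrow> nat"
  assumes p: "2 \<le> p" and r: "1 \<le> r" and \<tau>_less: "\<tau> s < p" and \<tau>_full: "\<exists>N. \<forall>s\<ge>N. \<tau> s = p - 1"
begin

section \<open>Positions of the tokens of a class\<close>

definition cum :: "nat \<Rightarrow> nat \<Rightarrow> nat" where
  "cum l s = (\<Sum>j<s. if j mod r = l then \<tau> j else 0)"

text \<open>The exponent of token k of class l, counted from 0: position s carries \<tau> s tokens,
  and \<open>cum l s\<close> tokens of class l lie below s.\<close>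

definition pos :: "nat \<Rightarrow> nat \<Rightarrow> nat" where
  "pos l k = (LEAST s. k < cum l (Suc s))"

definition prev :: "nat \<Rightarrow> nat" where
  "prev l = (l + (r - 1)) mod r"

lemma cum_Suc: "cum l (Suc s) = cum l s + (if s mod r = l then \<tau> s else 0)"
  by (simp add: cum_def)

lemma cum_mono: "s \<le> s' \<Longrightarrow> cum l s \<le> cum l s'"
  unfolding cum_def by (intro sum_mono2) auto

lemma cum_unbounded:
  assumes "l < r"
  shows "\<exists>s. k < cum l s"
proof -
  obtain N where N: "\<And>s. N \<le> s \<Longrightarrow> \<tau> s = p - 1" using \<tau>_full by blast
  have step: "cum l s < cum l (Suc (max s N * r + l))" for s
  proof -
    let ?t = "max s N * r + l"
    have "?t mod r = l" using assms by simp
    moreover have "max s N * 1 \<le> max s N * r" using r by (intro mult_le_mono2) simp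
    hence le: "max s N \<le> ?t" by simp
    ultimately have "cum l ?t < cum l (Suc ?t)" using N[of ?t] p by (simp add: cum_Suc)
    moreover have "cum l s \<le> cum l ?t" using le by (intro cum_mono) simp
    ultimately show ?thesis by simp
  qed
  show ?thesis
  proof (induction k)
    case 0
    have "0 < cum l (Suc (max 0 N * r + l))" using step[of 0] by linarith
    thus ?case by blast
  next
    case (Suc k)
    then obtain s where "k < cum l s" by blast
    hence "Suc k < cum l (Suc (max s N * r + l))" using step[of s] by simp
    thus ?case by blast
  qed
qed

lemma pos_bounds:
  assumes "l < r"
  shows "cum l (pos l k) \<le> k" "k < cum l (Suc (pos l k))"
proof -
  obtain s where "k < cum l s" using cum_unbounded[OF assms] by blast
  hence "k < cum l (Suc s)" using cum_mono[of s "Suc s" l] by simp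
  thus "k < cum l (Suc (pos l k))" unfolding pos_def by (rule LeastI)
  show "cum l (pos l k) \<le> k"
  proof (cases "pos l k")
    case (Suc s)
    thus ?thesis using not_less_Least[of s "\<lambda>s. k < cum l (Suc s)"] by (simp add: pos_def)
  qed (simp add: cum_def)
qed

lemma pos_less_iff: "l < r \<Longrightarrow> pos l k < s \<longleftrightarrow> k < cum l s"
  using pos_bounds[of l k] cum_mono[of "Suc (pos l k)" s l] cum_mono[of s "pos l k" l] by (cases "pos l k < s") auto

lemma pos_mod: "l < r \<Longrightarrow> pos l k mod r = l"
  using pos_bounds[of l k] by (auto simp: cum_Suc split: if_splits)

lemma pos_mono: "l < r \<Longrightarrow> j \<le> k \<Longrightarrow> pos l j \<le> pos l k"
  using pos_less_iff[of l j "Suc (pos l k)"] pos_bounds(2)[of l k] by simp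

text \<open>No position holds more than p - 1 tokens.\<close>

lemma pos_jump: "l < r \<Longrightarrow> pos l k < pos l (k + (p - 1))"
proof -
  assume l: "l < r"
  have "cum l (Suc (pos l k)) \<le> k + (p - 1)"
    using pos_bounds(1)[OF l, of k] \<tau>_less[of "pos l k"] by (auto simp: cum_Suc)
  thus ?thesis using pos_less_iff[OF l, of "k + (p - 1)" "Suc (pos l k)"] by simp
qed

lemma pos_eq: "l < r \<Longrightarrow> cum l s \<le> k \<Longrightarrow> k < cum l (Suc s) \<Longrightarrow> pos l k = s"
  using pos_less_iff[of l k s] pos_less_iff[of l k "Suc s"] by simp

text \<open>All tokens below position N together form the number with digits \<tau> below N. It is
  less than p ^ N, which is what \<open>val_sum\<close> needs.\<close>

lemma sum_cum: "(\<Sum>l<r. \<Sum>k<cum l N. p ^ pos l k) = (\<Sum>s<N. \<tau> s * p ^ s)"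
proof (induction N)
  case 0
  thus ?case by (simp add: cum_def)
next
  case (Suc N)
  have "(\<Sum>k<cum l (Suc N). p ^ pos l k) = (\<Sum>k<cum l N. p ^ pos l k) + (if l = N mod r then \<tau> N * p ^ N else 0)"
    if "l < r" for l
  proof (cases "l = N mod r")
    case True
    have "pos l (cum l N + i) = N" if "i < \<tau> N" for i
      using that True \<open>l < r\<close> by (intro pos_eq) (simp_all add: cum_Suc)
    thus ?thesis using True by (simp add: cum_Suc sum_lessThan_add)
  qed (auto simp: cum_Suc)
  hence "(\<Sum>l<r. \<Sum>k<cum l (Suc N). p ^ pos l k)
      = (\<Sum>l<r. (\<Sum>k<cum l N. p ^ pos l k) + (if l = N mod r then \<tau> N * p ^ N else 0))"
    by (intro sum.cong) auto
  also have "\<dots> = (\<Sum>s<Suc N. \<tau> s * p ^ s)" using Suc r by (simp add: sum.distrib)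
  finally show ?case .
qed

lemma bij_prev: "bij_betw prev {..<r} {..<r}"
proof -
  have "inj_on prev {..<r}"
  proof (rule inj_onI)
    fix x y assume xy: "x \<in> {..<r}" "y \<in> {..<r}" "prev x = prev y"
    hence "[x + (r - 1) = y + (r - 1)] (mod r)" by (simp add: prev_def cong_def)
    hence "[x = y] (mod r)" by (simp add: cong_add_rcancel_nat)
    thus "x = y" using xy by (simp add: cong_def)
  qed
  moreover have "prev ` {..<r} \<subseteq> {..<r}" using r by (auto simp: prev_def)
  ultimately show ?thesis using endo_inj_surj[of "{..<r}" prev] by (auto simp: bij_betw_def)
qed

sublocale token_system "int p" "{..<r}" prev "\<lambda>l k. p ^ pos l k"
proof
  show "2 \<le> int p" using p by simp
  show "bij_betw prev {..<r} {..<r}" by (rule bij_prev)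
  show "p ^ pos l j \<le> p ^ pos l k" if "l \<in> {..<r}" "j \<le> k" for l j k
    using that p by (intro power_increasing pos_mono) auto
  show "p ^ pos l k < p ^ pos l (k + nat (int p - 1))" if "l \<in> {..<r}" for l k
  proof -
    have "nat (int p - 1) = p - 1" by simp
    thus ?thesis using that p pos_jump[of l k] by simp
  qed
  show "l = l'" if "l \<in> {..<r}" "l' \<in> {..<r}" "p ^ pos l j = p ^ pos l' k" for l l' j k
  proof -
    have "pos l j = pos l' k" using that(3) p by simp
    thus ?thesis using pos_mod[of l j] pos_mod[of l' k] that by simp
  qed
  fix l T k
  assume l: "l \<in> {..<r}" and T: "finite T" "T \<subseteq> {..<r} \<times> UNIV" "\<And>i j. (i, j) \<in> T \<Longrightarrow> p ^ pos i j < p ^ pos l k"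
  have "T \<subseteq> Sigma {..<r} (\<lambda>i. {..<cum i (pos l k)})"
  proof
    fix t assume t: "t \<in> T"
    obtain i j where ij: "t = (i, j)" by force
    have "pos i j < pos l k" using T(3)[of i j] t ij p by simp
    thus "t \<in> Sigma {..<r} (\<lambda>i. {..<cum i (pos l k)})" using t ij T(2) pos_less_iff by auto
  qed
  hence "(\<Sum>(i, j)\<in>T. p ^ pos i j) \<le> (\<Sum>(i, j)\<in>Sigma {..<r} (\<lambda>i. {..<cum i (pos l k)}). p ^ pos i j)"
    by (intro sum_mono2) auto
  also have "\<dots> = (\<Sum>i<r. \<Sum>j<cum i (pos l k). p ^ pos i j)" by (subst sum.Sigma) auto
  also have "\<dots> = (\<Sum>s<pos l k. \<tau> s * p ^ s)" by (rule sum_cum)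
  also have "\<dots> < p ^ pos l k" using \<tau>_less by (rule digits_sum_less)
  finally show "(\<Sum>(i, j)\<in>T. p ^ pos i j) < p ^ pos l k" .
qed simp

end

section \<open>Chains of natural numbers and their charges\<close>

definition digit_chain :: "nat \<Rightarrow> nat \<Rightarrow> nat \<Rightarrow> (nat \<Rightarrow> nat) \<Rightarrow> bool" where
  "digit_chain p d e \<kappa> \<longleftrightarrow> \<kappa> 0 = 0 \<and> (\<forall>m<e. \<kappa> m < \<kappa> (Suc m) \<and>
    (\<forall>s. digit p (\<kappa> m) s \<le> digit p (\<kappa> (Suc m)) s) \<and> d dvd \<kappa> (Suc m) - \<kappa> m)"

lemma digit_chain_dvd: "digit_chain p d e \<kappa> \<Longrightarrow> m \<le> e \<Longrightarrow> d dvd \<kappa> m"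
proof (induction m)
  case (Suc m)
  hence "d dvd (\<kappa> (Suc m) - \<kappa> m) + \<kappa> m" by (intro dvd_add) (auto simp: digit_chain_def)
  moreover have "\<kappa> m < \<kappa> (Suc m)" using Suc.prems by (auto simp: digit_chain_def)
  ultimately show ?case by simp
qed (simp add: digit_chain_def)

lemma digit_chain_digit_le:
  assumes "digit_chain p d e \<kappa>" "m \<le> e"
  shows "digit p (\<kappa> m) s \<le> digit p (\<kappa> e) s"
  using assms(2)
proof (induction rule: inc_induct)
  case (step m)
  thus ?case using assms(1) by (auto simp: digit_chain_def intro: order_trans)
qed simp

lemma power_mod_class:
  fixes p r s :: nat
  assumes "2 \<le> p"
  shows "[p ^ s = p ^ (s mod r)] (mod (p ^ r - 1))"
proof -
  have "[p ^ r = 1] (mod (p ^ r - 1))" using cong_altdef_nat[of 1 "p ^ r" "p ^ r - 1"] assms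
    by (simp add: cong_sym_eq Suc_leI)
  hence "[(p ^ r) ^ (s div r) * p ^ (s mod r) = 1 ^ (s div r) * p ^ (s mod r)] (mod (p ^ r - 1))"
    by (intro cong_mult cong_pow cong_refl)
  moreover have "(p ^ r) ^ (s div r) * p ^ (s mod r) = p ^ s"
    by (simp flip: power_mult power_add)
  ultimately show ?thesis by simp
qed

context digit_universe
begin

abbreviation "q \<equiv> p ^ r"

definition class_count :: "nat \<Rightarrow> nat \<Rightarrow> nat" where
  "class_count l = digit_sum p (\<lambda>s. if s mod r = l then 1 else 0)"

text \<open>Digits are folded modulo r and rotated so that class l gets the highest exponent r - 1.
  Modulo q - 1 this amounts to multiplying K by p ^ (r - 1 - l).\<close>

definition weight :: "nat \<Rightarrow> nat \<Rightarrow> nat" where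
  "weight l = digit_sum p (\<lambda>s. p ^ ((s + (r - 1 - l)) mod r))"

definition charge :: "nat \<Rightarrow> nat \<Rightarrow> int" where
  "charge K l = int (weight l K div (q - 1))"

lemma q_pos: "1 < q"
  using p r by (intro one_less_power) simp_all

lemma prev_less: "prev l < r"
  using r by (simp add: prev_def)

lemma prev_0: "prev 0 = r - 1"
  using r by (simp add: prev_def)

lemma prev_pos:
  assumes "l < r" "l \<noteq> 0"
  shows "prev l = l - 1"
proof -
  have eq: "l + (r - 1) = (l - 1) + r" using assms by simp
  show ?thesis unfolding prev_def eq mod_add_self2 using assms by simp
qed

lemma mod_eq_last_iff:
  assumes "l < r"
  shows "(s + (r - 1 - l)) mod r = r - 1 \<longleftrightarrow> s mod r = l"
proof -
  have "(s + (r - 1 - l)) mod r = (s mod r + (r - 1 - l)) mod r" by (simp add: mod_add_left_eq)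
  moreover have m: "s mod r < r" using r by simp
  have "(s mod r + (r - 1 - l)) mod r = r - 1 \<longleftrightarrow> s mod r = l"
  proof (cases "s mod r \<le> l")
    case True
    hence "s mod r + (r - 1 - l) < r" using assms by simp
    thus ?thesis using True assms by auto
  next
    case False
    hence "s mod r + (r - 1 - l) = (s mod r - l - 1) + r" using assms by simp
    hence "(s mod r + (r - 1 - l)) mod r = s mod r - l - 1" using m by (metis mod_add_self2 mod_less less_imp_diff_less)
    thus ?thesis using False m by simp
  qed
  ultimately show ?thesis by simp
qed

lemma exponent_prev:
  assumes "l < r"
  shows "(s + (r - 1 - prev l)) mod r = Suc ((s + (r - 1 - l)) mod r) mod r"
proof (cases "l = 0")
  case True
  have "Suc (s + (r - 1)) = s + r" using r by simp
  thus ?thesis using True by (simp only: prev_0 mod_Suc_eq diff_self_eq_0 diff_zero) simp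
next
  case False
  have "Suc (s + (r - 1 - l)) = s + (r - 1 - (l - 1))" using assms False by simp
  thus ?thesis by (simp only: prev_pos[OF assms False] mod_Suc_eq)
qed

text \<open>Multiplication by p raises each exponent by 1. Only class l wraps around, from r to 0,
  and each of its tokens contributes the difference q - 1. Divided by q - 1 this is the formula for
  \<open>cnt\<close>.\<close>

lemma weight_prev:
  assumes l: "l < r"
  shows "p * weight l K = weight (prev l) K + (q - 1) * class_count l K"
proof -
  have *: "p * p ^ ((s + (r - 1 - l)) mod r)
      = p ^ ((s + (r - 1 - prev l)) mod r) + (q - 1) * (if s mod r = l then 1 else 0)" for s
  proof -
    define u where "u = (s + (r - 1 - l)) mod r"
    have "u < r" using r by (simp add: u_def)
    show ?thesis
    proof (cases "u = r - 1")
      case True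
      hence "s mod r = l" "Suc u = r" using mod_eq_last_iff[OF l, of s] r by (simp_all add: u_def)
      hence "(s + (r - 1 - prev l)) mod r = 0" "p * p ^ u = q"
        unfolding exponent_prev[OF l] u_def[symmetric] by (simp_all flip: power_Suc)
      thus ?thesis using \<open>s mod r = l\<close> q_pos by (simp add: u_def)
    next
      case False
      hence "s mod r \<noteq> l" "Suc u < r" using mod_eq_last_iff[OF l, of s] \<open>u < r\<close> by (auto simp: u_def)
      thus ?thesis unfolding exponent_prev[OF l] u_def[symmetric] by simp
    qed
  qed
  have "p * weight l K = (\<Sum>s<K. digit p K s * (p * p ^ ((s + (r - 1 - l)) mod r)))"
    by (simp add: weight_def digit_sum_def sum_distrib_left mult.left_commute)
  also have "\<dots> = weight (prev l) K + (q - 1) * class_count l K"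
    unfolding * by (simp add: weight_def class_count_def digit_sum_def sum_distrib_left distrib_left sum.distrib mult.left_commute)
  finally show ?thesis .
qed

lemma weight_cong: "[weight (r - 1) K = K] (mod (q - 1))"
proof -
  have "[digit_sum p (\<lambda>s. p ^ (s mod r)) K = digit_sum p (\<lambda>s. p ^ s) K] (mod (q - 1))"
    unfolding digit_sum_def by (intro cong_sum cong_mult[OF cong_refl] cong_sym[OF power_mod_class[OF p]])
  thus ?thesis using digit_sum_powers[OF p, of K] r by (simp add: weight_def)
qed

lemma weight_dvd:
  assumes "(q - 1) dvd K" "l < r"
  shows "(q - 1) dvd weight l K"
proof -
  have "(q - 1) dvd weight (r - 1 - i) K" if "i < r" for i
    using that
  proof (induction i)
    case 0
    thus ?case using weight_cong[of K] assms(1) by (simp add: cong_dvd_iff)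
  next
    case (Suc i)
    hence "prev (r - 1 - i) = r - 1 - Suc i" by (simp add: prev_pos)
    hence "p * weight (r - 1 - i) K = weight (r - 1 - Suc i) K + (q - 1) * class_count (r - 1 - i) K"
      using weight_prev[of "r - 1 - i" K] r by simp
    moreover have "(q - 1) dvd p * weight (r - 1 - i) K" using Suc by simp
    ultimately show ?case by (metis dvd_add_left_iff dvd_triv_left)
  qed
  from this[of "r - 1 - l"] show ?thesis using assms(2) by simp
qed

lemma cnt_charge:
  assumes "(q - 1) dvd K" "l < r"
  shows "cnt (charge K) l = int (class_count l K)"
proof -
  define c where "c l = weight l K div (q - 1)" for l
  have c: "weight l K = (q - 1) * c l" if "l < r" for l
    using weight_dvd[OF assms(1) that] by (simp add: c_def)
  have "(q - 1) * (p * c l) = (q - 1) * (c (prev l) + class_count l K)"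
    using weight_prev[OF assms(2), of K] c[OF assms(2)] c[OF prev_less[of l]]
    by (simp add: algebra_simps)
  hence "p * c l = c (prev l) + class_count l K" using q_pos by simp
  hence "int p * int (c l) = int (c (prev l)) + int (class_count l K)" by (metis of_nat_add of_nat_mult)
  thus ?thesis by (simp add: cnt_def charge_def c_def)
qed

text \<open>A strict increase between multiples of q - 1 is an increase by at least q - 1. Thus a
  chain of numbers satisfies the constraint of the relaxed problem.\<close>

lemma charge_less:
  assumes "(q - 1) dvd K" "(q - 1) dvd K'" "K < K'" "\<And>s. digit p K s \<le> digit p K' s" "l < r"
  shows "charge K l + 1 \<le> charge K' l"
proof -
  have "weight l K < weight l K'"
    unfolding weight_def using p by (intro digit_sum_strict_mono assms) simp_all
  moreover obtain a b where "weight l K = (q - 1) * a" "weight l K' = (q - 1) * b"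
    using weight_dvd assms by (metis dvdE)
  ultimately show ?thesis using q_pos by (simp add: charge_def)
qed

text \<open>Among the n l smallest tokens of each class l, those at position s; so this is a digit
  of the cheapest number with class counts n.\<close>

definition low :: "(nat \<Rightarrow> nat) \<Rightarrow> nat \<Rightarrow> nat" where
  "low n s = min (n (s mod r)) (cum (s mod r) (Suc s)) - min (n (s mod r)) (cum (s mod r) s)"

lemma low_le: "low n s \<le> \<tau> s"
  unfolding low_def cum_Suc by (auto simp: min_def)

lemma low_mono: "n (s mod r) \<le> n' (s mod r) \<Longrightarrow> low n s \<le> low n' s"
  unfolding low_def cum_Suc by (auto simp: min_def)

lemma sum_lowest_tokens:
  "(\<Sum>l<r. \<Sum>k<min (n l) (cum l N). p ^ pos l k) = (\<Sum>s<N. low n s * p ^ s)"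
proof (induction N)
  case 0
  thus ?case by (simp add: cum_def)
next
  case (Suc N)
  have "(\<Sum>k<min (n l) (cum l (Suc N)). p ^ pos l k)
      = (\<Sum>k<min (n l) (cum l N). p ^ pos l k) + (if l = N mod r then low n N * p ^ N else 0)" if "l < r" for l
  proof (cases "l = N mod r")
    case True
    have "min (n l) (cum l (Suc N)) = min (n l) (cum l N) + low n N" using True by (simp add: low_def cum_Suc)
    moreover have "pos l (min (n l) (cum l N) + i) = N" if "i < low n N" for i
    proof (rule pos_eq[OF \<open>l < r\<close>])
      have i: "i < min (n l) (cum l (Suc N)) - min (n l) (cum l N)" using that True by (simp add: low_def)
      show "cum l N \<le> min (n l) (cum l N) + i"
        using i by (cases "n l \<le> cum l N") (simp_all add: min_def)
      show "min (n l) (cum l N) + i < cum l (Suc N)" using i by linarith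
    qed
    ultimately show ?thesis using True by (simp add: sum_lessThan_add)
  qed (auto simp: cum_Suc)
  hence "(\<Sum>l<r. \<Sum>k<min (n l) (cum l (Suc N)). p ^ pos l k)
      = (\<Sum>l<r. (\<Sum>k<min (n l) (cum l N). p ^ pos l k) + (if l = N mod r then low n N * p ^ N else 0))"
    by (intro sum.cong) auto
  also have "\<dots> = (\<Sum>s<Suc N. low n s * p ^ s)" using Suc r by (simp add: sum.distrib)
  finally show ?case .
qed

lemma cum_bound: "\<exists>N. \<forall>l<r. n l \<le> cum l N"
proof -
  have "\<forall>l. \<exists>s. l < r \<longrightarrow> n l < cum l s" using cum_unbounded by blast
  then obtain f where f: "\<And>l. l < r \<Longrightarrow> n l < cum l (f l)" by metis
  have "n l \<le> cum l (\<Sum>i<r. f i)" if "l < r" for l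
    using f[OF that] cum_mono[of "f l" "\<Sum>i<r. f i" l] that member_le_sum[of l "{..<r}" f] by simp
  thus ?thesis by blast
qed

lemma digit_Phi: "digit p (Phi c) s = low (\<lambda>l. nat (cnt c l)) s"
proof -
  let ?n = "\<lambda>l. nat (cnt c l)"
  obtain N where N: "\<And>l. l < r \<Longrightarrow> ?n l \<le> cum l N" using cum_bound[of ?n] by blast
  have "Phi c = (\<Sum>l<r. \<Sum>k<min (?n l) (cum l N). p ^ pos l k)"
    unfolding Phi_classes using N by (intro sum.cong) (simp_all add: min_absorb1)
  also have "\<dots> = (\<Sum>s<N. low ?n s * p ^ s)" by (rule sum_lowest_tokens)
  finally have "Phi c = (\<Sum>s<N. low ?n s * p ^ s)" .
  moreover have "low ?n s = 0" if "N \<le> s" for s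
    using N[of "s mod r"] cum_mono[OF that, of "s mod r"] r by (simp add: low_def cum_Suc)
  moreover have "low ?n s < p" for s using low_le[of ?n s] \<tau>_less[of s] by simp
  ultimately show ?thesis by (simp add: digit_of_sum)
qed

text \<open>Modulo q - 1 a token of class l counts p ^ l, and the sum of p ^ l * (p * c l - c (prev
  l)) telescopes around the cycle to (q - 1) * c (r - 1).\<close>

lemma Phi_dvd:
  assumes "feas c"
  shows "(q - 1) dvd Phi c"
proof -
  obtain r' where r': "r = Suc r'" using r by (cases r) auto
  have "[Phi c = (\<Sum>l<r. \<Sum>k<nat (cnt c l). p ^ l)] (mod (q - 1))"
    unfolding Phi_classes
  proof (intro cong_sum)
    fix l k assume "l \<in> {..<r}"
    thus "[p ^ pos l k = p ^ l] (mod (q - 1))" using power_mod_class[OF p, of "pos l k" r] pos_mod[of l k] by simp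
  qed
  moreover have "int (\<Sum>l<r. \<Sum>k<nat (cnt c l). p ^ l) = (int q - 1) * c (r - 1)"
  proof -
    have "int (\<Sum>l<r. \<Sum>k<nat (cnt c l). p ^ l) = (\<Sum>l<r. int p ^ l * cnt c l)"
      using assms by (simp add: feas_def mult.commute)
    also have "\<dots> = (\<Sum>l<r. int p ^ Suc l * c l - int p ^ l * c (prev l))"
      by (intro sum.cong) (simp_all add: cnt_def algebra_simps)
    also have "\<dots> = (\<Sum>l<Suc (r - 1). int p ^ Suc l * c l) - (\<Sum>l<Suc (r - 1). int p ^ l * c (prev l))"
      using r by (simp add: sum_subtractf)
    also have "(\<Sum>l<Suc (r - 1). int p ^ l * c (prev l))
        = c (r - 1) + (\<Sum>l<r - 1. int p ^ Suc l * c l)"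
      unfolding sum.lessThan_Suc_shift using r by (simp add: prev_0 prev_pos)
    also have "(\<Sum>l<Suc (r - 1). int p ^ Suc l * c l)
        = (\<Sum>l<r - 1. int p ^ Suc l * c l) + int p ^ r * c (r - 1)"
      using r' by simp
    finally show ?thesis by (simp add: algebra_simps)
  qed
  hence "int (q - 1) dvd int (\<Sum>l<r. \<Sum>k<nat (cnt c l). p ^ l)" using q_pos by (simp add: of_nat_diff)
  ultimately show ?thesis by (simp only: of_nat_dvd_iff cong_dvd_iff)
qed

text \<open>K has at most \<tau> s tokens at each position, so its k-th smallest token of a class
  sits no lower than the k-th token of that class in the universe.\<close>

lemma Phi_le:
  assumes K: "\<And>s. digit p K s \<le> \<tau> s" "(q - 1) dvd K"
  shows "Phi (charge K) \<le> K"
proof -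
  define x where "x l N = (\<Sum>s<N. if s mod r = l then digit p K s else 0)" for l N
  have x_le: "x l N \<le> cum l N" for l N unfolding x_def cum_def by (rule sum_mono) (simp add: K)
  have step: "(\<Sum>k<x l N. p ^ pos l k) \<le> (\<Sum>s<N. if s mod r = l then digit p K s * p ^ s else 0)" if l: "l < r" for l N
  proof (induction N)
    case (Suc N)
    define d where "d = (if N mod r = l then digit p K N else 0)"
    have x_Suc: "x l (Suc N) = x l N + d" by (simp add: x_def d_def)
    have "p ^ pos l (x l N + i) \<le> p ^ N" if "i < d" for i
    proof -
      have "x l N + i < cum l (Suc N)" using that x_le[of l N] K(1)[of N] by (auto simp: d_def cum_Suc split: if_splits)
      thus ?thesis using pos_less_iff[OF l, of "x l N + i" "Suc N"] p by (intro power_increasing) auto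
    qed
    hence "(\<Sum>i<d. p ^ pos l (x l N + i)) \<le> (\<Sum>i<d. p ^ N)" by (intro sum_mono) simp
    also have "\<dots> = (if N mod r = l then digit p K N * p ^ N else 0)" by (simp add: d_def)
    finally show ?case unfolding x_Suc sum_lessThan_add using Suc by simp
  qed (simp add: x_def)
  have x_count: "x l K = class_count l K" for l
    unfolding x_def class_count_def digit_sum_def by (intro sum.cong) auto
  have "Phi (charge K) = (\<Sum>l<r. \<Sum>k<x l K. p ^ pos l k)"
    unfolding Phi_classes by (intro sum.cong) (simp_all add: cnt_charge[OF K(2)] x_count)
  also have "\<dots> \<le> (\<Sum>l<r. \<Sum>s<K. if s mod r = l then digit p K s * p ^ s else 0)"
    using step by (intro sum_mono) simp
  also have "\<dots> = (\<Sum>s<K. \<Sum>l<r. if s mod r = l then digit p K s * p ^ s else 0)"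
    by (rule sum.swap)
  also have "\<dots> = (\<Sum>s<K. digit p K s * p ^ s)" using r by (intro sum.cong) auto
  also have "\<dots> = K" using less_power_self[OF p, of K] by (simp add: sum_digits_mod)
  finally show ?thesis .
qed

text \<open>The relaxed bound is attained. A chain costs at least as much as its charges, hence at
  least as much as the optimum G, while the numbers \<open>Phi (G m)\<close> form a chain because
  the counts of G are nested. Equality forces the charges to be G and every member to be cheapest
  for its charge.\<close>

theorem unique_minimal_digit_chain:
  assumes "digit_chain p (q - 1) e \<kappa>\<^sub>0" "\<And>s. digit p (\<kappa>\<^sub>0 e) s \<le> \<tau> s"
  shows "\<exists>\<kappa>. digit_chain p (q - 1) e \<kappa> \<and> (\<forall>s. digit p (\<kappa> e) s \<le> \<tau> s) \<and>
    (\<forall>\<kappa>'. digit_chain p (q - 1) e \<kappa>' \<longrightarrow> (\<forall>s. digit p (\<kappa>' e) s \<le> \<tau> s) \<longrightarrow>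
      (\<Sum>m\<le>e. \<kappa> m) \<le> (\<Sum>m\<le>e. \<kappa>' m) \<and>
      ((\<Sum>m\<le>e. \<kappa>' m) = (\<Sum>m\<le>e. \<kappa> m) \<longrightarrow> (\<forall>m\<le>e. \<kappa>' m = \<kappa> m)))"
proof -
  have charges: "chain e (\<lambda>m. charge (\<kappa> m))" "charge (\<kappa> e) \<in> room e {}"
    and Phi_\<kappa>: "\<And>m. m \<le> e \<Longrightarrow> Phi (charge (\<kappa> m)) \<le> \<kappa> m"
    if \<kappa>: "digit_chain p (q - 1) e \<kappa>" "\<And>s. digit p (\<kappa> e) s \<le> \<tau> s" for \<kappa>
  proof -
    note dvd = digit_chain_dvd[OF \<kappa>(1)]
    have feas: "feas (charge (\<kappa> m))" if "m \<le> e" for m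
      using dvd[OF that] by (simp add: feas_def cnt_charge)
    show chain: "chain e (\<lambda>m. charge (\<kappa> m))"
      unfolding chain_def
    proof (intro conjI ballI allI impI)
      show "charge (\<kappa> 0) l = 0" for l
        using \<kappa>(1) by (simp add: digit_chain_def charge_def weight_def digit_sum_def)
      show "charge (\<kappa> m) l + 1 \<le> charge (\<kappa> (Suc m)) l" if "m < e" "l \<in> {..<r}" for m l
        using \<kappa>(1) that dvd[of m] dvd[of "Suc m"] by (intro charge_less) (auto simp: digit_chain_def)
    qed (rule feas)
    show "charge (\<kappa> e) \<in> room e {}"
      using feas[of e] chain_ge[OF chain, of e] by (simp add: room_def)
    show "Phi (charge (\<kappa> m)) \<le> \<kappa> m" if "m \<le> e" for m
      by (rule Phi_le) (use dvd[OF that] digit_chain_digit_le[OF \<kappa>(1) that] \<kappa>(2) in \<open>auto intro: order_trans\<close>)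
  qed
  have "room e {} \<noteq> {}" using charges(2)[OF assms] by blast
  then obtain G where G: "chain e G" "G e \<in> room e {}" "\<forall>m<e. \<forall>l\<in>{..<r}. cnt (G m) l \<le> cnt (G (Suc m)) l"
    and G_min: "\<And>C. chain e C \<Longrightarrow> C e \<in> room e {} \<Longrightarrow> cost e G \<le> cost e C \<and>
      (cost e C = cost e G \<longrightarrow> (\<forall>m\<le>e. \<forall>l\<in>{..<r}. C m l = G m l))"
    using unique_optimal_chain[of e "{}"] by blast
  define \<kappa> where "\<kappa> m = Phi (G m)" for m
  have "digit_chain p (q - 1) e \<kappa>"
    unfolding digit_chain_def
  proof (intro conjI allI impI)
    have "Phi (G 0) = Phi (\<lambda>_. 0)" using G(1) by (intro Phi_cong) (simp add: chain_def)
    thus "\<kappa> 0 = 0" by (simp add: \<kappa>_def Phi_classes cnt_def)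
    fix m assume m: "m < e"
    have feas: "feas (G m)" "feas (G (Suc m))" using G(1) m by (simp_all add: chain_def)
    show le: "digit p (\<kappa> m) s \<le> digit p (\<kappa> (Suc m)) s" for s
      unfolding \<kappa>_def digit_Phi using G(3) m r by (intro low_mono) (auto intro: nat_mono)
    have "\<kappa> m \<le> \<kappa> (Suc m)" using p le by (rule le_if_digits_le)
    moreover have "\<kappa> m \<noteq> \<kappa> (Suc m)"
    proof
      assume "\<kappa> m = \<kappa> (Suc m)"
      hence "G m 0 = G (Suc m) 0" using feas r by (intro Phi_inj) (auto simp: \<kappa>_def)
      moreover have "G m 0 + 1 \<le> G (Suc m) 0" using G(1) m r by (simp add: chain_def)
      ultimately show False by simp
    qed
    ultimately show "\<kappa> m < \<kappa> (Suc m)" by simp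
    show "(q - 1) dvd \<kappa> (Suc m) - \<kappa> m" unfolding \<kappa>_def by (intro dvd_diff_nat Phi_dvd feas)
  qed
  moreover have "digit p (\<kappa> e) s \<le> \<tau> s" for s unfolding \<kappa>_def digit_Phi by (rule low_le)
  moreover have "(\<Sum>m\<le>e. \<kappa> m) \<le> (\<Sum>m\<le>e. \<kappa>' m) \<and>
      ((\<Sum>m\<le>e. \<kappa>' m) = (\<Sum>m\<le>e. \<kappa> m) \<longrightarrow> (\<forall>m\<le>e. \<kappa>' m = \<kappa> m))"
    if \<kappa>': "digit_chain p (q - 1) e \<kappa>'" "\<And>s. digit p (\<kappa>' e) s \<le> \<tau> s" for \<kappa>'
  proof -
    let ?C = "\<lambda>m. charge (\<kappa>' m)"
    have le: "Phi (?C m) \<le> \<kappa>' m" if "m \<le> e" for m using Phi_\<kappa>[OF \<kappa>' that] .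
    note min = G_min[OF charges[OF \<kappa>']]
    have \<kappa>_cost: "(\<Sum>m\<le>e. \<kappa> m) = cost e G" by (simp add: \<kappa>_def cost_def)
    have C_cost: "cost e ?C \<le> (\<Sum>m\<le>e. \<kappa>' m)" unfolding cost_def using le by (intro sum_mono) simp
    have "\<kappa>' m = \<kappa> m" if eq: "(\<Sum>m\<le>e. \<kappa>' m) = (\<Sum>m\<le>e. \<kappa> m)" and m: "m \<le> e" for m
    proof -
      have "cost e ?C = cost e G" using eq min C_cost \<kappa>_cost by simp
      hence same: "?C m l = G m l" if "l < r" for l using min m that by simp
      have "(\<Sum>m\<le>e. Phi (?C m)) = (\<Sum>m\<le>e. \<kappa>' m)"
        using \<open>cost e ?C = cost e G\<close> eq \<kappa>_cost by (simp add: cost_def)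
      hence "Phi (?C m) = \<kappa>' m"
        using sum_mono_inv[of "\<lambda>m. Phi (?C m)" "{..e}" \<kappa>' m] le m by simp
      moreover have "Phi (?C m) = Phi (G m)" using same by (intro Phi_cong) simp
      ultimately show ?thesis by (simp add: \<kappa>_def)
    qed
    thus ?thesis using min C_cost \<kappa>_cost by simp
  qed
  ultimately show ?thesis by blast
qed

end

section \<open>Power sums over a finite field\<close>

lemma card_finite_field_gt_1: "1 < CARD('a :: finite_field)"
proof -
  have "card {0, 1 :: 'a} \<le> CARD('a)" by (intro card_mono) auto
  thus ?thesis by simp
qed

text \<open>If CARD is \<open>q = p^k m\<close> with p not dividing m, then \<open>x \<mapsto> x^m\<close> is the inverse of the k-th power of
  the Frobenius map, hence additive; so \<open>(Y + 1)^m - Y^m - 1\<close> has too many roots unless \<open>m = 1\<close>.\<close>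

lemma card_finite_field_CHAR_power:
  obtains r where "1 \<le> r" "CARD('a :: finite_field) = CHAR('a) ^ r"
proof -
  define p where "p = CHAR('a)"
  have p: "prime p" by (simp add: p_def)
  have "CARD('a) \<noteq> 0" by simp
  moreover have "\<not> is_unit p" using p by auto
  ultimately obtain m where m: "CARD('a) = p ^ multiplicity p CARD('a) * m" "\<not> p dvd m"
    using multiplicity_decompose' by blast
  define k where "k = multiplicity p CARD('a)"
  have m_pos: "0 < m" using m(2) by (cases m) auto
  have add: "(x + y :: 'a) ^ (p ^ k) = x ^ (p ^ k) + y ^ (p ^ k)" for x y
    unfolding p_def by (rule freshmans_dream') simp_all
  have "inj (\<lambda>x :: 'a. x ^ (p ^ k))"
  proof (rule injI)
    fix x y :: 'a assume "x ^ (p ^ k) = y ^ (p ^ k)"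
    moreover have "x ^ (p ^ k) = (x - y) ^ (p ^ k) + y ^ (p ^ k)" using add[of "x - y" y] by simp
    ultimately show "x = y" by simp
  qed
  hence surj: "\<exists>x. y = x ^ (p ^ k)" for y :: 'a
    by (metis finite_UNIV_inj_surj finite surjD)
  have additive: "(y + 1 :: 'a) ^ m = y ^ m + 1" for y
  proof -
    obtain x where x: "y = x ^ (p ^ k)" using surj by blast
    have card_power: "(z ^ (p ^ k)) ^ m = z" for z :: 'a
      using finite_field_power_card_eq_same[of z] m(1) by (simp flip: power_mult k_def)
    have "y + 1 = (x + 1) ^ (p ^ k)" using add[of x 1] x by simp
    thus ?thesis using x card_power by simp
  qed
  define P :: "'a poly" where "P = [:1, 1:] ^ m - monom 1 m - 1"
  have coeff_P: "coeff P i = of_nat (m choose i) - (if i = m then 1 else 0) - (if i = 0 then 1 else 0)" for i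
    by (cases "i \<le> m")
      (auto simp: P_def coeff_linear_poly_power binomial_eq_0 coeff_eq_0 degree_power_eq)
  have "m = 1"
  proof (rule ccontr)
    assume "m \<noteq> 1"
    hence "2 \<le> m" using m_pos by simp
    have "P = 0"
    proof (rule ccontr)
      assume "P \<noteq> 0"
      have "poly P y = 0" for y using additive[of y] by (simp add: P_def poly_monom poly_power add.commute)
      hence "{x. poly P x = 0} = UNIV" by auto
      hence "CARD('a) \<le> degree P" using card_poly_roots_bound[OF \<open>P \<noteq> 0\<close>] by simp
      moreover have "degree P \<le> m - 1"
      proof (rule degree_le, intro allI impI)
        fix i assume "m - 1 < i"
        hence "i = m \<or> m < i" "i \<noteq> 0" by auto
        thus "coeff P i = 0" using \<open>2 \<le> m\<close> by (auto simp: coeff_P binomial_eq_0)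
      qed
      moreover have "m \<le> CARD('a)" using m(1) p prime_gt_0_nat by (metis dvd_imp_le dvd_triv_right zero_less_card_finite)
      ultimately show False using m_pos by linarith
    qed
    hence "coeff P (m - 1) = 0" by simp
    moreover have "m choose (m - 1) = m" using m_pos binomial_symmetric[of 1 m] by simp
    ultimately have "of_nat m = (0 :: 'a)" using \<open>2 \<le> m\<close> by (auto simp: coeff_P)
    thus False using m(2) by (simp add: of_nat_eq_0_iff_char_dvd p_def)
  qed
  hence card: "CARD('a) = CHAR('a) ^ k" using m(1) by (simp add: k_def p_def)
  moreover have "k \<noteq> 0" using card card_finite_field_gt_1[where 'a = 'a] by (cases k) auto
  ultimately show thesis using that[of k] by simp
qed

lemma of_nat_card_finite_field: "of_nat CARD('a :: finite_field) = (0 :: 'a)"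
proof -
  have "(\<Sum>a\<in>UNIV. a + 1 :: 'a) = (\<Sum>a\<in>UNIV. a)"
    by (rule sum.reindex_bij_witness[of _ "\<lambda>a. a - 1" "\<lambda>a. a + 1"]) auto
  thus ?thesis by (simp add: sum.distrib)
qed

lemma power_card_minus_1:
  assumes "a \<noteq> (0 :: 'a :: finite_field)"
  shows "a ^ (CARD('a) - 1) = 1"
proof -
  have "CARD('a) = Suc (CARD('a) - 1)" using card_finite_field_gt_1[where 'a = 'a] by simp
  hence "a * a ^ (CARD('a) - 1) = a * 1"
    using finite_field_power_card_eq_same[of a] by (metis mult.right_neutral power_Suc)
  thus ?thesis using assms by simp
qed

text \<open>If b ^ i differs from 1 for some nonzero b, the substitution of b a for a shows that the
  sum vanishes. Otherwise q - 1 divides i, since X ^ j - 1 with j the remainder would have more than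
  j roots. For i = 0 the sum is q = 0, because 0 ^ 0 = 1.\<close>

lemma sum_powers_finite_field:
  "(\<Sum>a\<in>UNIV. (a :: 'a :: finite_field) ^ i) = (if 0 < i \<and> (CARD('a) - 1) dvd i then - 1 else 0)"
proof (cases "0 < i \<and> (\<forall>a::'a. a \<noteq> 0 \<longrightarrow> a ^ i = 1)")
  case True
  have "(CARD('a) - 1) dvd i"
  proof -
    define j where "j = i mod (CARD('a) - 1)"
    have q: "0 < CARD('a) - 1" using card_finite_field_gt_1[where 'a = 'a] by simp
    have "a ^ j = 1" if "a \<noteq> 0" for a :: 'a
    proof -
      have "a ^ i = (a ^ (CARD('a) - 1)) ^ (i div (CARD('a) - 1)) * a ^ j"
        unfolding j_def power_mult[symmetric] power_add[symmetric] by simp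
      thus ?thesis using True that power_card_minus_1[OF that] by simp
    qed
    hence sub: "UNIV - {0} \<subseteq> {a :: 'a. poly (monom 1 j - 1) a = 0}" by (auto simp: poly_monom)
    have "j = 0"
    proof (rule ccontr)
      assume "j \<noteq> 0"
      hence "coeff (monom 1 j - 1 :: 'a poly) j = 1" by simp
      hence ne: "monom 1 j - 1 \<noteq> (0 :: 'a poly)" by (metis coeff_0 zero_neq_one)
      have "card (UNIV - {0 :: 'a}) \<le> card {a :: 'a. poly (monom 1 j - 1) a = 0}"
        by (rule card_mono[OF _ sub]) simp
      also have "\<dots> \<le> degree (monom 1 j - 1 :: 'a poly)" by (rule card_poly_roots_bound[OF ne])
      also have "\<dots> \<le> j" by (rule degree_le) (auto simp: coeff_eq_0)
      also have "j < CARD('a) - 1" using q by (simp add: j_def)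
      finally show False by (simp add: card_Diff_singleton)
    qed
    thus ?thesis by (simp add: j_def mod_eq_0_iff_dvd)
  qed
  moreover have "(\<Sum>a\<in>UNIV. (a :: 'a) ^ i) = - 1"
  proof -
    have "(\<Sum>a\<in>UNIV. (a :: 'a) ^ i) = (\<Sum>a\<in>UNIV - {0}. (a :: 'a) ^ i)"
      using True by (intro sum.mono_neutral_right) auto
    also have "\<dots> = (\<Sum>a\<in>UNIV - {0 :: 'a}. 1)" using True by (intro sum.cong) auto
    also have "\<dots> = of_nat (CARD('a) - 1)" by (simp add: card_Diff_singleton)
    also have "\<dots> = of_nat CARD('a) - (1 :: 'a)" using card_finite_field_gt_1[where 'a = 'a] by (simp add: of_nat_diff)
    also have "\<dots> = - 1" by (simp add: of_nat_card_finite_field)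
    finally show ?thesis by simp
  qed
  ultimately show ?thesis using True by simp
next
  case False
  have "(\<Sum>a\<in>UNIV. (a :: 'a) ^ i) = 0"
  proof (cases "i = 0")
    case True
    thus ?thesis by (simp add: of_nat_card_finite_field)
  next
    case nz: False
    then obtain b :: 'a where b: "b \<noteq> 0" "b ^ i \<noteq> 1" using False by auto
    have "(\<Sum>a\<in>UNIV. a ^ i) = (\<Sum>a\<in>UNIV. (b * a) ^ i)"
      by (rule sum.reindex_bij_witness[of _ "\<lambda>a. b * a" "\<lambda>a. a / b"]) (use b in auto)
    also have "\<dots> = b ^ i * (\<Sum>a\<in>UNIV. a ^ i)" by (simp add: power_mult_distrib flip: sum_distrib_left)
    finally have "(1 - b ^ i) * (\<Sum>a\<in>UNIV. a ^ i) = 0" by (simp add: left_diff_distrib)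
    thus ?thesis using b by simp
  qed
  moreover have "\<not> (0 < i \<and> (CARD('a) - 1) dvd i)"
  proof
    assume i: "0 < i \<and> (CARD('a) - 1) dvd i"
    have "a ^ i = 1" if "a \<noteq> 0" for a :: 'a
      using i power_card_minus_1[OF that] by (auto simp: power_mult elim!: dvdE)
    thus False using False i by blast
  qed
  ultimately show ?thesis by simp
qed

section \<open>Lucas' theorem\<close>

text \<open>In Vandermonde's identity for p + N only the binomials p choose 0 and p choose p survive
  in characteristic p; the two terms reproduce Pascal's rule for n choose k.\<close>

lemma binomial_mod_char_step:
  assumes "a < CHAR('a :: finite_field)" "b < CHAR('a)"
  shows "of_nat ((CHAR('a) * n + a) choose (CHAR('a) * k + b))
    = (of_nat (n choose k) * of_nat (a choose b) :: 'a)"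
proof (induction n arbitrary: k)
  case 0
  thus ?case using assms by (cases k) (simp_all add: binomial_eq_0)
next
  case (Suc n)
  note IH = Suc.IH
  let ?p = "CHAR('a)" and ?N = "CHAR('a) * n + a" and ?K = "CHAR('a) * k + b"
  have p: "prime ?p" by simp
  have zero: "of_nat (?p choose i) = (0 :: 'a)" if "0 < i" "i < ?p" for i
    using that p dvd_choose_prime[of i ?p] by (simp add: of_nat_eq_0_iff_char_dvd)
  have "(?p * Suc n + a) choose ?K = (?p + ?N) choose ?K" by (simp add: algebra_simps)
  also have "\<dots> = (\<Sum>i\<le>?K. (?p choose i) * (?N choose (?K - i)))" by (rule vandermonde[symmetric])
  finally have "of_nat ((?p * Suc n + a) choose ?K)
      = (\<Sum>i\<le>?K. of_nat (?p choose i) * of_nat (?N choose (?K - i)) :: 'a)" by simp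
  also have "\<dots> = (\<Sum>i\<in>{0, ?p} \<inter> {..?K}. of_nat (?p choose i) * of_nat (?N choose (?K - i)))"
  proof (rule sum.mono_neutral_right)
    show "\<forall>i\<in>{..?K} - {0, ?p} \<inter> {..?K}. of_nat (?p choose i) * of_nat (?N choose (?K - i)) = (0 :: 'a)"
    proof
      fix i assume "i \<in> {..?K} - {0, ?p} \<inter> {..?K}"
      hence "0 < i" "i < ?p \<or> ?p < i" by auto
      thus "of_nat (?p choose i) * of_nat (?N choose (?K - i)) = (0 :: 'a)" using zero by (auto simp: binomial_eq_0)
    qed
  qed auto
  also have "\<dots> = of_nat (Suc n choose k) * of_nat (a choose b)"
  proof (cases k)
    case 0
    hence eq: "{0, ?p} \<inter> {..?K} = {0}" using assms by auto
    show ?thesis unfolding eq using IH[of 0] 0 by simp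
  next
    case (Suc k')
    hence eq: "{0, ?p} \<inter> {..?K} = {0, ?p}" by auto
    have "?K - ?p = ?p * k' + b" using Suc by simp
    hence "(\<Sum>i\<in>{0, ?p} \<inter> {..?K}. of_nat (?p choose i) * of_nat (?N choose (?K - i)))
        = of_nat (?N choose ?K) + (of_nat (?N choose (?p * k' + b)) :: 'a)"
      unfolding eq by simp
    also have "\<dots> = of_nat (Suc n choose k) * of_nat (a choose b)"
      unfolding IH using Suc by (simp add: algebra_simps)
    finally show ?thesis .
  qed
  finally show ?case .
qed

lemma digit_Suc: "digit p K (Suc s) = digit p (K div p) s"
  by (simp add: digit_def div_mult2_eq)

lemma binomial_neq_0_iff_digits:
  "of_nat (n choose k) \<noteq> (0 :: 'a :: finite_field) \<longleftrightarrow> (\<forall>s. digit CHAR('a) k s \<le> digit CHAR('a) n s)"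
proof (induction k arbitrary: n rule: less_induct)
  case (less k)
  let ?p = "CHAR('a)"
  have p: "prime ?p" "2 \<le> ?p" using prime_ge_2_nat[of ?p] by simp_all
  have small: "of_nat (a choose b) \<noteq> (0 :: 'a) \<longleftrightarrow> b \<le> a" if "a < ?p" for a b
  proof
    assume "b \<le> a"
    have "(a choose b) dvd fact a" using binomial_fact_lemma[OF \<open>b \<le> a\<close>] by (metis dvd_triv_right)
    moreover have "\<not> ?p dvd fact a" using prime_dvd_fact_iff[OF p(1)] that by simp
    ultimately show "of_nat (a choose b) \<noteq> (0 :: 'a)"
      by (metis of_nat_eq_0_iff_char_dvd dvd_trans)
  qed (metis binomial_eq_0 not_le of_nat_0)
  have all_digits: "(\<forall>s. digit ?p k s \<le> digit ?p n s) \<longleftrightarrow>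
      k mod ?p \<le> n mod ?p \<and> (\<forall>s. digit ?p (k div ?p) s \<le> digit ?p (n div ?p) s)"
  proof -
    have "(\<forall>s. P s) \<longleftrightarrow> P 0 \<and> (\<forall>s. P (Suc s))" for P by (metis not0_implies_Suc)
    from this[of "\<lambda>s. digit ?p k s \<le> digit ?p n s"] show ?thesis
      unfolding digit_Suc by (simp add: digit_def)
  qed
  show ?case
  proof (cases "k = 0")
    case True
    thus ?thesis by (simp add: digit_def)
  next
    case False
    hence "k div ?p < k" using p by simp
    have "of_nat (n choose k) = (of_nat (n div ?p choose (k div ?p)) * of_nat (n mod ?p choose (k mod ?p)) :: 'a)"
      using binomial_mod_char_step[where 'a = 'a, of "n mod ?p" "k mod ?p" "n div ?p" "k div ?p"] p by simp
    thus ?thesis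
      unfolding all_digits using less[OF \<open>k div ?p < k\<close>, of "n div ?p"] small[of "n mod ?p" "k mod ?p"] p by auto
  qed
qed

section \<open>Power sums of polynomials\<close>

lemma digit_chain_extend:
  assumes "digit_chain p d m \<kappa>" "\<kappa> m < K" "d dvd K - \<kappa> m" "\<And>s. digit p (\<kappa> m) s \<le> digit p K s"
  shows "digit_chain p d (Suc m) (\<kappa>(Suc m := K))"
  unfolding digit_chain_def
proof (intro conjI allI impI)
  show "(\<kappa>(Suc m := K)) 0 = 0" using assms(1) by (simp add: digit_chain_def)
  fix i assume "i < Suc m"
  hence "i < m \<or> i = m" by auto
  thus "(\<kappa>(Suc m := K)) i < (\<kappa>(Suc m := K)) (Suc i)"
    "digit p ((\<kappa>(Suc m := K)) i) s \<le> digit p ((\<kappa>(Suc m := K)) (Suc i)) s"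
    "d dvd (\<kappa>(Suc m := K)) (Suc i) - (\<kappa>(Suc m := K)) i" for s
    using assms by (auto simp: digit_chain_def)
qed

definition low_polys :: "nat \<Rightarrow> 'a :: finite_field poly set" where
  "low_polys m = {g. \<forall>i\<ge>m. coeff g i = 0}"

definition low_power_sum :: "nat \<Rightarrow> nat \<Rightarrow> 'a :: finite_field poly" where
  "low_power_sum m K = (\<Sum>g\<in>low_polys m. g ^ K)"

lemma low_polys_0: "low_polys 0 = {0}"
  by (auto simp: low_polys_def poly_eq_iff)

lemma low_polys_Suc: "low_polys (Suc m) = (\<lambda>(a, g). pCons a g) ` (UNIV \<times> low_polys m)"
proof -
  have "g \<in> (\<lambda>(a, g). pCons a g) ` (UNIV \<times> low_polys m)" if "g \<in> low_polys (Suc m)" for g :: "'a poly"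
  proof (cases g rule: pCons_cases)
    case (pCons a h)
    have "coeff h i = 0" if "m \<le> i" for i
      using \<open>g \<in> low_polys (Suc m)\<close> that by (auto simp: low_polys_def pCons dest!: spec[of _ "Suc i"])
    thus ?thesis using pCons by (auto simp: low_polys_def)
  qed
  moreover have "pCons a g \<in> low_polys (Suc m)" if "g \<in> low_polys m" for a and g :: "'a poly"
    using that by (auto simp: low_polys_def coeff_pCons split: nat.splits)
  ultimately show ?thesis by auto
qed

lemma inj_pCons: "inj_on (\<lambda>(a, g). pCons a g) X"
  by (auto simp: inj_on_def)

lemma coeff_pCons_power:
  fixes g :: "'a :: finite_field poly"
  shows "coeff (pCons a g ^ K) w
    = (\<Sum>j\<le>K. of_nat (K choose j) * a ^ (K - j) * (if j \<le> w then coeff (g ^ j) (w - j) else 0))"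
proof -
  have "pCons a g = monom 1 1 * g + [:a:]"
    by (simp add: monom_Suc monom_0 one_pCons[symmetric])
  hence "pCons a g ^ K = (\<Sum>j\<le>K. of_nat (K choose j) * (monom 1 1 * g) ^ j * [:a:] ^ (K - j))"
    by (simp add: binomial_ring)
  also have "\<dots> = (\<Sum>j\<le>K. smult (of_nat (K choose j) * a ^ (K - j)) (monom 1 j * g ^ j))"
  proof (rule sum.cong)
    fix j
    have "of_nat (K choose j) * (monom 1 1 * g) ^ j * [:a:] ^ (K - j)
        = [:of_nat (K choose j):] * (monom 1 j * g ^ j) * [:a ^ (K - j):]"
      by (simp add: of_nat_poly power_mult_distrib monom_power poly_const_pow)
    thus "of_nat (K choose j) * (monom 1 1 * g) ^ j * [:a:] ^ (K - j)
        = smult (of_nat (K choose j) * a ^ (K - j)) (monom 1 j * g ^ j)"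
      by (simp add: mult.commute)
  qed simp
  finally show ?thesis by (auto simp: coeff_sum coeff_monom_mult intro!: sum.cong)
qed

text \<open>Writing a polynomial as a + X g and summing over a keeps only the j for which K - j is a
  positive multiple of q - 1. The term j = K drops out because the sum of a ^ 0 is 0.\<close>

lemma coeff_low_power_sum_Suc:
  "coeff (low_power_sum (Suc m) K :: 'a :: finite_field poly) w
    = - (\<Sum>j | j < K \<and> j \<le> w \<and> (CARD('a) - 1) dvd K - j. of_nat (K choose j) * coeff (low_power_sum m j) (w - j))"
proof -
  have "coeff (low_power_sum (Suc m) K :: 'a poly) w
      = (\<Sum>(a, g)\<in>UNIV \<times> low_polys m. coeff (pCons a g ^ K) w)"
    unfolding low_power_sum_def low_polys_Suc sum.reindex[OF inj_pCons]
    by (simp add: coeff_sum case_prod_unfold)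
  also have "\<dots> = (\<Sum>a\<in>UNIV. \<Sum>g\<in>low_polys m. \<Sum>j\<le>K.
      of_nat (K choose j) * a ^ (K - j) * (if j \<le> w then coeff (g ^ j) (w - j) else 0))"
    unfolding sum.cartesian_product[symmetric] coeff_pCons_power ..
  also have "\<dots> = (\<Sum>a\<in>UNIV. \<Sum>j\<le>K. \<Sum>g\<in>low_polys m.
      of_nat (K choose j) * a ^ (K - j) * (if j \<le> w then coeff (g ^ j) (w - j) else 0))"
    by (intro sum.cong refl sum.swap)
  also have "\<dots> = (\<Sum>a\<in>UNIV. \<Sum>j\<le>K.
      of_nat (K choose j) * a ^ (K - j) * (if j \<le> w then coeff (low_power_sum m j) (w - j) else 0))"
    by (intro sum.cong refl) (simp add: low_power_sum_def coeff_sum flip: sum_distrib_left)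
  also have "\<dots> = (\<Sum>j\<le>K. \<Sum>a\<in>UNIV.
      of_nat (K choose j) * a ^ (K - j) * (if j \<le> w then coeff (low_power_sum m j) (w - j) else 0))"
    by (rule sum.swap)
  also have "\<dots> = (\<Sum>j\<le>K. of_nat (K choose j) * (\<Sum>a\<in>UNIV. (a :: 'a) ^ (K - j)) *
      (if j \<le> w then coeff (low_power_sum m j) (w - j) else 0))"
    by (simp add: sum_distrib_left sum_distrib_right)
  also have "\<dots> = (\<Sum>j | j < K \<and> j \<le> w \<and> (CARD('a) - 1) dvd K - j.
      - (of_nat (K choose j) * coeff (low_power_sum m j) (w - j)))"
    by (rule sum.mono_neutral_cong_right) (auto simp: sum_powers_finite_field)
  finally show ?thesis by (simp add: sum_negf)
qed

text \<open>A nonzero term of the recursion adds one member: its binomial gives digit inclusion by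
  Lucas, and the factor X ^ j adds j to the degree. The top K is therefore not counted in w.\<close>

lemma coeff_low_power_sum_nonzeroD:
  assumes "coeff (low_power_sum m K :: 'a :: finite_field poly) w \<noteq> 0"
  shows "\<exists>\<kappa>. digit_chain CHAR('a) (CARD('a) - 1) m \<kappa> \<and> \<kappa> m = K \<and> (\<Sum>i<m. \<kappa> i) = w"
  using assms
proof (induction m arbitrary: K w)
  case 0
  hence "K = 0" by (cases "K = 0") (auto simp: low_power_sum_def low_polys_0 power_0_left)
  moreover from this 0 have "w = 0" by (cases "w = 0") (auto simp: low_power_sum_def low_polys_0)
  ultimately show ?case by (intro exI[of _ "\<lambda>_. 0"]) (simp add: digit_chain_def)
next
  case (Suc m)
  hence "(\<Sum>j | j < K \<and> j \<le> w \<and> (CARD('a) - 1) dvd K - j.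
      of_nat (K choose j) * coeff (low_power_sum m j) (w - j)) \<noteq> (0 :: 'a)"
    unfolding coeff_low_power_sum_Suc by simp
  then obtain j where "j \<in> {j. j < K \<and> j \<le> w \<and> (CARD('a) - 1) dvd K - j}"
    and nz: "of_nat (K choose j) * coeff (low_power_sum m j) (w - j) \<noteq> (0 :: 'a)"
    by (rule sum.not_neutral_contains_not_neutral)
  hence j: "j < K" "j \<le> w" "(CARD('a) - 1) dvd K - j" by simp_all
  have binomial: "of_nat (K choose j) \<noteq> (0 :: 'a)" and nz': "coeff (low_power_sum m j :: 'a poly) (w - j) \<noteq> 0"
    using nz by auto
  obtain \<kappa> where \<kappa>: "digit_chain CHAR('a) (CARD('a) - 1) m \<kappa>" "\<kappa> m = j" "(\<Sum>i<m. \<kappa> i) = w - j"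
    using Suc.IH[OF nz'] by blast
  have digits: "digit CHAR('a) j s \<le> digit CHAR('a) K s" for s
    using binomial by (simp add: binomial_neq_0_iff_digits)
  have "digit_chain CHAR('a) (CARD('a) - 1) (Suc m) (\<kappa>(Suc m := K))"
    by (rule digit_chain_extend) (use \<kappa> digits j in simp_all)
  moreover have "(\<Sum>i<Suc m. (\<kappa>(Suc m := K)) i) = w" using \<kappa> j by simp
  moreover have "(\<kappa>(Suc m := K)) (Suc m) = K" by simp
  ultimately show ?case by blast
qed

text \<open>A second nonzero term of the recursion would extend to another chain with the same top
  and the same degree. Uniqueness leaves a single term, nonzero by induction.\<close>

lemma coeff_low_power_sum_nonzeroI:
  assumes "digit_chain CHAR('a) (CARD('a) - 1) m \<kappa>"
    and "\<And>\<kappa>'. digit_chain CHAR('a) (CARD('a) - 1) m \<kappa>' \<Longrightarrow> \<kappa>' m = \<kappa> m \<Longrightarrow>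
      (\<Sum>i<m. \<kappa>' i) = (\<Sum>i<m. \<kappa> i) \<Longrightarrow> \<forall>i\<le>m. \<kappa>' i = \<kappa> i"
  shows "coeff (low_power_sum m (\<kappa> m) :: 'a :: finite_field poly) (\<Sum>i<m. \<kappa> i) \<noteq> 0"
  using assms
proof (induction m)
  case 0
  have "\<kappa> 0 = 0" using 0(1) by (simp add: digit_chain_def)
  thus ?case by (simp add: low_power_sum_def low_polys_0)
next
  case (Suc m)
  let ?K = "\<kappa> (Suc m)" and ?w = "\<Sum>i<Suc m. \<kappa> i"
  let ?J = "{j. j < ?K \<and> j \<le> ?w \<and> (CARD('a) - 1) dvd ?K - j}"
  let ?f = "\<lambda>j. of_nat (?K choose j) * coeff (low_power_sum m j :: 'a poly) (?w - j)"
  have chain: "digit_chain CHAR('a) (CARD('a) - 1) m \<kappa>" using Suc.prems(1) by (simp add: digit_chain_def)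
  have step: "\<kappa> m < ?K" "\<And>s. digit CHAR('a) (\<kappa> m) s \<le> digit CHAR('a) ?K s" "(CARD('a) - 1) dvd ?K - \<kappa> m"
    using Suc.prems(1) by (simp_all add: digit_chain_def)
  have extend: "\<forall>i\<le>m. \<kappa>' i = \<kappa> i"
    if \<kappa>': "digit_chain CHAR('a) (CARD('a) - 1) m \<kappa>'" "\<kappa>' m < ?K" "(CARD('a) - 1) dvd ?K - \<kappa>' m"
      "\<And>s. digit CHAR('a) (\<kappa>' m) s \<le> digit CHAR('a) ?K s" "(\<Sum>i<m. \<kappa>' i) + \<kappa>' m = ?w" for \<kappa>'
  proof -
    have "digit_chain CHAR('a) (CARD('a) - 1) (Suc m) (\<kappa>'(Suc m := ?K))"
      by (rule digit_chain_extend) (use \<kappa>' in simp_all)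
    from Suc.prems(2)[OF this] \<kappa>'(5) have eq: "\<forall>i\<le>Suc m. (\<kappa>'(Suc m := ?K)) i = \<kappa> i" by simp
    show ?thesis
    proof (intro allI impI)
      fix i assume "i \<le> m"
      thus "\<kappa>' i = \<kappa> i" using eq[rule_format, of i] by simp
    qed
  qed
  have zero: "?f j = 0" if j: "j \<in> ?J - {\<kappa> m}" for j
  proof (rule ccontr)
    assume "?f j \<noteq> 0"
    hence binomial: "of_nat (?K choose j) \<noteq> (0 :: 'a)"
      and nz: "coeff (low_power_sum m j :: 'a poly) (?w - j) \<noteq> 0" by auto
    obtain \<kappa>' where \<kappa>': "digit_chain CHAR('a) (CARD('a) - 1) m \<kappa>'" "\<kappa>' m = j" "(\<Sum>i<m. \<kappa>' i) = ?w - j"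
      using coeff_low_power_sum_nonzeroD[OF nz] by blast
    have "digit CHAR('a) j s \<le> digit CHAR('a) ?K s" for s
      using binomial by (simp add: binomial_neq_0_iff_digits)
    with \<kappa>' have "\<forall>i\<le>m. \<kappa>' i = \<kappa> i" using j by (intro extend) auto
    thus False using \<open>\<kappa>' m = j\<close> j by simp
  qed
  have "(\<Sum>j\<in>?J. ?f j) = (\<Sum>j\<in>{\<kappa> m}. ?f j)"
  proof (rule sum.mono_neutral_right)
    show "\<forall>j\<in>?J - {\<kappa> m}. ?f j = 0" using zero by blast
    show "{\<kappa> m} \<subseteq> ?J" using step by auto
  qed auto
  moreover have "of_nat (?K choose (\<kappa> m)) \<noteq> (0 :: 'a)" using step(2) by (simp add: binomial_neq_0_iff_digits)
  moreover have "coeff (low_power_sum m (\<kappa> m) :: 'a poly) (?w - \<kappa> m) \<noteq> 0"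
  proof -
    have "coeff (low_power_sum m (\<kappa> m) :: 'a poly) (\<Sum>i<m. \<kappa> i) \<noteq> 0"
    proof (rule Suc.IH[OF chain])
      fix \<kappa>' assume "digit_chain CHAR('a) (CARD('a) - 1) m \<kappa>'" "\<kappa>' m = \<kappa> m"
        "(\<Sum>i<m. \<kappa>' i) = (\<Sum>i<m. \<kappa> i)"
      thus "\<forall>i\<le>m. \<kappa>' i = \<kappa> i" by (intro extend) (use step in simp_all)
    qed
    thus ?thesis by simp
  qed
  ultimately show ?case unfolding coeff_low_power_sum_Suc by simp
qed

text \<open>\<open>pCons 1 g\<close> is 1 + X g, the reversal of a monic polynomial of degree e; see
  \<open>sum_reflect_monic\<close>.\<close>

definition monic_power_sum :: "nat \<Rightarrow> nat \<Rightarrow> 'a :: finite_field poly" where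
  "monic_power_sum e n = (\<Sum>g\<in>low_polys e. pCons 1 g ^ n)"

text \<open>The constant term is fixed at 1 instead of summed over, so the last step from j to n
  carries neither divisibility nor strictness.\<close>

lemma coeff_monic_power_sum:
  "coeff (monic_power_sum e n :: 'a :: finite_field poly) w
    = (\<Sum>j\<le>n. of_nat (n choose j) * (if j \<le> w then coeff (low_power_sum e j) (w - j) else 0))"
proof -
  have "coeff (monic_power_sum e n :: 'a poly) w = (\<Sum>g\<in>low_polys e. \<Sum>j\<le>n.
      of_nat (n choose j) * (if j \<le> w then coeff (g ^ j) (w - j) else 0))"
    by (simp add: monic_power_sum_def coeff_sum coeff_pCons_power)
  also have "\<dots> = (\<Sum>j\<le>n. \<Sum>g\<in>low_polys e.
      of_nat (n choose j) * (if j \<le> w then coeff (g ^ j) (w - j) else 0))"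
    by (rule sum.swap)
  also have "\<dots> = (\<Sum>j\<le>n. of_nat (n choose j) * (if j \<le> w then coeff (low_power_sum e j) (w - j) else 0))"
    by (intro sum.cong refl) (simp add: low_power_sum_def coeff_sum flip: sum_distrib_left)
  finally show ?thesis .
qed

lemma coeff_monic_power_sum_nonzeroD:
  assumes "coeff (monic_power_sum e n :: 'a :: finite_field poly) w \<noteq> 0"
  shows "\<exists>\<kappa>. digit_chain CHAR('a) (CARD('a) - 1) e \<kappa> \<and>
    (\<forall>s. digit CHAR('a) (\<kappa> e) s \<le> digit CHAR('a) n s) \<and> (\<Sum>i\<le>e. \<kappa> i) = w"
proof -
  obtain j where j: "of_nat (n choose j) * (if j \<le> w then coeff (low_power_sum e j) (w - j) else 0) \<noteq> (0 :: 'a)"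
    using assms unfolding coeff_monic_power_sum by (rule sum.not_neutral_contains_not_neutral)
  hence binomial: "of_nat (n choose j) \<noteq> (0 :: 'a)" and "j \<le> w"
    and nz: "coeff (low_power_sum e j :: 'a poly) (w - j) \<noteq> 0"
    by (auto split: if_splits)
  obtain \<kappa> where "digit_chain CHAR('a) (CARD('a) - 1) e \<kappa>" "\<kappa> e = j" "(\<Sum>i<e. \<kappa> i) = w - j"
    using coeff_low_power_sum_nonzeroD[OF nz] by blast
  moreover have "\<forall>s. digit CHAR('a) j s \<le> digit CHAR('a) n s"
    using binomial by (simp add: binomial_neq_0_iff_digits)
  ultimately show ?thesis using \<open>j \<le> w\<close> by (intro exI[of _ \<kappa>]) (simp flip: lessThan_Suc_atMost)
qed

lemma coeff_monic_power_sum_nonzeroI: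
  assumes \<kappa>: "digit_chain CHAR('a) (CARD('a) - 1) e \<kappa>" "\<And>s. digit CHAR('a) (\<kappa> e) s \<le> digit CHAR('a) n s"
    and unique: "\<And>\<kappa>'. digit_chain CHAR('a) (CARD('a) - 1) e \<kappa>' \<Longrightarrow>
      (\<And>s. digit CHAR('a) (\<kappa>' e) s \<le> digit CHAR('a) n s) \<Longrightarrow>
      (\<Sum>i\<le>e. \<kappa>' i) = (\<Sum>i\<le>e. \<kappa> i) \<Longrightarrow> \<forall>i\<le>e. \<kappa>' i = \<kappa> i"
  shows "coeff (monic_power_sum e n :: 'a :: finite_field poly) (\<Sum>i\<le>e. \<kappa> i) \<noteq> 0"
proof -
  let ?w = "\<Sum>i\<le>e. \<kappa> i"
  have w: "?w = (\<Sum>i<e. \<kappa> i) + \<kappa> e" by (simp flip: lessThan_Suc_atMost)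
  let ?f = "\<lambda>j. of_nat (n choose j) * (if j \<le> ?w then coeff (low_power_sum e j :: 'a poly) (?w - j) else 0)"
  have zero: "?f j = 0" if j: "j \<noteq> \<kappa> e" for j
  proof (rule ccontr)
    assume "?f j \<noteq> 0"
    hence binomial: "of_nat (n choose j) \<noteq> (0 :: 'a)" and "j \<le> ?w"
      and nz: "coeff (low_power_sum e j :: 'a poly) (?w - j) \<noteq> 0"
      by (auto split: if_splits)
    obtain \<kappa>' where \<kappa>': "digit_chain CHAR('a) (CARD('a) - 1) e \<kappa>'" "\<kappa>' e = j" "(\<Sum>i<e. \<kappa>' i) = ?w - j"
      using coeff_low_power_sum_nonzeroD[OF nz] by blast
    have "digit CHAR('a) j s \<le> digit CHAR('a) n s" for s
      using binomial by (simp add: binomial_neq_0_iff_digits)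
    with \<kappa>' have "\<forall>i\<le>e. \<kappa>' i = \<kappa> i" using \<open>j \<le> ?w\<close> by (intro unique) (auto simp flip: lessThan_Suc_atMost)
    thus False using \<open>\<kappa>' e = j\<close> j by simp
  qed
  have "(\<Sum>j\<le>n. ?f j) = (\<Sum>j\<in>{\<kappa> e} \<inter> {..n}. ?f j)"
  proof (rule sum.mono_neutral_right)
    show "\<forall>j\<in>{..n} - {\<kappa> e} \<inter> {..n}. ?f j = 0" using zero by blast
  qed auto
  moreover have nz: "of_nat (n choose (\<kappa> e)) \<noteq> (0 :: 'a)" using \<kappa>(2) by (simp add: binomial_neq_0_iff_digits)
  hence "\<kappa> e \<le> n" by (metis binomial_eq_0 not_le of_nat_0)
  moreover have "coeff (low_power_sum e (\<kappa> e) :: 'a poly) (\<Sum>i<e. \<kappa> i) \<noteq> 0"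
    using \<kappa> by (intro coeff_low_power_sum_nonzeroI unique) (auto simp: w simp flip: lessThan_Suc_atMost)
  ultimately show ?thesis unfolding coeff_monic_power_sum using nz by (simp add: w)
qed

section \<open>Digits of p-adic integers\<close>

definition padic_trunc :: "'a :: semiring_prime_char padic_int \<Rightarrow> nat \<Rightarrow> nat" where
  "padic_trunc t N = nat (padic_res t N)"

definition padic_digit :: "'a :: semiring_prime_char padic_int \<Rightarrow> nat \<Rightarrow> nat" where
  "padic_digit t s = digit CHAR('a) (padic_trunc t (Suc s)) s"

lemma CHAR_ge_2: "2 \<le> CHAR('a :: semiring_prime_char)"
  by (rule prime_ge_2_nat) simp

lemma int_padic_trunc: "int (padic_trunc t N) = padic_res (t :: 'a :: semiring_prime_char padic_int) N"
proof -
  have "0 \<le> padic_res t N mod int CHAR('a) ^ N" by (rule pos_mod_sign) simp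
  thus ?thesis by (simp add: padic_trunc_def)
qed

lemma padic_trunc_less: "padic_trunc (t :: 'a :: semiring_prime_char padic_int) N < CHAR('a) ^ N"
proof -
  have "padic_res t N mod int CHAR('a) ^ N < int CHAR('a) ^ N" by (rule pos_mod_bound) simp
  hence "int (padic_trunc t N) < int (CHAR('a) ^ N)" by (simp add: int_padic_trunc)
  thus ?thesis by simp
qed

lemma padic_trunc_mod:
  assumes "m \<le> N"
  shows "padic_trunc (t :: 'a :: semiring_prime_char padic_int) N mod CHAR('a) ^ m = padic_trunc t m"
proof -
  have "int (padic_trunc t N mod CHAR('a) ^ m) = int (padic_trunc t m)"
    using padic_res_mod[OF assms, of t] by (simp add: int_padic_trunc zmod_int)
  thus ?thesis by simp
qed

lemma padic_trunc_inject:
  assumes "\<And>N. padic_trunc x N = padic_trunc y N"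
  shows "x = y"
proof (rule padic_int_eqI)
  fix n show "padic_res x n = padic_res y n" using assms[of n] by (simp flip: int_padic_trunc)
qed

lemma digit_mod_power:
  assumes "0 < p" "s < N"
  shows "digit p (K mod p ^ N) s = digit p K s"
proof -
  obtain d where N: "N = s + Suc d" using less_imp_Suc_add[OF assms(2)] by auto
  have "K mod p ^ N = p ^ s * (K div p ^ s mod p ^ Suc d) + K mod p ^ s"
    unfolding N power_add by (rule mod_mult2_eq)
  hence "K mod p ^ N div p ^ s = K div p ^ s mod p ^ Suc d" using assms(1) by simp
  thus ?thesis by (simp add: digit_def mod_mod_cancel)
qed

lemma digit_padic_trunc:
  "digit CHAR('a) (padic_trunc (t :: 'a :: semiring_prime_char padic_int) N) s = (if s < N then padic_digit t s else 0)"
proof (cases "s < N")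
  case True
  have "digit CHAR('a) (padic_trunc t N) s = digit CHAR('a) (padic_trunc t N mod CHAR('a) ^ Suc s) s"
    by (rule digit_mod_power[symmetric]) simp_all
  also have "\<dots> = padic_digit t s" using True by (simp add: padic_trunc_mod padic_digit_def del: power_Suc)
  finally show ?thesis using True by simp
next
  case False
  thus ?thesis using digit_eq_0[OF padic_trunc_less[of t N], of s] CHAR_ge_2[where 'a = 'a] by simp
qed

lemma padic_digit_less: "padic_digit (t :: 'a :: semiring_prime_char padic_int) s < CHAR('a)"
  unfolding padic_digit_def by (rule digit_less) (rule CHAR_ge_2)

lemma falling_product: "(\<Prod>i<k. int n - int i) = fact k * int (n choose k)"
proof -
  have "(\<Prod>i<k. real n - real i) = fact k * real (n choose k)"
    using gbinomial_mult_fact[of k "real n"] by (simp add: binomial_gbinomial atLeast0LessThan)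
  hence "real_of_int (\<Prod>i<k. int n - int i) = real_of_int (fact k * int (n choose k))" by simp
  thus ?thesis by (simp only: of_int_eq_iff)
qed

text \<open>After multiplication by k! both binomials agree modulo p ^ N. As 0 < k! < p ^ N, the
  factor k! cannot absorb all of p ^ N, and a congruence modulo p remains.\<close>

lemma padic_to_field_binomial:
  fixes t :: "'a :: finite_field padic_int"
  assumes "fact k < CHAR('a) ^ N"
  shows "padic_to_field (padic_binomial t k) = (of_nat (padic_trunc t N choose k) :: 'a)"
proof -
  define p where "p = int CHAR('a)"
  have p: "prime p" by (simp add: p_def)
  define b where "b = padic_binomial t k"
  let ?C = "int (padic_trunc t N choose k)"
  have b: "of_nat (fact k) * b = (\<Prod>i<k. t - of_nat i)"
    unfolding b_def padic_binomial_def by (rule theI'[OF padic_binomial_ex1])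
  have res_prod: "padic_res (\<Prod>i<k. t - of_nat i) N = (\<Prod>i<k. padic_res t N - int i) mod p ^ N" for k
    by (induction k) (simp_all add: padic_res_ring_ops padic_res_of_nat mod_simps p_def)
  have "[fact k * padic_res b N = fact k * ?C] (mod p ^ N)"
    using arg_cong[OF b, of "\<lambda>x. padic_res x N"] falling_product[of "padic_trunc t N" k]
    unfolding res_prod by (simp add: padic_res_ring_ops padic_res_of_nat mod_simps cong_def int_padic_trunc flip: p_def)
  hence dvd: "p ^ N dvd fact k * (padic_res b N - ?C)" by (simp add: cong_iff_dvd_diff right_diff_distrib)
  have "p dvd padic_res b N - ?C"
  proof (rule ccontr)
    assume "\<not> ?thesis"
    hence "coprime (p ^ N) (padic_res b N - ?C)" using p by (simp add: prime_imp_coprime)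
    hence "p ^ N dvd fact k" using dvd by (simp add: coprime_dvd_mult_left_iff)
    hence "p ^ N \<le> fact k" by (rule zdvd_imp_le) simp
    moreover have "int (fact k) < int (CHAR('a) ^ N)" using assms by (rule of_nat_less_iff[THEN iffD2])
    ultimately show False by (simp add: p_def)
  qed
  hence "padic_res b N mod p = ?C mod p" by (simp add: mod_eq_dvd_iff)
  moreover have "N \<noteq> 0"
  proof
    assume "N = 0"
    thus False using assms fact_ge_1[of k, where 'a = nat] by simp
  qed
  hence "padic_res b N mod p = padic_res b 1" using padic_res_mod[of 1 N b] by (simp add: p_def)
  ultimately have "[padic_res b 1 = ?C] (mod p)" by (metis cong_def mod_mod_trivial)
  hence "of_int (padic_res b 1) = (of_int ?C :: 'a)" by (simp only: of_int_eq_iff_cong_CHAR p_def)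
  thus ?thesis by (simp add: padic_to_field_def b_def)
qed

section \<open>Base q digits of p-adic integers and their permutation\<close>

lemma digit_base_power:
  assumes "0 < p" "j < r"
  shows "digit p (digit (p ^ r) K i) j = digit p K (r * i + j)"
proof -
  have "digit p (digit (p ^ r) K i) j = digit p (K div (p ^ r) ^ i mod p ^ r) j" by (simp add: digit_def)
  also have "\<dots> = digit p (K div (p ^ r) ^ i) j" by (rule digit_mod_power[OF assms])
  also have "\<dots> = digit p K (r * i + j)" by (simp add: digit_def div_mult2_eq power_add power_mult)
  finally show ?thesis .
qed

text \<open>Since p divides q, only the finitely many i with \<rho> i < n matter modulo p ^ n. This
  gives convergence in any order of the exponents, and the residue lists the coefficients by
  exponent.\<close>

lemma digit_series:
  fixes b :: "nat \<Rightarrow> nat" and \<rho> :: "nat \<Rightarrow> nat"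
  assumes "bij \<rho>" and q: "CHAR('a) dvd q"
  obtains X :: "'a :: semiring_prime_char padic_int" where "(\<lambda>i. of_nat (b i) * of_nat q ^ \<rho> i) sums X"
    "\<And>n. padic_trunc X n = (\<Sum>j<n. b (inv \<rho> j) * q ^ j) mod CHAR('a) ^ n"
proof -
  let ?p = "CHAR('a)"
  define x where "x n = int ((\<Sum>j<n. b (inv \<rho> j) * q ^ j) mod ?p ^ n)" for n
  have pq: "?p ^ n dvd q ^ m" if "n \<le> m" for n m
    using q that by (meson dvd_trans dvd_power_same le_imp_power_dvd)
  have "x (Suc n) mod int ?p ^ n = x n" for n
  proof -
    have "(\<Sum>j<Suc n. b (inv \<rho> j) * q ^ j) mod ?p ^ Suc n mod ?p ^ n = (\<Sum>j<Suc n. b (inv \<rho> j) * q ^ j) mod ?p ^ n"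
      by (rule mod_mod_cancel) simp
    also have "\<dots> = (\<Sum>j<n. b (inv \<rho> j) * q ^ j) mod ?p ^ n"
      using pq[of n n] by (simp add: mod_add_right_eq[symmetric] dvd_imp_mod_0 del: mod_add_right_eq)
    finally show ?thesis by (simp only: x_def flip: of_nat_mod of_nat_power)
  qed
  hence X: "padic_res (Abs_padic_int x :: 'a padic_int) n = x n" for n
    by (subst Abs_padic_int_inverse) auto
  define X :: "'a padic_int" where "X = Abs_padic_int x"
  have trunc: "padic_trunc X n = (\<Sum>j<n. b (inv \<rho> j) * q ^ j) mod ?p ^ n" for n
    using X[of n] by (simp add: padic_trunc_def X_def x_def)
  have "(\<lambda>i. of_nat (b i) * of_nat q ^ \<rho> i) sums X"
    unfolding sums_def tendsto_padic_int_iff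
  proof
    fix n
    \<comment> \<open>All indices i with \<rho> i < n lie below M.\<close>
    define M where "M = Suc (Max (insert 0 (inv \<rho> ` {..<n})))"
    have M: "inv \<rho> j < M" if "j < n" for j
      using that by (simp add: M_def le_imp_less_Suc)
    have "padic_res (\<Sum>i<m. of_nat (b i) * of_nat q ^ \<rho> i :: 'a padic_int) n = padic_res X n" if m: "M \<le> m" for m
    proof -
      have "[(\<Sum>i<m. b i * q ^ \<rho> i) = (\<Sum>i<m. if \<rho> i < n then b i * q ^ \<rho> i else 0)] (mod ?p ^ n)"
        using pq by (intro cong_sum) (auto simp: cong_0_iff not_less)
      also have "(\<Sum>i<m. if \<rho> i < n then b i * q ^ \<rho> i else 0) = (\<Sum>i\<in>{i. i < m \<and> \<rho> i < n}. b i * q ^ \<rho> i)"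
        by (rule sum.mono_neutral_cong_right) auto
      also have "\<dots> = (\<Sum>j<n. b (inv \<rho> j) * q ^ j)"
      proof (rule sum.reindex_bij_witness[of _ "inv \<rho>" \<rho>])
        fix j assume "j \<in> {..<n}"
        thus "inv \<rho> j \<in> {i. i < m \<and> \<rho> i < n}" using M[of j] m bij_is_surj[OF assms(1)] by (simp add: surj_f_inv_f)
      qed (use assms(1) in \<open>auto simp: bij_is_surj surj_f_inv_f bij_is_inj\<close>)
      finally have "(\<Sum>i<m. b i * q ^ \<rho> i) mod ?p ^ n = padic_trunc X n" by (simp add: cong_def trunc)
      hence res: "int (\<Sum>i<m. b i * q ^ \<rho> i) mod int ?p ^ n = padic_res X n"
        by (simp only: flip: int_padic_trunc of_nat_mod of_nat_power)
      have eq: "(\<Sum>i<m. of_nat (b i) * of_nat q ^ \<rho> i) = (of_nat (\<Sum>i<m. b i * q ^ \<rho> i) :: 'a padic_int)"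
        by simp
      show ?thesis unfolding eq padic_res_of_nat by (rule res)
    qed
    thus "\<forall>\<^sub>F m in sequentially. padic_res (\<Sum>i<m. of_nat (b i) * of_nat q ^ \<rho> i :: 'a padic_int) n = padic_res X n"
      unfolding eventually_sequentially by blast
  qed
  thus thesis using trunc by (rule that)
qed

lemma padic_trunc_digit_series:
  fixes X :: "'a :: semiring_prime_char padic_int"
  assumes r: "1 \<le> r" and c: "\<And>j. c j < CHAR('a) ^ r"
    and X: "\<And>n. padic_trunc X n = (\<Sum>j<n. c j * (CHAR('a) ^ r) ^ j) mod CHAR('a) ^ n"
  shows "padic_trunc X (r * N) = (\<Sum>j<N. c j * (CHAR('a) ^ r) ^ j)"
proof -
  let ?q = "CHAR('a) ^ r"
  have "N \<le> r * N" using r by simp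
  then obtain d where d: "r * N = N + d" using le_Suc_ex by blast
  have "(\<Sum>j<N + d. c j * ?q ^ j) = (\<Sum>j<N. c j * ?q ^ j) + ?q ^ N * (\<Sum>j<d. c (N + j) * ?q ^ j)" for d
    by (induction d) (simp_all add: algebra_simps power_add)
  from this[of d] have "padic_trunc X (r * N)
      = ((\<Sum>j<N. c j * ?q ^ j) + ?q ^ N * (\<Sum>j<d. c (N + j) * ?q ^ j)) mod ?q ^ N"
    using X[of "r * N"] unfolding power_mult d[symmetric] by (simp only:)
  also have "\<dots> = (\<Sum>j<N. c j * ?q ^ j)"
    using digits_sum_less[of c ?q N, OF c] by simp
  finally show ?thesis .
qed

lemma padic_digit_digit_series:
  fixes X :: "'a :: semiring_prime_char padic_int"
  assumes r: "1 \<le> r" and c: "\<And>j. c j < CHAR('a) ^ r"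
    and X: "\<And>n. padic_trunc X n = (\<Sum>j<n. c j * (CHAR('a) ^ r) ^ j) mod CHAR('a) ^ n"
  shows "padic_digit X s = digit CHAR('a) (c (s div r)) (s mod r)"
proof -
  let ?p = "CHAR('a)" and ?i = "s div r"
  have "digit (?p ^ r) (\<Sum>j<Suc ?i. (if j < Suc ?i then c j else 0) * (?p ^ r) ^ j) ?i = c ?i"
    by (subst digit_of_sum) (use c CHAR_ge_2[where 'a = 'a] in auto)
  moreover have "(\<Sum>j<Suc ?i. (if j < Suc ?i then c j else 0) * (?p ^ r) ^ j) = padic_trunc X (r * Suc ?i)"
    unfolding padic_trunc_digit_series[OF assms] by (intro sum.cong) auto
  ultimately have "c ?i = digit (?p ^ r) (padic_trunc X (r * Suc ?i)) ?i" by simp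
  hence "digit ?p (c ?i) (s mod r) = digit ?p (padic_trunc X (r * Suc ?i)) (r * ?i + s mod r)"
    using r CHAR_ge_2[where 'a = 'a] by (simp add: digit_base_power)
  also have "r * ?i + s mod r = s" by simp
  also have "s < r * Suc ?i" using r by (metis One_nat_def add.commute less_eq_Suc_le mult_Suc_right mod_less_divisor mult_div_mod_eq add_less_cancel_left)
  hence "digit ?p (padic_trunc X (r * Suc ?i)) s = padic_digit X s" by (simp add: digit_padic_trunc)
  finally show ?thesis by simp
qed

text \<open>This resolves the description in \<open>padic_digits\<close>. Existence and uniqueness
  of the expansion both reduce to finite sums modulo powers of q, to which
  \<open>digit_series\<close> reduces the series.\<close>

lemma padic_digits_eq:
  fixes X :: "'a :: finite_field padic_int"
  assumes r: "1 \<le> r" and q: "CARD('a) = CHAR('a) ^ r"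
  shows "padic_digits X = (\<lambda>i. digit CARD('a) (padic_trunc X (r * Suc i)) i)"
proof -
  let ?p = "CHAR('a)" and ?q = "CARD('a)"
  define c where "c i = digit ?q (padic_trunc X (r * Suc i)) i" for i
  have q2: "2 \<le> ?q" using card_finite_field_gt_1[where 'a = 'a] by simp
  have dvd: "?p dvd ?q" using r by (simp add: q dvd_power)
  have c_less: "c i < ?p ^ r" for i unfolding c_def q[symmetric] by (rule digit_less[OF q2])
  have c: "digit ?q (padic_trunc X (r * N)) i = c i" if "i < N" for i N
  proof -
    have le: "r * Suc i \<le> r * N" using that by (intro mult_le_mono2) simp
    have "c i = digit ?q (padic_trunc X (r * N) mod ?p ^ (r * Suc i)) i"
      unfolding padic_trunc_mod[OF le] c_def ..
    also have "\<dots> = digit ?q (padic_trunc X (r * N)) i"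
      unfolding power_mult q[symmetric] using q2 by (intro digit_mod_power) simp_all
    finally show ?thesis ..
  qed
  have digits: "b i = c i" if b: "\<forall>i. b i < ?q" "(\<lambda>i. of_nat (b i) * of_nat ?q ^ i) sums X" for b i
  proof -
    obtain Y :: "'a padic_int" where Y: "(\<lambda>i. of_nat (b i) * of_nat ?q ^ id i) sums Y"
      "\<And>n. padic_trunc Y n = (\<Sum>j<n. b (inv id j) * ?q ^ j) mod ?p ^ n"
      using digit_series[OF bij_id dvd, of b] by blast
    have "Y = X" using Y(1) b(2) by (simp add: sums_unique2)
    have b_less: "b j < ?p ^ r" for j using b(1) by (simp add: q)
    have "padic_trunc X (r * Suc i) = (\<Sum>j<Suc i. b j * ?q ^ j)"
      unfolding q by (rule padic_trunc_digit_series[OF r b_less]) (use Y(2) \<open>Y = X\<close> in \<open>simp add: q\<close>)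
    also have "\<dots> = (\<Sum>j<Suc i. (if j < Suc i then b j else 0) * ?q ^ j)" by (intro sum.cong) auto
    finally show ?thesis unfolding c_def by (simp only:) (subst digit_of_sum; use b(1) q2 in auto)
  qed
  have "(\<lambda>i. of_nat (c i) * of_nat ?q ^ i) sums X"
  proof -
    obtain Y :: "'a padic_int" where Y: "(\<lambda>i. of_nat (c i) * of_nat ?q ^ id i) sums Y"
      "\<And>n. padic_trunc Y n = (\<Sum>j<n. c (inv id j) * ?q ^ j) mod ?p ^ n"
      using digit_series[OF bij_id dvd, of c] by blast
    have "padic_trunc Y n = padic_trunc X n" for n
    proof -
      have "padic_trunc Y (r * n) = (\<Sum>j<n. c j * ?q ^ j)"
        unfolding q by (rule padic_trunc_digit_series[OF r c_less]) (use Y(2) in \<open>simp add: q\<close>)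
      also have "\<dots> = (\<Sum>j<n. digit ?q (padic_trunc X (r * n)) j * ?q ^ j)"
        by (intro sum.cong) (simp_all add: c)
      also have "\<dots> = padic_trunc X (r * n) mod ?q ^ n" by (rule sum_digits_mod)
      also have "\<dots> = padic_trunc X (r * n)"
        using padic_trunc_less[of X "r * n"] by (simp add: q power_mult)
      finally have eq: "padic_trunc Y (r * n) = padic_trunc X (r * n)" .
      have "n \<le> r * n" using r by simp
      from padic_trunc_mod[OF this, of X] padic_trunc_mod[OF this, of Y] eq show ?thesis by simp
    qed
    hence "Y = X" by (rule padic_trunc_inject)
    thus ?thesis using Y(1) by simp
  qed
  moreover have "\<forall>i. c i < ?q" using c_less by (simp add: q)
  ultimately have "padic_digits X = c"
    unfolding padic_digits_def
  proof (intro the_equality conjI)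
    fix b assume "(\<forall>i. b i < ?q) \<and> (\<lambda>i. of_nat (b i) * of_nat ?q ^ i) sums X"
    hence "\<forall>i. b i < ?q" "(\<lambda>i. of_nat (b i) * of_nat ?q ^ i) sums X" by blast+
    thus "b = c" by (intro ext digits)
  qed
  thus ?thesis by (simp add: c_def fun_eq_iff)
qed

text \<open>Base p positions split into blocks of length r, one for each base q digit. The
  permutation moves whole blocks, so each base p digit keeps its offset in the block.\<close>

lemma padic_digit_digit_perm:
  fixes X :: "'a :: finite_field padic_int"
  assumes r: "1 \<le> r" and q: "CARD('a) = CHAR('a) ^ r" and \<rho>: "bij \<rho>"
  shows "padic_digit (digit_perm \<rho> X) (r * \<rho> (s div r) + s mod r) = padic_digit X s"
proof -
  let ?p = "CHAR('a)" and ?q = "CARD('a)"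
  define c where "c = padic_digits X"
  have q2: "2 \<le> ?q" using card_finite_field_gt_1[where 'a = 'a] by simp
  have dvd: "?p dvd ?q" using r by (simp add: q dvd_power)
  have c_less: "c i < ?p ^ r" for i
    unfolding c_def padic_digits_eq[OF r q] q[symmetric] by (rule digit_less[OF q2])
  obtain Y :: "'a padic_int" where Y: "(\<lambda>i. of_nat (c i) * of_nat ?q ^ \<rho> i) sums Y"
    "\<And>n. padic_trunc Y n = (\<Sum>j<n. c (inv \<rho> j) * ?q ^ j) mod ?p ^ n"
    using digit_series[OF \<rho> dvd, of c] by blast
  have "digit_perm \<rho> X = Y" using sums_unique[OF Y(1)] by (simp add: digit_perm_def c_def)
  moreover have "padic_digit Y (r * \<rho> (s div r) + s mod r) = digit ?p (c (s div r)) (s mod r)"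
  proof -
    have "padic_digit Y (r * \<rho> (s div r) + s mod r)
        = digit ?p (c (inv \<rho> ((r * \<rho> (s div r) + s mod r) div r))) ((r * \<rho> (s div r) + s mod r) mod r)"
      by (rule padic_digit_digit_series[OF r c_less]) (use Y(2) in \<open>simp add: q\<close>)
    thus ?thesis using r bij_is_inj[OF \<rho>] by simp
  qed
  moreover have "padic_digit X s = digit ?p (c (s div r)) (s mod r)"
  proof -
    let ?N = "r * Suc (s div r)"
    have "s < ?N"
      using r mult_div_mod_eq[of r s] mod_less_divisor[of r s] unfolding mult_Suc_right by linarith
    hence "padic_digit X s = digit ?p (padic_trunc X ?N) (r * (s div r) + s mod r)" by (simp add: digit_padic_trunc)
    also have "\<dots> = digit ?p (digit (?p ^ r) (padic_trunc X ?N) (s div r)) (s mod r)"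
      using r CHAR_ge_2[where 'a = 'a] by (intro digit_base_power[symmetric]) simp_all
    finally show ?thesis unfolding c_def padic_digits_eq[OF r q] q .
  qed
  ultimately show ?thesis by simp
qed

section \<open>Permuting the digits of a chain\<close>

lemma permute_digits:
  assumes p: "2 \<le> p" and P: "bij P"
  shows "\<exists>K'. \<forall>s. digit p K' s = digit p K (P s)"
proof -
  define N where "N = Suc (Max (insert 0 (inv P ` {..<K})))"
  have "digit p K (P s) = 0" if "N \<le> s" for s
  proof (rule ccontr)
    assume "digit p K (P s) \<noteq> 0"
    hence "P s < K" using digit_eq_0[OF less_power_self[OF p, of K], of "P s"] p by (cases "P s < K") auto
    moreover have "inv P (P s) = s" using P by (simp add: bij_is_inj)
    ultimately have "s \<in> inv P ` {..<K}" by (metis imageI lessThan_iff)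
    hence "s < N" by (simp add: N_def le_imp_less_Suc)
    thus False using that by simp
  qed
  hence "digit p (\<Sum>s<N. digit p K (P s) * p ^ s) s = digit p K (P s)" for s
    using p by (intro digit_of_sum digit_less) auto
  thus ?thesis by blast
qed

text \<open>Modulo p ^ r - 1 the power p ^ s depends only on s mod r, which P preserves, so the sum
  over the nonzero digits is merely reindexed.\<close>

lemma permuted_digits_cong:
  assumes p: "2 \<le> p" and P: "bij P" "\<And>s. P s mod r = s mod r" and K': "\<And>s. digit p K' s = digit p K (P s)"
  shows "[K' = K] (mod (p ^ r - 1))"
proof -
  define D where "D K = {s. digit p K s \<noteq> 0}" for K
  have D_sub: "D K \<subseteq> {..<K}" for K
  proof
    fix s assume "s \<in> D K"
    thus "s \<in> {..<K}"
      using digit_eq_0[OF less_power_self[OF p, of K], of s] p by (cases "s < K") (auto simp: D_def)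
  qed
  have class_sum: "[K = (\<Sum>s\<in>D K. digit p K s * p ^ (s mod r))] (mod (p ^ r - 1))" for K
  proof -
    have "K = (\<Sum>s<K. digit p K s * p ^ s)" using less_power_self[OF p, of K] by (simp add: sum_digits_mod)
    also have "\<dots> = (\<Sum>s\<in>D K. digit p K s * p ^ s)"
      using D_sub by (intro sum.mono_neutral_right) (auto simp: D_def)
    finally have "K = (\<Sum>s\<in>D K. digit p K s * p ^ s)" .
    moreover have "[(\<Sum>s\<in>D K. digit p K s * p ^ s) = (\<Sum>s\<in>D K. digit p K s * p ^ (s mod r))] (mod (p ^ r - 1))"
      by (intro cong_sum cong_mult[OF cong_refl] power_mod_class p)
    ultimately show ?thesis by simp
  qed
  have "bij_betw P (D K') (D K)"
  proof (rule bij_betwI[of _ _ _ "inv P"])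
    show "P \<in> D K' \<rightarrow> D K" "inv P \<in> D K \<rightarrow> D K'"
      using P(1) by (auto simp: D_def K' bij_is_surj surj_f_inv_f)
  qed (use P(1) in \<open>simp_all add: bij_is_inj bij_is_surj surj_f_inv_f\<close>)
  hence "(\<Sum>s\<in>D K'. digit p K (P s) * p ^ (P s mod r)) = (\<Sum>s\<in>D K. digit p K s * p ^ (s mod r))"
    by (rule sum.reindex_bij_betw)
  hence "(\<Sum>s\<in>D K'. digit p K' s * p ^ (s mod r)) = (\<Sum>s\<in>D K. digit p K s * p ^ (s mod r))"
    by (simp add: K' P(2))
  thus ?thesis using class_sum[of K] class_sum[of K'] by (metis cong_sym cong_trans)
qed

lemma digit_chain_permute:
  assumes p: "2 \<le> p" and P: "bij P" "\<And>s. P s mod r = s mod r"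
    and \<kappa>: "digit_chain p (p ^ r - 1) e \<kappa>"
  shows "\<exists>\<kappa>'. digit_chain p (p ^ r - 1) e \<kappa>' \<and> (\<forall>m s. digit p (\<kappa>' m) s = digit p (\<kappa> m) (P s))"
proof -
  have "\<forall>m. \<exists>K'. \<forall>s. digit p K' s = digit p (\<kappa> m) (P s)" using permute_digits[OF p P(1)] by blast
  then obtain \<kappa>' where \<kappa>': "\<And>m s. digit p (\<kappa>' m) s = digit p (\<kappa> m) (P s)" by metis
  have dvd: "(p ^ r - 1) dvd \<kappa>' m" if "m \<le> e" for m
    using digit_chain_dvd[OF \<kappa> that] permuted_digits_cong[OF p P, of "\<kappa>' m" "\<kappa> m"] \<kappa>'
    by (simp add: cong_dvd_iff)
  have "digit_chain p (p ^ r - 1) e \<kappa>'"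
    unfolding digit_chain_def
  proof (intro conjI allI impI)
    have "\<kappa> 0 = 0" using \<kappa> by (simp add: digit_chain_def)
    hence "digit p (\<kappa>' 0) s = digit p 0 s" for s by (simp add: \<kappa>')
    thus "\<kappa>' 0 = 0" by (rule digits_inject[OF p])
    fix m assume m: "m < e"
    show le: "digit p (\<kappa>' m) s \<le> digit p (\<kappa>' (Suc m)) s" for s
      using \<kappa> m by (simp add: \<kappa>' digit_chain_def)
    have "\<kappa>' m \<noteq> \<kappa>' (Suc m)"
    proof
      assume eq: "\<kappa>' m = \<kappa>' (Suc m)"
      have "\<kappa> m = \<kappa> (Suc m)"
      proof (rule digits_inject[OF p])
        fix s
        obtain s' where "s = P s'" using bij_is_surj[OF P(1)] by (metis surjD)
        thus "digit p (\<kappa> m) s = digit p (\<kappa> (Suc m)) s" using eq \<kappa>'[of m s'] \<kappa>'[of "Suc m" s'] by simp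
      qed
      thus False using \<kappa> m by (auto simp: digit_chain_def)
    qed
    moreover have "\<kappa>' m \<le> \<kappa>' (Suc m)" using p le by (rule le_if_digits_le)
    ultimately show "\<kappa>' m < \<kappa>' (Suc m)" by simp
    show "(p ^ r - 1) dvd \<kappa>' (Suc m) - \<kappa>' m" using m by (intro dvd_diff_nat dvd) simp_all
  qed
  thus ?thesis using \<kappa>' by blast
qed

section \<open>Powers of 1-units\<close>

lemma one_unit_fps:
  assumes "one_unit u"
  obtains U where "u = fps_to_fls U" "fps_nth U 0 = 1"
proof -
  obtain v where v: "u - 1 = fls_X * fps_to_fls v" using assms by (auto simp: one_unit_def)
  have "u = fps_to_fls (1 + fps_X * v)" using v by (simp add: fls_times_fps_to_fls algebra_simps)
  thus thesis by (rule that) simp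
qed

lemma fps_nth_power_eq_0:
  assumes "fps_nth (U :: 'a :: comm_ring_1 fps) 0 = 1" "n < k"
  shows "fps_nth ((U - 1) ^ k) n = 0"
  using startsby_zero_power_prefix[of "U - 1" k] assms by simp

lemma dist_fps_to_fls_le:
  fixes A B :: "'a :: ring_1 fps"
  assumes "\<And>i. i < n \<Longrightarrow> fps_nth A i = fps_nth B i"
  shows "dist (fps_to_fls A) (fps_to_fls B) \<le> inverse (2 ^ n)"
proof (cases "A = B")
  case False
  hence "n \<le> subdegree (A - B)" using assms by (intro subdegree_geI) auto
  hence "inverse (2 ^ subdegree (A - B)) \<le> (inverse (2 ^ n) :: real)" by simp
  moreover have "fls_subdegree (fps_to_fls A - fps_to_fls B) = int (subdegree (A - B))"
    unfolding fps_to_fls_minus[symmetric] by (rule fls_subdegree_fls_to_fps)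
  ultimately show ?thesis using False by (simp add: dist_fls_def)
qed simp

text \<open>(U - 1) ^ k has order at least k, so every coefficient of the partial sums becomes
  stationary; in the metric of Laurent series this is convergence.\<close>

lemma one_unit_power_fps:
  fixes U :: "'a :: finite_field fps"
  assumes U: "fps_nth U 0 = 1"
  shows "one_unit_power (fps_to_fls U) t
    = fps_to_fls (Abs_fps (\<lambda>n. \<Sum>k\<le>n. padic_to_field (padic_binomial t k) * fps_nth ((U - 1) ^ k) n))"
proof -
  define c where "c k = (padic_to_field (padic_binomial t k) :: 'a)" for k
  define W where "W = Abs_fps (\<lambda>n. \<Sum>k\<le>n. c k * fps_nth ((U - 1) ^ k) n)"
  define P where "P n = (\<Sum>k<n. fps_const (c k) * (U - 1) ^ k)" for n
  have partial: "(\<Sum>k<n. fls_const (c k) * (fps_to_fls U - 1) ^ k) = fps_to_fls (P n)" for n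
  proof (induction n)
    case (Suc n)
    have "fls_const (c n) * (fps_to_fls U - 1) ^ n = fps_to_fls (fps_const (c n) * (U - 1) ^ n)"
      by (simp add: fls_times_fps_to_fls fps_to_fls_power)
    thus ?case using Suc by (simp add: P_def)
  qed (simp add: P_def)
  have agree: "fps_nth (P n) i = fps_nth W i" if "i < n" for n i
  proof -
    have "fps_nth (P n) i = (\<Sum>k<n. c k * fps_nth ((U - 1) ^ k) i)" by (simp add: P_def fps_sum_nth)
    also have "\<dots> = (\<Sum>k\<le>i. c k * fps_nth ((U - 1) ^ k) i)"
      using that fps_nth_power_eq_0[OF U] by (intro sum.mono_neutral_right) auto
    finally show ?thesis by (simp add: W_def)
  qed
  have "(\<lambda>n. fps_to_fls (P n)) \<longlonglongrightarrow> fps_to_fls W"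
    unfolding tendsto_dist_iff[of _ "fps_to_fls W"]
  proof (rule tendsto_sandwich[of "\<lambda>_. 0" _ _ "\<lambda>n. inverse (2 ^ n)"])
    show "(\<lambda>n. inverse (2 ^ n :: real)) \<longlonglongrightarrow> 0" by (rule LIMSEQ_inverse_realpow_zero) simp
    show "\<forall>\<^sub>F n in sequentially. dist (fps_to_fls (P n)) (fps_to_fls W) \<le> inverse (2 ^ n)"
      using agree by (intro always_eventually allI dist_fps_to_fls_le)
  qed (simp_all add: tendsto_const)
  hence "(\<lambda>k. fls_const (c k) * (fps_to_fls U - 1) ^ k) sums fps_to_fls W"
    unfolding sums_def partial .
  hence "one_unit_power (fps_to_fls U) t = fps_to_fls W"
    unfolding one_unit_power_def c_def by (rule sums_unique[symmetric])
  thus ?thesis by (simp add: W_def c_def)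
qed

text \<open>Only k up to w contribute to this coefficient, and for them the binomials of t agree in
  the field with those of its residue. Up to a given degree, a p-adic power is thus an ordinary
  one.\<close>

lemma nth_one_unit_power:
  fixes U :: "'a :: finite_field fps"
  assumes U: "fps_nth U 0 = 1" and w: "fact w < CHAR('a) ^ N"
  shows "fls_nth (one_unit_power (fps_to_fls U) t) (int w) = fps_nth (U ^ padic_trunc t N) w"
proof -
  let ?n = "padic_trunc t N"
  have binomial: "padic_to_field (padic_binomial t k) = (of_nat (?n choose k) :: 'a)" if "k \<le> w" for k
  proof (rule padic_to_field_binomial)
    have "fact k \<le> (fact w :: nat)" by (rule fact_mono[OF that])
    thus "fact k < CHAR('a) ^ N" using w by simp
  qed
  have "U ^ ?n = (\<Sum>k\<le>?n. fps_const (of_nat (?n choose k)) * (U - 1) ^ k)"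
    using binomial_ring[of "U - 1" 1 ?n] by (simp add: fps_of_nat)
  hence "fps_nth (U ^ ?n) w = (\<Sum>k\<le>?n. of_nat (?n choose k) * fps_nth ((U - 1) ^ k) w)"
    by (simp add: fps_sum_nth)
  also have "\<dots> = (\<Sum>k\<le>?n + w. of_nat (?n choose k) * fps_nth ((U - 1) ^ k) w)"
    by (rule sum.mono_neutral_left) (auto simp: binomial_eq_0)
  also have "\<dots> = (\<Sum>k\<le>w. of_nat (?n choose k) * fps_nth ((U - 1) ^ k) w)"
    using fps_nth_power_eq_0[OF U] by (intro sum.mono_neutral_right) auto
  also have "\<dots> = fls_nth (one_unit_power (fps_to_fls U) t) (int w)"
    by (simp add: one_unit_power_fps[OF U] binomial)
  finally show ?thesis ..
qed

lemma poly_to_fls_reflect: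
  "fls_X ^ degree f * poly_to_fls f = fps_to_fls (fps_of_poly (reflect_poly f))"
proof -
  let ?e = "degree f"
  have "poly_to_fls f = (\<Sum>i\<le>?e. fls_const (coeff f i) * fls_X_inv ^ i)"
    unfolding poly_to_fls_def by (simp add: poly_altdef coeff_map_poly degree_map_poly)
  hence nth: "fls_nth (poly_to_fls f) k = (\<Sum>i\<le>?e. if k = - int i then coeff f i else 0)" for k
    by (simp add: fls_nth_sum if_distrib[of "\<lambda>x. _ * x"] cong: if_cong)
  have "fls_nth (fls_X ^ ?e * poly_to_fls f) k = fls_nth (fps_to_fls (fps_of_poly (reflect_poly f))) k" for k
  proof -
    have "fls_nth (fls_X ^ ?e * poly_to_fls f) k = (\<Sum>i\<le>?e. if k - int ?e = - int i then coeff f i else 0)"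
      by (simp add: fls_X_power_times_conv_shift nth)
    also have "\<dots> = (if 0 \<le> k \<and> k \<le> int ?e then coeff f (nat (int ?e - k)) else 0)"
    proof -
      have "(k - int ?e = - int i) \<longleftrightarrow> (k \<le> int ?e \<and> i = nat (int ?e - k))" for i by auto
      thus ?thesis by (auto simp: sum.delta nat_le_iff cong: if_cong)
    qed
    also have "\<dots> = fls_nth (fps_to_fls (fps_of_poly (reflect_poly f))) k"
    proof (cases "0 \<le> k")
      case True
      then obtain n where k: "k = int n" using nonneg_int_cases by blast
      show ?thesis unfolding k by (auto simp: coeff_reflect_poly nat_diff_distrib')
    qed simp
    finally show ?thesis .
  qed
  thus ?thesis by (intro fls_eqI)
qed

lemma sum_reflect_monic:
  "(\<Sum>f | lead_coeff f = 1 \<and> degree f = e. reflect_poly f ^ n) = (monic_power_sum e n :: 'a :: finite_field poly)"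
proof -
  \<comment> \<open>Reversal at the fixed length e is an involution even when the constant
    coefficient vanishes, unlike reversal at the degree.\<close>
  define rv where "rv h = (\<Sum>i\<le>e. monom (coeff h (e - i)) i)" for h :: "'a poly"
  have coeff_rv: "coeff (rv h) i = (if i \<le> e then coeff h (e - i) else 0)" for h i
    by (simp add: rv_def coeff_sum)
  have rv_rv: "rv (rv h) = h" if "\<And>i. e < i \<Longrightarrow> coeff h i = 0" for h
    using that by (intro poly_eqI) (auto simp: coeff_rv not_le)
  have reflect: "reflect_poly f = rv f" if "degree f = e" for f
    using that by (intro poly_eqI) (auto simp: coeff_rv coeff_reflect_poly)
  show ?thesis
    unfolding monic_power_sum_def
  proof (rule sum.reindex_bij_witness[of _ "\<lambda>g. rv (pCons 1 g)" "\<lambda>f. poly_shift 1 (rv f)"])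
    fix f :: "'a poly" assume f: "f \<in> {f. lead_coeff f = 1 \<and> degree f = e}"
    have shift: "pCons 1 (poly_shift 1 (rv f)) = rv f"
      using f by (intro poly_eqI) (auto simp: coeff_pCons coeff_poly_shift coeff_rv split: nat.splits)
    show "rv (pCons 1 (poly_shift 1 (rv f))) = f"
      unfolding shift using f by (intro rv_rv) (auto simp: coeff_eq_0)
    show "poly_shift 1 (rv f) \<in> low_polys e"
      by (auto simp: low_polys_def coeff_poly_shift coeff_rv)
    show "pCons 1 (poly_shift 1 (rv f)) ^ n = reflect_poly f ^ n"
      unfolding shift using f by (simp add: reflect)
  next
    fix g :: "'a poly" assume g: "g \<in> low_polys e"
    have rr: "rv (rv (pCons 1 g)) = pCons 1 g"
      using g by (intro rv_rv) (auto simp: low_polys_def coeff_pCons split: nat.splits)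
    show "poly_shift 1 (rv (rv (pCons 1 g))) = g"
      unfolding rr by (intro poly_eqI) (simp add: coeff_poly_shift)
    have lead: "coeff (rv (pCons 1 g)) e = 1" by (simp add: coeff_rv)
    have "degree (rv (pCons 1 g)) = e"
      by (intro antisym degree_le le_degree) (auto simp: coeff_rv lead)
    thus "rv (pCons 1 g) \<in> {f. lead_coeff f = 1 \<and> degree f = e}" using lead by simp
  qed
qed

text \<open>All f in the sum have degree e, so the 1-unit part of \<pi> enters every term through
  the same factor V ^ e, which can be pulled out.\<close>

lemma nth_power_sum:
  fixes \<pi> :: "'a :: finite_field fls"
  assumes \<pi>: "\<pi> = fls_X * fps_to_fls V" and V: "fps_nth V 0 = 1"
  shows "k < 0 \<Longrightarrow> fls_nth (power_sum \<pi> e t) k = 0"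
    "fact w < CHAR('a) ^ N \<Longrightarrow> fls_nth (power_sum \<pi> e t) (int w)
      = fps_nth ((V ^ e) ^ padic_trunc t N * fps_of_poly (monic_power_sum e (padic_trunc t N))) w"
proof -
  let ?M = "{f :: 'a poly. lead_coeff f = 1 \<and> degree f = e}"
  define U where "U f = V ^ e * fps_of_poly (reflect_poly f)" for f
  have angle: "angle \<pi> f = fps_to_fls (U f)" and U0: "fps_nth (U f) 0 = 1" if "f \<in> ?M" for f
  proof -
    have "degree f = e" using that by simp
    hence "angle \<pi> f = fps_to_fls V ^ e * (fls_X ^ degree f * poly_to_fls f)"
      by (simp add: angle_def \<pi> power_mult_distrib mult_ac)
    thus "angle \<pi> f = fps_to_fls (U f)"
      unfolding poly_to_fls_reflect by (simp add: U_def fls_times_fps_to_fls fps_to_fls_power)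
    show "fps_nth (U f) 0 = 1" using that V by (auto simp: U_def fps_nth_power_0)
  qed
  show "fls_nth (power_sum \<pi> e t) k = 0" if "k < 0"
    unfolding power_sum_def fls_nth_sum
  proof (intro sum.neutral ballI)
    fix f :: "'a poly" assume f: "f \<in> ?M"
    show "fls_nth (one_unit_power (angle \<pi> f) t) k = 0"
      unfolding angle[OF f] one_unit_power_fps[OF U0[OF f]] using that by simp
  qed
  show "fls_nth (power_sum \<pi> e t) (int w)
      = fps_nth ((V ^ e) ^ padic_trunc t N * fps_of_poly (monic_power_sum e (padic_trunc t N))) w"
    if w: "fact w < CHAR('a) ^ N"
  proof -
    let ?n = "padic_trunc t N"
    have "fls_nth (power_sum \<pi> e t) (int w) = (\<Sum>f\<in>?M. fps_nth (U f ^ ?n) w)"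
      unfolding power_sum_def fls_nth_sum
      by (intro sum.cong refl) (simp only: angle nth_one_unit_power[OF U0 w])
    also have "\<dots> = fps_nth ((V ^ e) ^ ?n * (\<Sum>f\<in>?M. fps_of_poly (reflect_poly f ^ ?n))) w"
      by (simp add: U_def power_mult_distrib fps_of_poly_power sum_distrib_left fps_sum_nth)
    also have "(\<Sum>f\<in>?M. fps_of_poly (reflect_poly f ^ ?n)) = fps_of_poly (monic_power_sum e ?n)"
      by (simp only: fps_of_poly_sum[symmetric] sum_reflect_monic)
    finally show ?thesis .
  qed
qed

section \<open>The zero set\<close>

text \<open>A nonzero coefficient yields a chain directly. Conversely, the unique cheapest chain
  produces the lowest nonzero coefficient of the monic power sum, and the factor from the
  uniformizer, having constant coefficient 1, cannot destroy it. Hence the criterion does not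
  mention \<pi>.\<close>

theorem not_in_zero_set_iff:
  fixes \<pi> :: "'a :: finite_field fls"
  assumes \<pi>: "positive_uniformizer \<pi>"
  shows "t \<notin> zero_set \<pi> e \<longleftrightarrow>
    (\<exists>\<kappa>. digit_chain CHAR('a) (CARD('a) - 1) e \<kappa> \<and> (\<forall>s. digit CHAR('a) (\<kappa> e) s \<le> padic_digit t s))"
proof -
  let ?p = "CHAR('a)" and ?q = "CARD('a)"
  have p2: "2 \<le> ?p" by (rule CHAR_ge_2)
  obtain u where u: "one_unit u" "\<pi> = fls_X * u"
    using \<pi> by (auto simp: positive_uniformizer_def fls_inverse_X_inv)
  obtain V where V: "u = fps_to_fls V" "fps_nth V 0 = 1" by (rule one_unit_fps[OF u(1)])
  note nth = nth_power_sum[OF u(2)[unfolded V(1)] V(2)]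
  show ?thesis
  proof
    assume "t \<notin> zero_set \<pi> e"
    then obtain k where k: "fls_nth (power_sum \<pi> e t) k \<noteq> 0" by (auto simp: zero_set_def fls_eq_iff)
    have "0 \<le> k" using k nth(1)[of k e t] by (cases "k < 0") auto
    then obtain w where "k = int w" by (rule nonneg_int_cases)
    hence w: "fls_nth (power_sum \<pi> e t) (int w) \<noteq> 0" using k by simp
    define N where "N = (fact w :: nat)"
    have "fact w < ?p ^ N" unfolding N_def by (rule less_power_self[OF p2])
    hence "fps_of_poly (monic_power_sum e (padic_trunc t N) :: 'a poly) \<noteq> 0" using w nth(2)[of w N e t] by auto
    hence "(monic_power_sum e (padic_trunc t N) :: 'a poly) \<noteq> 0" by auto
    then obtain v where "coeff (monic_power_sum e (padic_trunc t N) :: 'a poly) v \<noteq> 0" by (auto simp: poly_eq_iff)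
    then obtain \<kappa> where "digit_chain ?p (?q - 1) e \<kappa>"
      "\<forall>s. digit ?p (\<kappa> e) s \<le> digit ?p (padic_trunc t N) s"
      using coeff_monic_power_sum_nonzeroD by blast
    moreover have "digit ?p (padic_trunc t N) s \<le> padic_digit t s" for s by (simp add: digit_padic_trunc)
    ultimately show "\<exists>\<kappa>. digit_chain ?p (?q - 1) e \<kappa> \<and> (\<forall>s. digit ?p (\<kappa> e) s \<le> padic_digit t s)"
      using order_trans by blast
  next
    assume "\<exists>\<kappa>. digit_chain ?p (?q - 1) e \<kappa> \<and> (\<forall>s. digit ?p (\<kappa> e) s \<le> padic_digit t s)"
    then obtain \<kappa>\<^sub>0 where \<kappa>\<^sub>0: "digit_chain ?p (?q - 1) e \<kappa>\<^sub>0" "\<And>s. digit ?p (\<kappa>\<^sub>0 e) s \<le> padic_digit t s" by blast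
    define W where "W = (\<Sum>i\<le>e. \<kappa>\<^sub>0 i)"
    \<comment> \<open>Large enough for two purposes: a chain of total at most W stays below p ^ N,
      and the coefficients up to degree W can be computed from t modulo p ^ N.\<close>
    define N where "N = W + fact W"
    have N: "W < ?p ^ N" "fact W < ?p ^ N"
      using less_power_self[OF p2, of N] by (simp_all add: N_def)
    \<comment> \<open>The digits from N on are filled up as \<open>digit_universe\<close> demands.
      Chains of total at most W do not reach them, and the minimal chain is among these because
      \<open>\<kappa>\<^sub>0\<close> has total W.\<close>
    define \<tau> where "\<tau> s = (if s < N then padic_digit t s else ?p - 1)" for s
    obtain r where r: "1 \<le> r" "?q = ?p ^ r" by (rule card_finite_field_CHAR_power)
    note card = r(2)
    interpret digit_universe ?p r \<tau>
    proof
      show "\<tau> s < ?p" for s using padic_digit_less[of t s] p2 by (simp add: \<tau>_def)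
      show "\<exists>N. \<forall>s\<ge>N. \<tau> s = ?p - 1" by (rule exI[of _ N]) (simp add: \<tau>_def)
    qed (use p2 r in auto)
    have top_le: "\<kappa> e \<le> (\<Sum>i\<le>e. \<kappa> i)" for \<kappa> :: "nat \<Rightarrow> nat" by (rule member_le_sum) auto
    have small: "digit ?p (\<kappa> e) s \<le> digit ?p (padic_trunc t N) s"
      if "(\<Sum>i\<le>e. \<kappa> i) \<le> W" "\<And>s. digit ?p (\<kappa> e) s \<le> \<tau> s" for \<kappa> s
    proof (cases "s < N")
      case True
      thus ?thesis using that(2)[of s] by (simp add: digit_padic_trunc \<tau>_def)
    next
      case False
      have "\<kappa> e < ?p ^ N" using top_le[of \<kappa>] that(1) N(1) by simp
      thus ?thesis using digit_eq_0[of "\<kappa> e" ?p N s] False p2 by simp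
    qed
    have \<tau>_ge: "digit ?p (padic_trunc t N) s \<le> \<tau> s" for s by (simp add: digit_padic_trunc \<tau>_def)
    have "digit ?p (\<kappa>\<^sub>0 e) s \<le> \<tau> s" for s
    proof (cases "s < N")
      case True
      thus ?thesis using \<kappa>\<^sub>0(2)[of s] by (simp add: \<tau>_def)
    next
      case False
      have "\<kappa>\<^sub>0 e < ?p ^ N" using top_le[of \<kappa>\<^sub>0] N(1) by (simp add: W_def)
      thus ?thesis using digit_eq_0[of "\<kappa>\<^sub>0 e" ?p N s] False p2 by simp
    qed
    then obtain \<kappa> where \<kappa>: "digit_chain ?p (?q - 1) e \<kappa>" "\<And>s. digit ?p (\<kappa> e) s \<le> \<tau> s"
      and minimal: "\<And>\<kappa>'. digit_chain ?p (?q - 1) e \<kappa>' \<Longrightarrow> (\<forall>s. digit ?p (\<kappa>' e) s \<le> \<tau> s) \<Longrightarrow>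
        (\<Sum>m\<le>e. \<kappa> m) \<le> (\<Sum>m\<le>e. \<kappa>' m) \<and> ((\<Sum>m\<le>e. \<kappa>' m) = (\<Sum>m\<le>e. \<kappa> m) \<longrightarrow> (\<forall>m\<le>e. \<kappa>' m = \<kappa> m))"
      and \<kappa>_le: "(\<Sum>m\<le>e. \<kappa> m) \<le> W"
      using unique_minimal_digit_chain[of e \<kappa>\<^sub>0] \<kappa>\<^sub>0(1) unfolding card[symmetric] W_def by blast
    define S where "S = (monic_power_sum e (padic_trunc t N) :: 'a poly)"
    define w where "w = (\<Sum>i\<le>e. \<kappa> i)"
    have chain_\<tau>: "\<forall>s. digit ?p (\<kappa>' e) s \<le> \<tau> s"
      if "\<And>s. digit ?p (\<kappa>' e) s \<le> digit ?p (padic_trunc t N) s" for \<kappa>'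
      using that \<tau>_ge order_trans by blast
    have nonzero: "coeff S w \<noteq> 0"
      unfolding S_def w_def
    proof (rule coeff_monic_power_sum_nonzeroI[OF \<kappa>(1) small[OF \<kappa>_le \<kappa>(2)]])
      fix \<kappa>' assume "digit_chain ?p (?q - 1) e \<kappa>'" "(\<Sum>i\<le>e. \<kappa>' i) = (\<Sum>i\<le>e. \<kappa> i)"
        and "\<And>s. digit ?p (\<kappa>' e) s \<le> digit ?p (padic_trunc t N) s"
      thus "\<forall>i\<le>e. \<kappa>' i = \<kappa> i" using minimal[of \<kappa>'] chain_\<tau>[of \<kappa>'] by blast
    qed
    have lower: "coeff S v = 0" if "v < w" for v
    proof (rule ccontr)
      assume "coeff S v \<noteq> 0"
      then obtain \<kappa>' where \<kappa>': "digit_chain ?p (?q - 1) e \<kappa>'" "(\<Sum>i\<le>e. \<kappa>' i) = v"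
        "\<forall>s. digit ?p (\<kappa>' e) s \<le> digit ?p (padic_trunc t N) s"
        unfolding S_def using coeff_monic_power_sum_nonzeroD by blast
      have "w \<le> (\<Sum>i\<le>e. \<kappa>' i)"
        unfolding w_def using minimal[OF \<kappa>'(1)] chain_\<tau>[of \<kappa>'] \<kappa>'(3) by blast
      thus False using that \<kappa>'(2) by simp
    qed
    have "fact w \<le> (fact W :: nat)" using \<kappa>_le by (intro fact_mono) (simp add: w_def)
    hence "fls_nth (power_sum \<pi> e t) (int w) = fps_nth ((V ^ e) ^ padic_trunc t N * fps_of_poly S) w"
      unfolding S_def using N(2) by (intro nth(2)) simp
    also have "\<dots> = (\<Sum>i=0..w. fps_nth ((V ^ e) ^ padic_trunc t N) i * coeff S (w - i))"
      by (simp add: fps_mult_nth)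
    also have "\<dots> = (\<Sum>i\<in>{0}. fps_nth ((V ^ e) ^ padic_trunc t N) i * coeff S (w - i))"
      by (rule sum.mono_neutral_right) (auto simp: lower)
    also have "\<dots> = coeff S w" using V(2) by (simp add: fps_nth_power_0)
    finally have "fls_nth (power_sum \<pi> e t) (int w) \<noteq> 0" using nonzero by simp
    thus "t \<notin> zero_set \<pi> e" by (auto simp: zero_set_def)
  qed
qed

theorem corollary5:
  fixes \<pi> :: "'a :: finite_field fls" and e :: nat
    and \<sigma> :: "'a padic_int \<Rightarrow> 'a padic_int" and t :: "'a padic_int"
  assumes "positive_uniformizer \<pi>"
    and "\<sigma> \<in> digit_perms"
    and "t \<in> zero_set \<pi> e"
  shows "\<sigma> t \<in> zero_set \<pi> e"
proof (rule ccontr)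
  let ?p = "CHAR('a)"
  obtain \<rho> where \<rho>: "bij \<rho>" "\<sigma> = digit_perm \<rho>" using assms(2) by (auto simp: digit_perms_def)
  obtain r where r: "1 \<le> r" "CARD('a) = ?p ^ r" by (rule card_finite_field_CHAR_power)
  \<comment> \<open>The base p form of \<rho>: blocks of length r are moved, offsets inside a block
    are kept.\<close>
  define P where "P s = r * \<rho> (s div r) + s mod r" for s
  have "bij P"
  proof (rule o_bij[of "\<lambda>s. r * inv \<rho> (s div r) + s mod r"])
    show "(\<lambda>s. r * inv \<rho> (s div r) + s mod r) \<circ> P = id"
      using r \<rho>(1) by (simp add: P_def fun_eq_iff bij_is_inj)
    show "P \<circ> (\<lambda>s. r * inv \<rho> (s div r) + s mod r) = id"
      using r \<rho>(1) by (simp add: P_def fun_eq_iff bij_is_surj surj_f_inv_f)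
  qed
  have P_mod: "P s mod r = s mod r" for s using r by (simp add: P_def)
  assume "\<sigma> t \<notin> zero_set \<pi> e"
  then obtain \<kappa> where \<kappa>: "digit_chain ?p (?p ^ r - 1) e \<kappa>" "\<And>s. digit ?p (\<kappa> e) s \<le> padic_digit (\<sigma> t) s"
    using not_in_zero_set_iff[OF assms(1), of "\<sigma> t" e] unfolding r(2) by blast
  \<comment> \<open>Digit s of t is digit P s of \<sigma> t, so pulling the chain back along P turns
    a chain below \<sigma> t into one below t.\<close>
  obtain \<kappa>' where \<kappa>': "digit_chain ?p (?p ^ r - 1) e \<kappa>'" "\<And>m s. digit ?p (\<kappa>' m) s = digit ?p (\<kappa> m) (P s)"
    using digit_chain_permute[OF CHAR_ge_2 \<open>bij P\<close> P_mod \<kappa>(1)] by blast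
  have "digit ?p (\<kappa>' e) s \<le> padic_digit t s" for s
    using \<kappa>(2)[of "P s"] padic_digit_digit_perm[OF r \<rho>(1), of t s] by (simp add: \<kappa>'(2) \<rho>(2) P_def)
  hence "t \<notin> zero_set \<pi> e"
    using not_in_zero_set_iff[OF assms(1), of t e] \<kappa>'(1) unfolding r(2) by blast
  thus False using assms(3) by contradiction
qed

end
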